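(* Let $\phi=\frac1N\sum_{i=1}^N\phi_i$ and let Assumptions (A1)–(A4) of the context hold. Let $\{\mathbf{x}_k\}$ be the infinite sequence generated by the LSOS algorithm described in the context. Then $$\liminf_{k\to\infty}\|\nabla\phi(\mathbf{x}_k)\|=0\quad\text{almost surely.}$$ Furthermore, if $K_f\le K_{\max}$ (i.e. the counter $K_f$ never exceeds $K_{\max}$ during the run, so that the algorithm never switches to the predefined step lengths $\alpha_k$), then $$\lim_{k\to\infty}\|\nabla\phi(\mathbf{x}_k)\|=0\quad\text{almost surely,}$$ and each limit point of $\{\mathbf{x}_k\}$ is almost surely a stationary point for the problem of minimizing $\phi$ over $\mathbb{R}^n$.
   Context: **Problem.** Minimize $\phi(\mathbf{x})=\frac1N\sum_{i=1}^N\phi_i(\mathbf{x})$ over $\mathbf{x}\in\mathbb{R}^n$, where each $\phi_i:\mathbb{R}^n\to\mathbb{R}$ is twice continuously differentiable (no convexity is assumed). Let $\mathcal{N}=\{1,\dots,N\}$. For a nonempty subset $\mathcal{M}\subset\mathcal{N}$ with cardinality $M$, put $f_{\mathcal{M}}(\mathbf{x})=\frac1M\sum_{i\in\mathcal{M}}\phi_i(\mathbf{x})$ and $\mathbf{g}_{\mathcal{M}}(\mathbf{x})=\frac1M\sum_{i\in\mathcal{M}}\nabla\phi_i(\mathbf{x})$. $\|\cdot\|$ is the Euclidean norm. **LSOS algorithm.** Given: $\mathbf{x}_0\in\mathbb{R}^n$, $B_0\in\mathbb{R}^{n\times n}$, $\eta,\beta\in(0,1)$, sequences $\{\alpha_k\},\{\zeta_k\}$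 of positive reals and $\{\delta_k\}$ of nonnegative reals, constants $c_{\min}>0$, $C_{\max}>0$, and $K_{\max}\in\mathbb{N}$. Initialize $K_f=0$, $ind=0$, $k=0$. The algorithm is run indefinitely; iteration $k$ is: 1. Choose a sample $\mathcal{N}_k\subset\mathcal{N}$ randomly and uniformly, and compute an approximation $\mathbf{g}_k=\mathbf{g}_k(\mathbf{x}_k)$ of $\nabla\phi(\mathbf{x}_k)$ (for instance $\mathbf{g}_{\mathcal{N}_k}(\mathbf{x}_k)$, but other approximations are allowed). 2. Find a direction $\mathbf{d}_k$ such that $\|B_k\mathbf{d}_k+\mathbf{g}_k\|\le\delta_k\|\mathbf{g}_k\|$. 3. If $ind=0$: find the smallest integer $j\ge0$ such that $t_k=\beta^j$ satisfies $$f_{\mathcal{N}_k}(\mathbf{x}_k+t_k\mathbf{d}_k)\le f_{\mathcal{N}_k}(\mathbf{x}_k)+\eta\,t_k\,\mathbf{g}_k^\top\mathbf{d}_k+\zeta_k,$$ and set $\bar{\mathbf{x}}_k=\mathbf{x}_k+t_k\mathbf{d}_k$. Then choose a new sample $\mathcal{D}_k\subset\mathcal{N}$ (of arbitrary size $\ge1$) randomly and uniformly, independently of the past and of $\mathcal{N}_k$. If $$f_{\mathcal{D}_k}(\bar{\mathbf{x}}_k)\le f_{\mathcal{D}_k}(\mathbf{x}_k)-c_{\min}\|\mathbf{g}_{\mathcal{D}_k}(\mathbf{x}_k)\|^2+C_{\max}\zeta_k,$$ set $\mathbf{x}_{k+1}=\bar{\mathbf{x}}_k$; otherwise set $\mathbf{x}_{k+1}=\mathbf{x}_k$,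 increase $K_f$ by $1$, and if now $K_f>K_{\max}$ set $ind=1$. 4. Otherwise ($ind=1$): set $t_k=\alpha_k$ and $\mathbf{x}_{k+1}=\mathbf{x}_k+\alpha_k\mathbf{d}_k$. 5. Compute the next Hessian approximation $B_{k+1}$, and increase $k$ by $1$. So $B_k$ is available at the start of iteration $k$, before $\mathcal{N}_k$ is drawn. **Notation and standing assumption.** $\mathcal{F}_k$ is the $\sigma$-algebra generated by $\mathbf{x}_0,\dots,\mathbf{x}_k$. It is assumed throughout that $\mathbf{g}_k$ and $B_k$ are conditionally independent given $\mathcal{F}_k$, in the sense that $\mathbb{E}(B_k\mathbf{g}_k\mid\mathcal{F}_k)=B_k\,\mathbb{E}(\mathbf{g}_k\mid\mathcal{F}_k)$. **Assumptions.** (A1) $\phi$ is bounded from below by $\phi^*$, and the functions $\phi_i$ have Lipschitz-continuous gradients with Lipschitz constant $L$. (A2) There exist $\mu,L>0$ (the same $L$ as in (A1), without loss of generality) such that $\mu I\preceq B_k\preceq LI$ for all $k$ ($B_k$ symmetric). (A3) There is a constant $\bar c_1>0$ such that for all $k$: $\mathbb{E}(\mathbf{g}_k\mid\mathcal{F}_k)=\nabla\phi(\mathbf{x}_k)$ and $\mathbb{E}(\|\nabla\phi(\mathbf{x}_k)-\mathbf{g}_k\|^2\mid\mathcal{F}_k)\le\bar c_1$. (A4) $\sum_{k=1}^\infty\zeta_k<\infty$; $\sum_{k=0}^\infty\alpha_k=\infty$; $\sum_{k=1}^\infty\alpha_k^2<\infty$; $\delta_k\to0$; $\sum_{k=1}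^\infty\delta_k\alpha_k<\infty$.
   Formalization: The standing assumption is taken as genuine conditional independence of g_k and B_k given F_k together with the displayed identity E(B_k g_k|F_k)=B_k E(g_k|F_k); with the displayed identity alone the claim is false. *)

theory Defs
  imports "HOL-Probability.Probability"
begin

section \<open>Objective and sampled objectives\<close>

definition gradient :: "(real ^ 'n \<Rightarrow> real) \<Rightarrow> real ^ 'n \<Rightarrow> real ^ 'n" where
  "gradient f x = (THE D. GDERIV f x :> D)"

definition twice_continuously_differentiable :: "(real ^ 'n \<Rightarrow> real) \<Rightarrow> bool" where
  "twice_continuously_differentiable f \<longleftrightarrow>
     (\<forall>x. \<exists>D. GDERIV f x :> D) \<and>
     (\<exists>H :: real ^ 'n \<Rightarrow> real ^ 'n ^ 'n.
        (\<forall>x. (gradient f has_derivative (\<lambda>h. H x *v h)) (at x)) \<and> continuous_on UNIV H)"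

definition sample_fun :: "(nat \<Rightarrow> real ^ 'n \<Rightarrow> real) \<Rightarrow> nat set \<Rightarrow> real ^ 'n \<Rightarrow> real" where
  "sample_fun \<phi> S x = (1 / real (card S)) * (\<Sum>i\<in>S. \<phi> i x)"

definition sample_grad :: "(nat \<Rightarrow> real ^ 'n \<Rightarrow> real) \<Rightarrow> nat set \<Rightarrow> real ^ 'n \<Rightarrow> real ^ 'n" where
  "sample_grad \<phi> S x = (1 / real (card S)) *\<^sub>R (\<Sum>i\<in>S. gradient (\<phi> i) x)"

abbreviation full_fun :: "(nat \<Rightarrow> real ^ 'n \<Rightarrow> real) \<Rightarrow> nat \<Rightarrow> real ^ 'n \<Rightarrow> real" where
  "full_fun \<phi> N \<equiv> sample_fun \<phi> {1..N}"

definition loewner_le :: "real ^ 'n ^ 'n \<Rightarrow> real ^ 'n ^ 'n \<Rightarrow> bool" where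
  "loewner_le A B \<longleftrightarrow> transpose (B - A) = B - A \<and> (\<forall>v. 0 \<le> v \<bullet> ((B - A) *v v))"


section \<open>One iteration of LSOS, along a single sample path\<close>

definition line_search_condition ::
  "(nat \<Rightarrow> real ^ 'n \<Rightarrow> real) \<Rightarrow> nat set \<Rightarrow> real \<Rightarrow> real \<Rightarrow> real ^ 'n \<Rightarrow> real ^ 'n \<Rightarrow> real ^ 'n \<Rightarrow> real \<Rightarrow> bool"
  where
  "line_search_condition \<phi> S \<eta> \<zeta> x g d t \<longleftrightarrow>
     sample_fun \<phi> S (x + t *\<^sub>R d) \<le> sample_fun \<phi> S x + \<eta> * t * (g \<bullet> d) + \<zeta>"

definition acceptance_condition ::
  "(nat \<Rightarrow> real ^ 'n \<Rightarrow> real) \<Rightarrow> nat set \<Rightarrow> real \<Rightarrow> real \<Rightarrow> real \<Rightarrow> real ^ 'n \<Rightarrow> real ^ 'n \<Rightarrow> bool"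
  where
  "acceptance_condition \<phi> D c C \<zeta> x xbar \<longleftrightarrow>
     sample_fun \<phi> D xbar \<le> sample_fun \<phi> D x - c * (norm (sample_grad \<phi> D x))\<^sup>2 + C * \<zeta>"

text \<open>
  The last two arguments are the states (iterate, K_f, ind) before and after the iteration;
  a is the predefined step length, S and D are the two samples.  When ind = 1 the set D plays no role.
\<close>

definition LSOS_iteration ::
  "(nat \<Rightarrow> real ^ 'n \<Rightarrow> real) \<Rightarrow> real \<Rightarrow> real \<Rightarrow> real \<Rightarrow> real \<Rightarrow> nat \<Rightarrow>
   real \<Rightarrow> real \<Rightarrow> real \<Rightarrow> nat set \<Rightarrow> nat set \<Rightarrow>
   real ^ 'n ^ 'n \<Rightarrow> real ^ 'n \<Rightarrow> real ^ 'n \<Rightarrow> real \<Rightarrow>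
   (real ^ 'n) \<times> nat \<times> nat \<Rightarrow> (real ^ 'n) \<times> nat \<times> nat \<Rightarrow> bool"
  where
  "LSOS_iteration \<phi> \<eta> \<beta> c C Kmax a \<zeta> \<delta> S D B g d t = (\<lambda>(x, Kf, ind) (x', Kf', ind').
     norm (B *v d + g) \<le> \<delta> * norm g \<and>
     (if ind = 0 then
        (\<exists>j. t = \<beta> ^ j \<and> line_search_condition \<phi> S \<eta> \<zeta> x g d (\<beta> ^ j) \<and>
             (\<forall>i<j. \<not> line_search_condition \<phi> S \<eta> \<zeta> x g d (\<beta> ^ i))) \<and>
        (if acceptance_condition \<phi> D c C \<zeta> x (x + t *\<^sub>R d)
         then x' = x + t *\<^sub>R d \<and> Kf' = Kf \<and> ind' = ind
         else x' = x \<and> Kf' = Kf + 1 \<and> ind' = (if Kf' > Kmax then 1 else ind))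
      else t = a \<and> x' = x + a *\<^sub>R d \<and> Kf' = Kf \<and> ind' = ind))"


section \<open>Sigma-algebras, sampling, conditional expectation\<close>

definition preimages :: "'w measure \<Rightarrow> ('w \<Rightarrow> 'b) \<Rightarrow> 'b measure \<Rightarrow> 'w set set" where
  "preimages M X T = {X -` A \<inter> space M | A. A \<in> sets T}"

definition iterate_algebra ::
  "'w measure \<Rightarrow> (nat \<Rightarrow> 'w \<Rightarrow> real ^ 'n) \<Rightarrow> nat \<Rightarrow> 'w measure" where
  "iterate_algebra M x k = sigma (space M) (\<Union>j\<le>k. preimages M (x j) borel)"

text \<open>
  Everything produced before the first sample of iteration k is drawn.  The step lengths, K_f and ind
  are functions of the listed variables.
\<close>

definition history_events where
  "history_events M x B S g d D k =
     (\<Union>j\<le>k. preimages M (x j) borel \<union> preimages M (B j) borel) \<union>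
     (\<Union>j<k. preimages M (S j) (count_space UNIV) \<union> preimages M (g j) borel \<union>
             preimages M (d j) borel \<union> preimages M (D j) (count_space UNIV))"

definition history_algebra ::
  "'w measure \<Rightarrow> (nat \<Rightarrow> 'w \<Rightarrow> real ^ 'n) \<Rightarrow> (nat \<Rightarrow> 'w \<Rightarrow> real ^ 'n ^ 'n) \<Rightarrow>
   (nat \<Rightarrow> 'w \<Rightarrow> nat set) \<Rightarrow> (nat \<Rightarrow> 'w \<Rightarrow> real ^ 'n) \<Rightarrow> (nat \<Rightarrow> 'w \<Rightarrow> real ^ 'n) \<Rightarrow>
   (nat \<Rightarrow> 'w \<Rightarrow> nat set) \<Rightarrow> nat \<Rightarrow> 'w measure" where
  "history_algebra M x B S g d D k = sigma (space M) (history_events M x B S g d D k)"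

text \<open>Everything produced before the second sample of iteration k is drawn.\<close>

definition mid_history_algebra ::
  "'w measure \<Rightarrow> (nat \<Rightarrow> 'w \<Rightarrow> real ^ 'n) \<Rightarrow> (nat \<Rightarrow> 'w \<Rightarrow> real ^ 'n ^ 'n) \<Rightarrow>
   (nat \<Rightarrow> 'w \<Rightarrow> nat set) \<Rightarrow> (nat \<Rightarrow> 'w \<Rightarrow> real ^ 'n) \<Rightarrow> (nat \<Rightarrow> 'w \<Rightarrow> real ^ 'n) \<Rightarrow>
   (nat \<Rightarrow> 'w \<Rightarrow> nat set) \<Rightarrow> nat \<Rightarrow> 'w measure" where
  "mid_history_algebra M x B S g d D k =
     sigma (space M)
       (history_events M x B S g d D k \<union> preimages M (S k) (count_space UNIV) \<union>
        preimages M (g k) borel \<union> preimages M (d k) borel)"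

text \<open>
  A nonempty random subset of {1..N} that, given the events of H, is uniform among the subsets of its own
  size; the size itself is arbitrary (a fixed number, or random).
\<close>

definition uniform_sample :: "'w measure \<Rightarrow> 'w measure \<Rightarrow> nat \<Rightarrow> ('w \<Rightarrow> nat set) \<Rightarrow> bool" where
  "uniform_sample M H N S \<longleftrightarrow>
     S \<in> measurable M (count_space (Pow {1..N} - {{}})) \<and>
     (\<forall>A\<in>sets H. \<forall>U V. U \<subseteq> {1..N} \<longrightarrow> V \<subseteq> {1..N} \<longrightarrow> card U = card V \<longrightarrow>
        measure M {\<omega>\<in>A. S \<omega> = U} = measure M {\<omega>\<in>A. S \<omega> = V})"

definition independent_of_algebra :: "'w measure \<Rightarrow> 'w measure \<Rightarrow> ('w \<Rightarrow> nat set) \<Rightarrow> bool" where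
  "independent_of_algebra M H S \<longleftrightarrow>
     prob_space.indep_set M (preimages M S (count_space UNIV)) (sets H)"

text \<open>The library's conditional expectation is scalar; vectors are treated componentwise.\<close>

definition vec_cond_exp ::
  "'w measure \<Rightarrow> 'w measure \<Rightarrow> ('w \<Rightarrow> real ^ 'n) \<Rightarrow> 'w \<Rightarrow> real ^ 'n" where
  "vec_cond_exp M F f \<omega> = (\<chi> i. real_cond_exp M F (\<lambda>\<omega>. f \<omega> $ i) \<omega>)"

definition cond_indep :: "'w measure \<Rightarrow> 'w measure \<Rightarrow>
   ('w \<Rightarrow> 'b::topological_space) \<Rightarrow> ('w \<Rightarrow> 'c::topological_space) \<Rightarrow> bool" where
  "cond_indep M F X Y \<longleftrightarrow>
     (\<forall>A\<in>sets borel. \<forall>C\<in>sets borel. AE \<omega> in M.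
        real_cond_exp M F (indicat_real {\<omega>\<in>space M. X \<omega> \<in> A \<and> Y \<omega> \<in> C}) \<omega> =
        real_cond_exp M F (indicat_real {\<omega>\<in>space M. X \<omega> \<in> A}) \<omega> *
        real_cond_exp M F (indicat_real {\<omega>\<in>space M. Y \<omega> \<in> C}) \<omega>)"

text \<open>
  The displayed identity alone constrains only the action of B on the conditional mean of g, so that B may
  still be correlated with the noise in g through directions it does not see, and E(B^-1 g | F) need not
  be a descent direction in expectation; hence conditional independence proper is required as well.
\<close>

definition cond_indep_gradient_matrix ::
  "'w measure \<Rightarrow> 'w measure \<Rightarrow> ('w \<Rightarrow> real ^ 'n) \<Rightarrow> ('w \<Rightarrow> real ^ 'n ^ 'n) \<Rightarrow> bool" where
  "cond_indep_gradient_matrix M F g B \<longleftrightarrow>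
     cond_indep M F g B \<and>
     (AE \<omega> in M. vec_cond_exp M F (\<lambda>\<omega>. B \<omega> *v g \<omega>) \<omega> = B \<omega> *v vec_cond_exp M F g \<omega>)"

end

theory Submission
  imports Defs
begin

text \<open>
  While the line search is active, at most Kmax + 1 trial points are rejected.  In every iteration some sample
  size has probability bounded away from zero, and the second sample is independent of the past, so
  Borel--Cantelli shows that, if the switch never happens, eventually all samples of that size would accept
  the trial point.  Averaging the acceptance tests over these samples gives a descent inequality for
  \<open>\<phi>\<close> itself, so the squared gradients are summable.

  After the switch the iteration is stochastic gradient descent, but the noise is controlled only given the
  iterates, and these need not reveal whether the switch has happened.  The bias caused by this is small
  wherever the conditional probability of having switched is close to one.  On paths whose gradients stay away
  from zero this holds eventually, by a maximal inequality, because such paths almost surely do switch.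
  A bounded concave transform of the objective gap then serves as a Lyapunov function: it is insensitive to
  the unbounded gap at the switching time, and it keeps the mass of the gap from escaping to infinity, which
  contradicts the divergence of the sum of the step lengths.
\<close>

section \<open>Smooth functions and matrix inverses\<close>

text \<open>The direction solves \<open>B d = - g\<close> up to the residual, so the first-order
  term of the descent estimate contains the inverse of \<open>B\<close> applied to the noise, while
  \<open>B\<close> need not be measurable with respect to the iterates. Conditional independence is
  therefore transferred to the entries of the inverse, as Borel functions of the matrix. It yields
  orthogonality only against weights measurable with respect to the iterates. The event that the
  switch has happened need not be such a weight, so a supermartingale started at the switch is not
  directly available; the indicator of this event is dropped from the linear noise term and the
  error is absorbed into the descent. The acceptance test bounds a sampled objective, not
  \<open>\<phi>\<close>, so it gives no control of the mean gap at the random switching time. For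
  this reason no estimate presupposes that objective values or gradients along the iterates are
  integrable: each one is tested against a bounded weight that also keeps the weighted squared
  gradient bounded.\<close>

lemma gradient_eq:
  assumes "GDERIV f x :> D"
  shows "gradient f x = D"
  unfolding gradient_def
proof (rule the_equality)
  show "GDERIV f x :> D" by fact
next
  fix D' assume "GDERIV f x :> D'"
  then have "(\<lambda>h. inner h D') = (\<lambda>h. inner h D)"
    using assms unfolding gderiv_def by (rule has_derivative_unique)
  then have "inner h D' = inner h D" for h by metis
  then show "D' = D" by (metis inner_commute vector_eq_rdot)
qed

lemma twice_continuously_differentiable_GDERIV:
  assumes "twice_continuously_differentiable f"
  shows "GDERIV f x :> gradient f x"
  using assms gradient_eq unfolding twice_continuously_differentiable_def by metis

lemma GDERIV_sample_fun:
  assumes "\<And>i. i \<in> S \<Longrightarrow> twice_continuously_differentiable (\<phi> i)"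
  shows "GDERIV (sample_fun \<phi> S) x :> sample_grad \<phi> S x"
proof -
  have "(\<phi> i has_derivative (\<lambda>h. inner h (gradient (\<phi> i) x))) (at x)" if "i \<in> S" for i
    using twice_continuously_differentiable_GDERIV[OF assms[OF that]] by (simp add: gderiv_def)
  then have "((\<lambda>x. (1 / real (card S)) * (\<Sum>i\<in>S. \<phi> i x)) has_derivative
      (\<lambda>h. (1 / real (card S)) * (\<Sum>i\<in>S. inner h (gradient (\<phi> i) x)))) (at x)"
    by (intro has_derivative_mult_right has_derivative_sum) auto
  then show ?thesis
    unfolding gderiv_def sample_fun_def sample_grad_def
    by (simp add: inner_sum_right sum_divide_distrib)
qed

lemma lipschitz_sample_grad:
  assumes "\<And>i. i \<in> S \<Longrightarrow> L-lipschitz_on UNIV (gradient (\<phi> i))" and "finite S" "S \<noteq> {}"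
  shows "L-lipschitz_on UNIV (sample_grad \<phi> S)"
proof (rule lipschitz_onI)
  from assms obtain i where "i \<in> S" by auto
  then show "0 \<le> L" using assms(1) lipschitz_on_nonneg by blast
  fix x y
  have c: "real (card S) > 0" using assms by (simp add: card_gt_0_iff)
  have "norm (\<Sum>i\<in>S. gradient (\<phi> i) x - gradient (\<phi> i) y) \<le> (\<Sum>i\<in>S. L * dist x y)"
    using assms(1) by (intro sum_norm_le) (auto simp: lipschitz_on_def dist_norm)
  then have "norm (\<Sum>i\<in>S. gradient (\<phi> i) x - gradient (\<phi> i) y) \<le> real (card S) * (L * dist x y)" by simp
  moreover have "sample_grad \<phi> S x - sample_grad \<phi> S y =
      (1 / real (card S)) *\<^sub>R (\<Sum>i\<in>S. gradient (\<phi> i) x - gradient (\<phi> i) y)"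
    by (simp add: sample_grad_def sum_subtractf scaleR_diff_right)
  ultimately show "dist (sample_grad \<phi> S x) (sample_grad \<phi> S y) \<le> L * dist x y"
    using c by (simp add: dist_norm field_simps)
qed

text \<open>The difference \<open>q\<close> between \<open>f\<close> and its quadratic majorant
  along the segment has nonpositive derivative, by Cauchy-Schwarz and the Lipschitz bound.
  Monotonicity of \<open>q\<close> replaces an integral of the gradient along the segment.\<close>

lemma descent_lemma:
  fixes f :: "'a::real_inner \<Rightarrow> real"
  assumes G: "\<And>x. GDERIV f x :> G x" and L: "L-lipschitz_on UNIV G"
  shows "f (x + h) \<le> f x + inner h (G x) + L / 2 * (norm h)\<^sup>2"
proof -
  define q where "q s = f (x + s *\<^sub>R h) - s * inner h (G x) - L / 2 * s\<^sup>2 * (norm h)\<^sup>2" for s :: real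
  have "q 1 \<le> q 0"
  proof (rule DERIV_nonpos_imp_nonincreasing[of 0 1 q])
    fix s :: real assume s: "0 \<le> s" "s \<le> 1"
    have "((\<lambda>s. f (x + s *\<^sub>R h)) has_derivative (\<lambda>r. inner (r *\<^sub>R h) (G (x + s *\<^sub>R h)))) (at s)"
      by (rule has_derivative_compose[where f = "\<lambda>s. x + s *\<^sub>R h" and f' = "\<lambda>r. r *\<^sub>R h"])
        (use G in \<open>auto simp: gderiv_def intro!: derivative_eq_intros\<close>)
    then have "((\<lambda>s. f (x + s *\<^sub>R h)) has_real_derivative inner h (G (x + s *\<^sub>R h))) (at s)"
      by (simp add: has_field_derivative_def mult_commute_abs)
    then have D: "(q has_real_derivative
        inner h (G (x + s *\<^sub>R h)) - inner h (G x) - L * s * (norm h)\<^sup>2) (at s)"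
      unfolding q_def by (auto intro!: derivative_eq_intros)
    have "inner h (G (x + s *\<^sub>R h) - G x) \<le> norm h * norm (G (x + s *\<^sub>R h) - G x)"
      by (rule norm_cauchy_schwarz)
    moreover have "norm (G (x + s *\<^sub>R h) - G x) \<le> L * (s * norm h)"
      using lipschitz_onD[OF L, of "x + s *\<^sub>R h" x] s by (simp add: dist_norm)
    then have "norm h * norm (G (x + s *\<^sub>R h) - G x) \<le> norm h * (L * (s * norm h))"
      by (intro mult_left_mono) auto
    ultimately have "inner h (G (x + s *\<^sub>R h)) - inner h (G x) - L * s * (norm h)\<^sup>2 \<le> 0"
      by (simp add: inner_diff_right power2_eq_square algebra_simps)
    with D show "\<exists>y. DERIV q s :> y \<and> y \<le> 0" by blast
  qed simp
  then show ?thesis by (simp add: q_def)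
qed

text \<open>A gradient step of length \<open>1 / L\<close>, the minimizer of the quadratic majorant,
  cannot go below the lower bound. Later this lets a weight that damps the objective gap also damp
  the squared gradient.\<close>

lemma norm_gradient_le:
  fixes f :: "'a::real_inner \<Rightarrow> real"
  assumes G: "\<And>x. GDERIV f x :> G x" and L: "L-lipschitz_on UNIV G" "0 < L" and low: "\<And>y. low \<le> f y"
  shows "(norm (G x))\<^sup>2 \<le> 2 * L * (f x - low)"
proof -
  have "low \<le> f (x + (- (1 / L)) *\<^sub>R G x)" by (rule low)
  also have "\<dots> \<le> f x + inner ((- (1 / L)) *\<^sub>R G x) (G x) + L / 2 * (norm ((- (1 / L)) *\<^sub>R G x))\<^sup>2"
    by (rule descent_lemma[OF G L(1)])
  also have "\<dots> = f x - (norm (G x))\<^sup>2 / (2 * L)"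
    using L(2) by (simp add: dot_square_norm power_mult_distrib field_simps power2_eq_square)
  finally show ?thesis using L(2) by (simp add: field_simps)
qed

section \<open>Inverses of symmetric matrices between two positive multiples of the identity\<close>

lemma matrix_inv_right:
  fixes A :: "real ^ 'n ^ 'n"
  assumes "invertible A"
  shows "A ** matrix_inv A = mat 1"
  using someI_ex[OF assms[unfolded invertible_def]] by (simp add: matrix_inv_def)

context
  fixes B :: "real ^ 'n ^ 'n" and \<mu> L :: real
  assumes sym: "transpose B = B" and low: "loewner_le (mat \<mu>) B" and up: "loewner_le B (mat L)"
    and \<mu>: "0 < \<mu>" and L: "0 < L"
begin

lemma loewner_quad_lower: "\<mu> * (norm v)\<^sup>2 \<le> inner v (B *v v)"
proof -
  have "0 \<le> inner v ((B - mat \<mu>) *v v)" using low by (simp add: loewner_le_def)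
  moreover have "(mat \<mu> :: real ^ 'n ^ 'n) *v v = \<mu> *\<^sub>R v"
    by (simp add: vec_eq_iff matrix_vector_mult_def mat_def if_distrib[of "\<lambda>a. a * _"] cong: if_cong)
  ultimately show ?thesis
    by (simp add: matrix_vector_mult_diff_rdistrib inner_diff_right power2_norm_eq_inner)
qed

lemma loewner_quad_upper: "inner v (B *v v) \<le> L * (norm v)\<^sup>2"
proof -
  have "0 \<le> inner v ((mat L - B) *v v)" using up by (simp add: loewner_le_def)
  moreover have "(mat L :: real ^ 'n ^ 'n) *v v = L *\<^sub>R v"
    by (simp add: vec_eq_iff matrix_vector_mult_def mat_def if_distrib[of "\<lambda>a. a * _"] cong: if_cong)
  ultimately show ?thesis
    by (simp add: matrix_vector_mult_diff_rdistrib inner_diff_right power2_norm_eq_inner)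
qed

lemma loewner_norm_lower: "\<mu> * norm v \<le> norm (B *v v)"
proof (cases "v = 0")
  case False
  have "\<mu> * (norm v)\<^sup>2 \<le> norm v * norm (B *v v)"
    using loewner_quad_lower[of v] norm_cauchy_schwarz[of v "B *v v"] by linarith
  then show ?thesis using False by (simp add: power2_eq_square)
qed simp

lemma invertible_loewner: "invertible B"
proof -
  have "v = 0" if "B *v v = 0" for v
    using loewner_norm_lower[of v] that \<mu> by (simp add: mult_le_0_iff)
  then show ?thesis using invertible_left_inverse matrix_left_invertible_ker by blast
qed

lemma matrix_inv_cancel: "B *v (matrix_inv B *v v) = v"
  using invertible_loewner by (simp add: matrix_vector_mul_assoc matrix_inv_right)

lemma norm_matrix_inv_le: "norm (matrix_inv B *v v) \<le> norm v / \<mu>"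
  using loewner_norm_lower[of "matrix_inv B *v v"] \<mu> by (simp add: matrix_inv_cancel field_simps)

text \<open>With \<open>y\<close> the inverse applied to \<open>v\<close>, the quadratic form of
  \<open>B\<close> at \<open>y - v / L\<close> is nonnegative. Expanding it by symmetry and bounding
  \<open>inner v (B *v v)\<close> by \<open>L * (norm v)^2\<close> leaves the claim, without any use
  of eigenvalues.\<close>

lemma inner_matrix_inv_ge: "(norm v)\<^sup>2 / L \<le> inner v (matrix_inv B *v v)"
proof -
  define y where "y = matrix_inv B *v v"
  have v: "v = B *v y" by (simp add: y_def matrix_inv_cancel)
  have "inner y (B *v v) = inner v (B *v y)"
    using sym by (metis dot_lmul_matrix inner_commute transpose_matrix_vector)
  then have "inner (y - (1 / L) *\<^sub>R v) (B *v (y - (1 / L) *\<^sub>R v)) =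
      inner v y - 2 / L * (norm v)\<^sup>2 + (1 / L)\<^sup>2 * inner v (B *v v)"
    by (simp add: matrix_vector_mult_diff_distrib matrix_vector_mult_scaleR inner_diff v[symmetric]
        inner_commute[of y v] dot_square_norm power2_eq_square algebra_simps)
  moreover have "0 \<le> inner (y - (1 / L) *\<^sub>R v) (B *v (y - (1 / L) *\<^sub>R v))"
    using \<mu> by (intro order_trans[OF _ loewner_quad_lower]) simp
  moreover have "(1 / L)\<^sup>2 * inner v (B *v v) \<le> (1 / L)\<^sup>2 * (L * (norm v)\<^sup>2)"
    by (intro mult_left_mono loewner_quad_upper) simp
  moreover have "(1 / L)\<^sup>2 * (L * (norm v)\<^sup>2) = (norm v)\<^sup>2 / L" using L by (simp add: power2_eq_square)
  ultimately show ?thesis by (simp add: y_def)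
qed

end

text \<open>By Cramer's rule the inverse agrees with a Borel function of the matrix.\<close>

definition cramer_entry :: "'n \<Rightarrow> 'n \<Rightarrow> real ^ 'n ^ 'n \<Rightarrow> real" where
  "cramer_entry i j A = det (\<chi> k l. if l = i then axis j 1 $ k else A $ k $ l) / det A"

text \<open>Column \<open>j\<close> of the inverse solves \<open>A y = axis j 1\<close>, and
  Cramer's rule gives its entries. The identity is needed because \<open>cond_indep\<close> speaks
  of Borel events of \<open>B\<close>, whereas \<open>matrix_inv\<close> is a choice term whose
  measurability is not evident; the two agree wherever (A2) holds, that is, almost surely.\<close>

lemma cramer_entry_eq_matrix_inv:
  fixes A :: "real ^ 'n ^ 'n"
  assumes "invertible A"
  shows "cramer_entry i j A = matrix_inv A $ i $ j"
proof -
  have "A *v (matrix_inv A *v axis j 1) = axis j 1"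
    using assms by (simp add: matrix_vector_mul_assoc matrix_inv_right)
  then have "matrix_inv A *v axis j 1 =
      (\<chi> i. det (\<chi> k l. if l = i then axis j 1 $ k else A $ k $ l) / det A)"
    using cramer[of A] assms invertible_det_nz by blast
  moreover have "(matrix_inv A *v axis j 1) $ i = matrix_inv A $ i $ j"
    by (simp add: matrix_vector_mul_component inner_axis)
  ultimately show ?thesis by (simp add: cramer_entry_def)
qed

section \<open>Borel measurability of components, determinants and Cramer quotients\<close>

lemma borel_measurable_vec_component [measurable (raw)]:
  fixes f :: "'a \<Rightarrow> real ^ 'n"
  assumes "f \<in> borel_measurable M"
  shows "(\<lambda>\<omega>. f \<omega> $ i) \<in> borel_measurable M"
proof -
  have "(\<lambda>v :: real ^ 'n. v $ i) \<in> borel_measurable borel"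
    by (intro borel_measurable_continuous_onI continuous_intros)
  from measurable_compose[OF assms this] show ?thesis .
qed

lemma borel_measurable_vec_nth2 [measurable]:
  "(\<lambda>A :: real ^ 'n ^ 'm. A $ i $ j) \<in> borel_measurable borel"
  by (intro borel_measurable_continuous_onI continuous_intros)

lemma borel_measurable_det:
  fixes f :: "'a \<Rightarrow> real ^ 'n ^ 'n"
  assumes "\<And>i j. (\<lambda>x. f x $ i $ j) \<in> borel_measurable M"
  shows "(\<lambda>x. det (f x)) \<in> borel_measurable M"
  unfolding det_def using assms
  by (intro borel_measurable_sum borel_measurable_times borel_measurable_const borel_measurable_prod) auto

lemma borel_measurable_cramer_entry [measurable]: "cramer_entry i j \<in> borel_measurable borel"
  unfolding cramer_entry_def
  by (intro borel_measurable_divide borel_measurable_det) (simp_all add: if_distrib cong: if_cong, measurable)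

section \<open>Averages over samples\<close>

lemma card_subsets_containing:
  assumes "finite A" "i \<in> A" "0 < m"
  shows "card {V. V \<subseteq> A \<and> card V = m \<and> i \<in> V} = (card A - 1) choose (m - 1)"
proof -
  have "bij_betw (insert i) {W. W \<subseteq> A - {i} \<and> card W = m - 1} {V. V \<subseteq> A \<and> card V = m \<and> i \<in> V}"
  proof (rule bij_betw_byWitness[where f' = "\<lambda>V. V - {i}"])
    show "insert i ` {W. W \<subseteq> A - {i} \<and> card W = m - 1} \<subseteq> {V. V \<subseteq> A \<and> card V = m \<and> i \<in> V}"
    proof safe
      fix W assume W: "W \<subseteq> A - {i}" "card W = m - 1"
      then have "finite W" "i \<notin> W" using assms(1) finite_subset by auto
      with W assms show "card (insert i W) = m" by simp
    qed (use assms in auto)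
    show "(\<lambda>V. V - {i}) ` {V. V \<subseteq> A \<and> card V = m \<and> i \<in> V} \<subseteq> {W. W \<subseteq> A - {i} \<and> card W = m - 1}"
      using assms by (auto simp: card_Diff_singleton finite_subset)
  qed auto
  then have "card {V. V \<subseteq> A \<and> card V = m \<and> i \<in> V} = card {W. W \<subseteq> A - {i} \<and> card W = m - 1}"
    by (simp add: bij_betw_same_card)
  also have "\<dots> = card (A - {i}) choose (m - 1)" using assms by (intro n_subsets) auto
  finally show ?thesis using assms by simp
qed

text \<open>Double counting: each element lies in \<open>(card A - 1) choose (m - 1)\<close> of the
  subsets of size \<open>m\<close>, and
  \<open>m * (n choose m) = n * ((n - 1) choose (m - 1))\<close> for
  \<open>n = card A\<close>.\<close>

lemma sum_subset_averages:
  fixes a :: "'i \<Rightarrow> 'a::real_vector"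
  assumes A: "finite A" and m: "0 < m" "m \<le> card A"
  shows "(\<Sum>V | V \<subseteq> A \<and> card V = m. (1 / real m) *\<^sub>R (\<Sum>i\<in>V. a i)) =
    real (card A choose m) *\<^sub>R ((1 / real (card A)) *\<^sub>R (\<Sum>i\<in>A. a i))"
proof -
  let ?P = "{V. V \<subseteq> A \<and> card V = m}"
  have fin: "finite ?P" using A by simp
  have "(\<Sum>V\<in>?P. \<Sum>i\<in>V. a i) = (\<Sum>V\<in>?P. \<Sum>i\<in>A. if i \<in> V then a i else 0)"
    by (rule sum.cong[OF refl], rule sum.mono_neutral_cong_left) (use A in auto)
  also have "\<dots> = (\<Sum>i\<in>A. \<Sum>V\<in>?P. if i \<in> V then a i else 0)" by (rule sum.swap)
  also have "\<dots> = (\<Sum>i\<in>A. real ((card A - 1) choose (m - 1)) *\<^sub>R a i)"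
  proof (rule sum.cong[OF refl])
    fix i assume i: "i \<in> A"
    have "(\<Sum>V\<in>?P. if i \<in> V then a i else 0) = (\<Sum>V\<in>{V. V \<subseteq> A \<and> card V = m \<and> i \<in> V}. a i)"
      by (rule sum.mono_neutral_cong_right) (use fin in auto)
    then show "(\<Sum>V\<in>?P. if i \<in> V then a i else 0) = real ((card A - 1) choose (m - 1)) *\<^sub>R a i"
      by (simp add: card_subsets_containing[OF A i m(1)] sum_constant_scaleR)
  qed
  finally have "(\<Sum>V\<in>?P. \<Sum>i\<in>V. a i) = real ((card A - 1) choose (m - 1)) *\<^sub>R (\<Sum>i\<in>A. a i)"
    by (simp add: scaleR_right.sum)
  moreover have "real m * real (card A choose m) = real (card A) * real ((card A - 1) choose (m - 1))"
    using times_binomial_minus1_eq[OF m(1), of "card A"] by (metis of_nat_mult)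
  then have "real ((card A - 1) choose (m - 1)) / real m = real (card A choose m) / real (card A)"
    using m by (simp add: field_simps)
  ultimately show ?thesis by (simp flip: scaleR_right.sum)
qed

text \<open>Over all subsets of size \<open>m\<close>, the sampled functions and gradients average
  to the full ones. The squared gradient norm enters with a negative sign, and convexity (the square
  of a mean is at most the mean of the squares, \<open>J\<close>) goes in just the direction that
  this sign requires.\<close>

lemma acceptance_average:
  assumes m: "0 < m" "m \<le> N" and c: "0 \<le> c"
    and acc: "\<And>V. V \<subseteq> {1..N} \<Longrightarrow> card V = m \<Longrightarrow> acceptance_condition \<phi> V c C \<zeta> x y"
  shows "full_fun \<phi> N y \<le> full_fun \<phi> N x - c * (norm (sample_grad \<phi> {1..N} x))\<^sup>2 + C * \<zeta>"
proof -
  let ?P = "{V. V \<subseteq> {1..N} \<and> card V = m}"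
  define n where "n = real (N choose m)"
  have n: "0 < n" using m by (simp add: n_def zero_less_binomial_iff)
  have card: "real (card ?P) = n" using n_subsets[of "{1..N}" m] by (simp add: n_def)
  have f: "(\<Sum>V\<in>?P. sample_fun \<phi> V z) = n * full_fun \<phi> N z" for z
    using sum_subset_averages[of "{1..N}" m "\<lambda>i. \<phi> i z"] m by (simp add: sample_fun_def n_def)
  have g: "(\<Sum>V\<in>?P. sample_grad \<phi> V x) = n *\<^sub>R sample_grad \<phi> {1..N} x"
    using sum_subset_averages[of "{1..N}" m "\<lambda>i. gradient (\<phi> i) x"] m by (simp add: sample_grad_def n_def)
  have "(n * norm (sample_grad \<phi> {1..N} x))\<^sup>2 = (norm (\<Sum>V\<in>?P. sample_grad \<phi> V x))\<^sup>2"
    using n by (simp only: g norm_scaleR abs_of_pos)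
  also have "\<dots> \<le> (\<Sum>V\<in>?P. norm (sample_grad \<phi> V x))\<^sup>2"
    by (intro power_mono norm_sum) simp
  also have "\<dots> \<le> (\<Sum>V\<in>?P. (norm (sample_grad \<phi> V x))\<^sup>2) * real (card ?P)"
    by (rule sum_squared_le_sum_of_squares) 
  finally have J: "n * (norm (sample_grad \<phi> {1..N} x))\<^sup>2 \<le> (\<Sum>V\<in>?P. (norm (sample_grad \<phi> V x))\<^sup>2)"
    using n unfolding card by (simp add: power_mult_distrib power2_eq_square[of n] mult.commute mult.left_commute)
  have "n * full_fun \<phi> N y \<le>
      (\<Sum>V\<in>?P. sample_fun \<phi> V x - c * (norm (sample_grad \<phi> V x))\<^sup>2 + C * \<zeta>)"
    unfolding f[symmetric] using acc by (intro sum_mono) (auto simp: acceptance_condition_def)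
  also have "\<dots> = n * full_fun \<phi> N x - c * (\<Sum>V\<in>?P. (norm (sample_grad \<phi> V x))\<^sup>2) + n * (C * \<zeta>)"
    by (simp only: sum.distrib sum_subtractf f sum_distrib_left[of c, symmetric] sum_constant card)
  also have "\<dots> \<le> n * full_fun \<phi> N x - c * (n * (norm (sample_grad \<phi> {1..N} x))\<^sup>2) + n * (C * \<zeta>)"
    using mult_left_mono[OF J c] by linarith
  finally have "n * full_fun \<phi> N y \<le>
      n * (full_fun \<phi> N x - c * (norm (sample_grad \<phi> {1..N} x))\<^sup>2 + C * \<zeta>)"
    by (simp add: algebra_simps)
  then show ?thesis using n by simp
qed

section \<open>Orthogonality from conditional independence\<close>

text \<open>The hypothesis says that X has conditional expectation zero given Y.\<close>

lemma (in prob_space) integral_mult_eq_0I: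
  fixes X :: "'a \<Rightarrow> real" and f :: "'b \<Rightarrow> real"
  assumes X: "integrable M X" and Y: "Y \<in> measurable M P"
    and ind: "\<And>C. C \<in> sets P \<Longrightarrow> (\<integral>\<omega>. X \<omega> * indicat_real {\<omega>\<in>space M. Y \<omega> \<in> C} \<omega> \<partial>M) = 0"
    and f: "f \<in> borel_measurable P" and int: "integrable M (\<lambda>\<omega>. X \<omega> * f (Y \<omega>))"
  shows "(\<integral>\<omega>. X \<omega> * f (Y \<omega>) \<partial>M) = 0"
proof -
  \<comment> \<open>The algebra generated by \<open>Y\<close>: vanishing integrals over its events
    say that the conditional expectation of \<open>X\<close> is zero, and
    \<open>f (Y \<omega>)\<close> can be pulled out. Only the product has to be integrable, so
    \<open>f\<close> may be unbounded.\<close>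
  let ?F = "vimage_algebra (space M) Y P"
  have YF: "Y \<in> measurable ?F P"
    using Y by (intro measurable_vimage_algebra1) (auto simp: measurable_def)
  have "subalgebra M ?F"
    using Y by (auto simp: subalgebra_def sets_vimage_algebra2 measurable_def)
  then interpret finite_measure_subalgebra M ?F by unfold_locales
  have "AE \<omega> in M. real_cond_exp M ?F X \<omega> = 0"
  proof (rule real_cond_exp_charact)
    fix A assume "A \<in> sets ?F"
    then obtain C where C: "C \<in> sets P" and A: "A = Y -` C \<inter> space M"
      using Y by (auto simp: sets_vimage_algebra2 measurable_def)
    have "(\<integral>\<omega>\<in>A. X \<omega> \<partial>M) = (\<integral>\<omega>. X \<omega> * indicat_real {\<omega>\<in>space M. Y \<omega> \<in> C} \<omega> \<partial>M)"
      unfolding set_lebesgue_integral_def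
      by (intro Bochner_Integration.integral_cong) (auto simp: A indicator_def)
    then show "(\<integral>\<omega>\<in>A. X \<omega> \<partial>M) = (\<integral>\<omega>\<in>A. 0 \<partial>M)"
      using ind[OF C] by (simp add: set_lebesgue_integral_def)
  qed (use X in auto)
  moreover have "(\<lambda>\<omega>. f (Y \<omega>)) \<in> borel_measurable ?F" using YF f by measurable
  then have "(\<integral>\<omega>. f (Y \<omega>) * X \<omega> \<partial>M) = (\<integral>\<omega>. f (Y \<omega>) * real_cond_exp M ?F X \<omega> \<partial>M)"
    using int X by (intro real_cond_exp_intg(2)[symmetric]) (auto simp: mult.commute)
  ultimately have "(\<integral>\<omega>. f (Y \<omega>) * X \<omega> \<partial>M) = (\<integral>\<omega>. 0 \<partial>M)"
    by (simp only:) (rule integral_cong_AE; use YF f Y in \<open>auto\<close>)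
  then show ?thesis by (simp add: mult.commute)
qed

text \<open>Conditional independence is given for events only; \<open>integral_mult_eq_0I\<close> is
  used twice to pass to functions, first from events of \<open>X\<close> to
  \<open>\<psi> (X \<omega>)\<close> with the event of \<open>Y\<close> held fixed, then from events
  of \<open>Y\<close> to \<open>f (Y \<omega>)\<close>. In the application \<open>X\<close> is the
  stochastic gradient, \<open>Y\<close> the matrix, \<open>\<psi>\<close> a coordinate and
  \<open>f\<close> an entry of the inverse.\<close>

lemma (in prob_space) cond_indep_orthogonal:
  fixes w :: "'a \<Rightarrow> real" and X :: "'a \<Rightarrow> 'b::topological_space" and Y :: "'a \<Rightarrow> 'c::topological_space"
  assumes F: "subalgebra M F" and X[measurable]: "X \<in> borel_measurable M" and Y[measurable]: "Y \<in> borel_measurable M"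
    and ci: "cond_indep M F X Y"
    and w: "w \<in> borel_measurable F" and wb: "\<And>\<omega>. \<bar>w \<omega>\<bar> \<le> b"
    and \<psi>[measurable]: "\<psi> \<in> borel_measurable borel" and w\<psi>: "integrable M (\<lambda>\<omega>. w \<omega> * \<psi> (X \<omega>))"
    and m: "m \<in> borel_measurable F" "AE \<omega> in M. real_cond_exp M F (\<lambda>\<omega>. \<psi> (X \<omega>)) \<omega> = m \<omega>"
    and f[measurable]: "f \<in> borel_measurable borel"
    and int: "integrable M (\<lambda>\<omega>. w \<omega> * (\<psi> (X \<omega>) - m \<omega>) * f (Y \<omega>))"
  shows "(\<integral>\<omega>. w \<omega> * (\<psi> (X \<omega>) - m \<omega>) * f (Y \<omega>) \<partial>M) = 0"
proof -
  interpret finite_measure_subalgebra M F using F by unfold_locales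
  note [measurable] = w m(1) measurable_from_subalg[OF F w] measurable_from_subalg[OF F m(1)]
  have wm: "integrable M (\<lambda>\<omega>. w \<omega> * m \<omega>)"
  proof (rule integrable_cong_AE_imp)
    show "integrable M (\<lambda>\<omega>. w \<omega> * real_cond_exp M F (\<lambda>\<omega>. \<psi> (X \<omega>)) \<omega>)"
      using w\<psi> by (intro real_cond_exp_intg(1)) auto
  qed (use m(2) in auto)
  show ?thesis
  proof (rule integral_mult_eq_0I[OF _ Y _ f int])
    show "integrable M (\<lambda>\<omega>. w \<omega> * (\<psi> (X \<omega>) - m \<omega>))"
      using w\<psi> wm by (simp add: right_diff_distrib)
    fix C :: "'c set" assume C[measurable]: "C \<in> sets borel"
    let ?iC = "indicat_real {\<omega>\<in>space M. Y \<omega> \<in> C}"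
    define q where "q = real_cond_exp M F ?iC"
    have q[measurable]: "q \<in> borel_measurable F" "q \<in> borel_measurable M" by (auto simp: q_def)
    have iC: "integrable M ?iC" by (intro integrable_real_indicator) (auto simp: less_top[symmetric])
    have "AE \<omega> in M. 0 \<le> q \<omega>" unfolding q_def by (rule real_cond_exp_ge_c[OF iC]) auto
    moreover have "AE \<omega> in M. q \<omega> \<le> 1" unfolding q_def by (rule real_cond_exp_le_c[OF iC]) auto
    ultimately have qb: "AE \<omega> in M. \<bar>q \<omega>\<bar> \<le> 1" by eventually_elim auto
    have b: "0 \<le> b" using wb[of undefined] by simp
    have bnd: "AE \<omega> in M. norm (w \<omega> * r \<omega>) \<le> b" if "AE \<omega> in M. \<bar>r \<omega>\<bar> \<le> 1" for r
      using that
    proof eventually_elim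
      case (elim \<omega>)
      have "\<bar>w \<omega>\<bar> * \<bar>r \<omega>\<bar> \<le> b * 1" by (rule mult_mono) (use elim wb b in auto)
      then show ?case by (simp add: abs_mult)
    qed
    \<comment> \<open>The indicator of the event of \<open>Y\<close>, centred at its conditional
      probability \<open>q\<close>. The product formula makes it orthogonal to every event of
      \<open>X\<close>, hence to \<open>\<psi> (X \<omega>)\<close>.\<close>
    define Z where "Z \<omega> = w \<omega> * (?iC \<omega> - q \<omega>)" for \<omega>
    have Z[measurable]: "Z \<in> borel_measurable M" unfolding Z_def by measurable
    have intw: "integrable M (\<lambda>\<omega>. w \<omega> * r \<omega>)"
      if "AE \<omega> in M. \<bar>r \<omega>\<bar> \<le> 1" "r \<in> borel_measurable M" for r
      using bnd[OF that(1)] that(2) by (intro integrable_const_bound[where B = b]) auto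
    have "(\<integral>\<omega>. Z \<omega> * \<psi> (X \<omega>) \<partial>M) = 0"
    proof (rule integral_mult_eq_0I[OF _ X _ \<psi>])
      show "integrable M Z"
        unfolding Z_def right_diff_distrib using qb by (intro Bochner_Integration.integrable_diff intw) auto
      fix A :: "'b set" assume A[measurable]: "A \<in> sets borel"
      let ?iA = "indicat_real {\<omega>\<in>space M. X \<omega> \<in> A}"
      let ?iAC = "indicat_real {\<omega>\<in>space M. X \<omega> \<in> A \<and> Y \<omega> \<in> C}"
      have e: "AE \<omega> in M. real_cond_exp M F ?iAC \<omega> = real_cond_exp M F ?iA \<omega> * q \<omega>"
        using ci A C unfolding cond_indep_def q_def by blast
      have "(\<integral>\<omega>. w \<omega> * ?iAC \<omega> \<partial>M) = (\<integral>\<omega>. w \<omega> * real_cond_exp M F ?iAC \<omega> \<partial>M)"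
        by (intro real_cond_exp_intg(2)[symmetric] intw) (auto simp: indicator_def)
      also have "\<dots> = (\<integral>\<omega>. (w \<omega> * q \<omega>) * real_cond_exp M F ?iA \<omega> \<partial>M)"
        by (rule integral_cong_AE) (use e in auto)
      also have "\<dots> = (\<integral>\<omega>. (w \<omega> * q \<omega>) * ?iA \<omega> \<partial>M)"
      proof (rule real_cond_exp_intg(2))
        have "integrable M (\<lambda>\<omega>. w \<omega> * (q \<omega> * ?iA \<omega>))"
          by (rule intw) (use qb in \<open>auto simp: indicator_def\<close>)
        then show "integrable M (\<lambda>\<omega>. (w \<omega> * q \<omega>) * ?iA \<omega>)" by (simp add: mult.assoc)
      qed auto
      finally have "(\<integral>\<omega>. w \<omega> * ?iAC \<omega> - (w \<omega> * (q \<omega> * ?iA \<omega>)) \<partial>M) = 0"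
        by (subst Bochner_Integration.integral_diff)
          (use qb in \<open>auto intro!: intw simp: indicator_def mult.assoc\<close>)
      moreover have "(\<integral>\<omega>. Z \<omega> * ?iA \<omega> \<partial>M) = (\<integral>\<omega>. w \<omega> * ?iAC \<omega> - (w \<omega> * (q \<omega> * ?iA \<omega>)) \<partial>M)"
        by (intro Bochner_Integration.integral_cong) (auto simp: Z_def indicator_def algebra_simps)
      ultimately show "(\<integral>\<omega>. Z \<omega> * ?iA \<omega> \<partial>M) = 0" by simp
    next
      show "integrable M (\<lambda>\<omega>. Z \<omega> * \<psi> (X \<omega>))"
      proof (rule Bochner_Integration.integrable_bound[OF integrable_mult_right[OF w\<psi>, of 2]])
        show "AE \<omega> in M. norm (Z \<omega> * \<psi> (X \<omega>)) \<le> norm (2 * (w \<omega> * \<psi> (X \<omega>)))"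
          using qb
        proof eventually_elim
          case (elim \<omega>)
          have "\<bar>?iC \<omega> - q \<omega>\<bar> \<le> 2" using elim by (auto simp: indicator_def)
          then have "\<bar>w \<omega> * \<psi> (X \<omega>)\<bar> * \<bar>?iC \<omega> - q \<omega>\<bar> \<le> \<bar>w \<omega> * \<psi> (X \<omega>)\<bar> * 2"
            by (intro mult_left_mono) auto
          then show ?case by (simp add: Z_def abs_mult mult_ac)
        qed
      qed auto
    qed
    have i1: "integrable M (\<lambda>\<omega>. w \<omega> * \<psi> (X \<omega>) * ?iC \<omega>)"
      by (rule integrable_real_mult_indicator) (use w\<psi> in auto)
    have i2: "integrable M (\<lambda>\<omega>. w \<omega> * m \<omega> * ?iC \<omega>)"
      by (rule integrable_real_mult_indicator) (use wm in auto)
    have bq: "integrable M (\<lambda>\<omega>. r \<omega> * q \<omega>)" if "integrable M r" for r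
    proof (rule Bochner_Integration.integrable_bound[OF that])
      show "AE \<omega> in M. norm (r \<omega> * q \<omega>) \<le> norm (r \<omega>)" using qb
        by eventually_elim (auto simp: abs_mult intro: mult_left_le)
    qed (use that in auto)
    \<comment> \<open>Three exchanges: the indicator becomes \<open>q\<close> by orthogonality of
      \<open>Z\<close>; \<open>\<psi> (X \<omega>)\<close> becomes its conditional mean
      \<open>m\<close>, because \<open>w * q\<close> is measurable in \<open>F\<close>; then
      \<open>q\<close> becomes the indicator again, because \<open>w * m\<close> is.\<close>
    have "(\<integral>\<omega>. w \<omega> * \<psi> (X \<omega>) * ?iC \<omega> \<partial>M) = (\<integral>\<omega>. (w \<omega> * q \<omega>) * \<psi> (X \<omega>) \<partial>M)"
    proof -
      have "(\<integral>\<omega>. Z \<omega> * \<psi> (X \<omega>) \<partial>M) = (\<integral>\<omega>. w \<omega> * \<psi> (X \<omega>) * ?iC \<omega> - w \<omega> * \<psi> (X \<omega>) * q \<omega> \<partial>M)"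
        by (intro Bochner_Integration.integral_cong) (auto simp: Z_def algebra_simps)
      also have "\<dots> = (\<integral>\<omega>. w \<omega> * \<psi> (X \<omega>) * ?iC \<omega> \<partial>M) - (\<integral>\<omega>. w \<omega> * \<psi> (X \<omega>) * q \<omega> \<partial>M)"
        by (intro Bochner_Integration.integral_diff i1 bq w\<psi>)
      finally show ?thesis using \<open>(\<integral>\<omega>. Z \<omega> * \<psi> (X \<omega>) \<partial>M) = 0\<close> by (simp add: mult_ac)
    qed
    also have "\<dots> = (\<integral>\<omega>. (w \<omega> * q \<omega>) * real_cond_exp M F (\<lambda>\<omega>. \<psi> (X \<omega>)) \<omega> \<partial>M)"
      using bq[OF w\<psi>] by (intro real_cond_exp_intg(2)[symmetric]) (auto simp: mult_ac)
    also have "\<dots> = (\<integral>\<omega>. (w \<omega> * m \<omega>) * q \<omega> \<partial>M)"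
      by (rule integral_cong_AE) (use m(2) in auto)
    also have "\<dots> = (\<integral>\<omega>. (w \<omega> * m \<omega>) * ?iC \<omega> \<partial>M)"
      unfolding q_def using i2 by (intro real_cond_exp_intg(2)) auto
    finally show "(\<integral>\<omega>. w \<omega> * (\<psi> (X \<omega>) - m \<omega>) * ?iC \<omega> \<partial>M) = 0"
      using i1 i2 by (simp add: right_diff_distrib left_diff_distrib)
  qed
qed

section \<open>Descent with a hidden switch\<close>

text \<open>Here \<open>V\<close> models the objective gap, \<open>G\<close> the gradient norm and
  \<open>J k\<close> the event that the switch precedes iteration \<open>k\<close>. The point of the
  locale is that \<open>J k\<close> is measurable in \<open>M\<close> but not assumed measurable in
  \<open>F k\<close>, whereas \<open>V k\<close> and \<open>G k\<close> are. \<open>G_le\<close>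
  abstracts the smoothness bound of the squared gradient by the gap.\<close>

locale switched_drift = prob_space M for M :: "'a measure" +
  fixes F :: "nat \<Rightarrow> 'a measure" and V G :: "nat \<Rightarrow> 'a \<Rightarrow> real" and J :: "nat \<Rightarrow> 'a set"
    and \<alpha> :: "nat \<Rightarrow> real" and C :: real
  assumes F: "\<And>k. subalgebra M (F k)" and F_mono: "\<And>j k. j \<le> k \<Longrightarrow> sets (F j) \<subseteq> sets (F k)"
    and V[measurable]: "\<And>k. V k \<in> borel_measurable (F k)" and G[measurable]: "\<And>k. G k \<in> borel_measurable (F k)"
    and J[measurable]: "\<And>k. J k \<in> sets M" and J_mono: "\<And>k. J k \<subseteq> J (Suc k)"
    and V_nonneg: "\<And>k \<omega>. 0 \<le> V k \<omega>" and G_nonneg: "\<And>k \<omega>. 0 \<le> G k \<omega>"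
    and C: "0 \<le> C" and G_le: "\<And>k \<omega>. (G k \<omega>)\<^sup>2 \<le> C * V k \<omega>"
    and \<alpha>: "\<And>k. 0 < \<alpha> k" and \<alpha>_div: "filterlim (\<lambda>n. \<Sum>k<n. \<alpha> k) at_top sequentially"
begin

definition switch_prob :: "nat \<Rightarrow> 'a \<Rightarrow> real" where
  "switch_prob k = real_cond_exp M (F k) (indicat_real (J k))"

text \<open>A weak form of a conditional descent inequality on \<open>J k\<close>. Testing against
  weights \<open>\<sigma>\<close> replaces conditional expectations, and the majorant
  \<open>U\<close> replaces the increment, since the increment of \<open>V\<close> is not assumed
  integrable. Weights live where the slope exceeds \<open>\<epsilon>\<close> and the switch is
  likely, the only region where the bias can be absorbed. The bounds by \<open>c\<close> make the
  integrals on the right-hand side finite.\<close>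

definition drift_bound :: "real \<Rightarrow> real \<Rightarrow> real \<Rightarrow> (nat \<Rightarrow> real) \<Rightarrow> nat \<Rightarrow> bool" where
  "drift_bound \<epsilon> \<kappa> \<rho> b k \<longleftrightarrow> (\<forall>\<sigma> c. \<sigma> \<in> borel_measurable (F k) \<longrightarrow>
     (\<forall>\<omega>. 0 \<le> \<sigma> \<omega> \<and> \<sigma> \<omega> \<le> c \<and> \<sigma> \<omega> * (G k \<omega>)\<^sup>2 \<le> c) \<longrightarrow>
     (\<forall>\<omega>. \<sigma> \<omega> \<noteq> 0 \<longrightarrow> \<epsilon> < G k \<omega> \<and> 1 - \<rho> \<le> switch_prob k \<omega>) \<longrightarrow>
     (\<exists>U. integrable M U \<and>
        (AE \<omega> in M. indicator (J k) \<omega> * (\<sigma> \<omega> * (V (Suc k) \<omega> - V k \<omega>)) \<le> U \<omega>) \<and>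
        (\<integral>\<omega>. U \<omega> \<partial>M) \<le> b k * (\<integral>\<omega>. \<sigma> \<omega> \<partial>M) - \<alpha> k * \<kappa> * (\<integral>\<omega>. \<sigma> \<omega> * (G k \<omega>)\<^sup>2 \<partial>M)))"

lemma space_F [simp]: "space (F k) = space M"
  using F[of k] by (simp add: subalgebra_def)

lemma measurable_F_mono: "j \<le> k \<Longrightarrow> f \<in> borel_measurable (F j) \<Longrightarrow> f \<in> borel_measurable (F k)"
  using F_mono[of j k] by (intro measurable_from_subalg[of "F k" "F j"]) (auto simp: subalgebra_def)

lemma V_M [measurable]: "V k \<in> borel_measurable M" and G_M [measurable]: "G k \<in> borel_measurable M"
  by (rule measurable_from_subalg[OF F V], rule measurable_from_subalg[OF F G])

lemma switch_prob_F [measurable]: "switch_prob k \<in> borel_measurable (F k)" and switch_prob_M [measurable]: "switch_prob k \<in> borel_measurable M"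
  unfolding switch_prob_def by auto

lemma J_mono': "j \<le> k \<Longrightarrow> J j \<subseteq> J k"
  by (rule lift_Suc_mono_le[of J]) (use J_mono in auto)

lemma measurable_persistent_slope:
  "Measurable.pred (F k) (\<lambda>\<omega>. \<forall>j\<in>{K..k}. \<epsilon> < G j \<omega> \<and> q \<le> switch_prob j \<omega>)"
proof (intro pred_intros_finite)
  fix j assume j: "j \<in> {K..k}"
  have [measurable]: "G j \<in> borel_measurable (F k)" "switch_prob j \<in> borel_measurable (F k)"
    using measurable_F_mono[OF _ G[of j]] measurable_F_mono[OF _ switch_prob_F[of j]] j by auto
  show "Measurable.pred (F k) (\<lambda>\<omega>. \<epsilon> < G j \<omega> \<and> q \<le> switch_prob j \<omega>)" by measurable
qed auto

lemma bounded_ratio_tendsto_0: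
  "(\<lambda>n. \<integral>\<omega>. V K \<omega> / (real (Suc n) + V K \<omega>) \<partial>M) \<longlonglongrightarrow> 0"
proof -
  have "(\<lambda>n. \<integral>\<omega>. V K \<omega> / (real (Suc n) + V K \<omega>) \<partial>M) \<longlonglongrightarrow> (\<integral>\<omega>. 0 \<partial>M)"
  proof (rule integral_dominated_convergence[where w = "\<lambda>_. 1"])
    show "AE \<omega> in M. (\<lambda>n. V K \<omega> / (real (Suc n) + V K \<omega>)) \<longlonglongrightarrow> 0"
    proof (rule AE_I2)
      fix \<omega>
      have "filterlim (\<lambda>n. V K \<omega> + real (Suc n)) at_top sequentially"
        by (intro filterlim_tendsto_add_at_top[OF tendsto_const] filterlim_compose[OF filterlim_real_sequentially filterlim_Suc])
      then have "filterlim (\<lambda>n. real (Suc n) + V K \<omega>) at_infinity sequentially"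
        by (intro filterlim_at_top_imp_at_infinity) (simp add: add.commute)
      then show "(\<lambda>n. V K \<omega> / (real (Suc n) + V K \<omega>)) \<longlonglongrightarrow> 0"
        by (intro tendsto_divide_0[OF tendsto_const])
    qed
    show "AE \<omega> in M. norm (V K \<omega> / (real (Suc n) + V K \<omega>)) \<le> 1" for n
      using V_nonneg[of K] by (intro AE_I2) (simp add: divide_le_eq_1 abs_of_nonneg add_nonneg_pos add_pos_nonneg)
  qed auto
  then show ?thesis by simp
qed

text \<open>
  The switching times contribute to the Lyapunov function at every step, and the value at the switch need not
  be integrable.  The bounded concave transform v / (R + v) makes the total contribution at most the
  probability of a late switch, while its derivative damps the noise by 1 / R.
\<close>

lemma persistent_slope_contradiction:
  assumes \<epsilon>: "0 < \<epsilon>" and \<kappa>: "0 < \<kappa>" and b: "summable b" "\<And>k. 0 \<le> b k"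
    and drift: "\<And>k. K \<le> k \<Longrightarrow> drift_bound \<epsilon> \<kappa> \<rho> b k"
    and z: "0 < z" "z \<le> prob {\<omega>\<in>space M. \<omega> \<in> J K \<and> (\<forall>k\<ge>K. \<epsilon> < G k \<omega> \<and> 1 - \<rho> \<le> switch_prob k \<omega>)}"
    and late: "prob ((\<Union>k. J k) - J K) \<le> z / 8"
  shows False
proof -
  \<comment> \<open>The scale \<open>R = Suc n\<close> makes the initial Lyapunov value and the
    accumulated error \<open>b\<close> each less than \<open>z / 16\<close>. Together with
    \<open>z / 8\<close> for late switches the budget is \<open>z / 4\<close>.\<close>
  have "eventually (\<lambda>n. (\<integral>\<omega>. V K \<omega> / (real (Suc n) + V K \<omega>) \<partial>M) < z / 16) sequentially"
    using z by (intro order_tendstoD(2)[OF bounded_ratio_tendsto_0]) auto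
  moreover have "eventually (\<lambda>n. (\<Sum>k. b k) / real (Suc n) < z / 16) sequentially"
  proof -
    have "(\<lambda>n. (\<Sum>k. b k) / real (Suc n)) \<longlonglongrightarrow> 0"
      by (intro LIMSEQ_Suc[of "\<lambda>n. (\<Sum>k. b k) / real n"] lim_const_over_n)
    then show ?thesis using z by (intro order_tendstoD(2)) auto
  qed
  ultimately obtain n where n: "(\<integral>\<omega>. V K \<omega> / (real (Suc n) + V K \<omega>) \<partial>M) < z / 16"
    "(\<Sum>k. b k) / real (Suc n) < z / 16"
    using eventually_happens'[OF sequentially_bot eventually_conj] by blast
  define R where "R = real (Suc n)"
  have R: "1 \<le> R" by (simp add: R_def)
  define h where "h v = v / (R + v)" for v
  have h01: "0 \<le> h v" "h v \<le> 1" if "0 \<le> v" for v using that R by (auto simp: h_def field_simps)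
  have [measurable]: "h \<in> borel_measurable borel" unfolding h_def by measurable
  \<comment> \<open>Marks the paths on which the slope has stayed large and the switch likely from
    \<open>K\<close> up to \<open>k\<close>. It is measurable in \<open>F k\<close>, hence
    admissible in a weight, and it can only decrease with \<open>k\<close>.\<close>
  define s where "s k = indicat_real {\<omega>\<in>space M. \<forall>j\<in>{K..k}. \<epsilon> < G j \<omega> \<and> 1 - \<rho> \<le> switch_prob j \<omega>}" for k
  have s_F: "s k \<in> borel_measurable (F k)" for k
  proof -
    have "{\<omega>\<in>space (F k). \<forall>j\<in>{K..k}. \<epsilon> < G j \<omega> \<and> 1 - \<rho> \<le> switch_prob j \<omega>} \<in> sets (F k)"
      by (rule predE[OF measurable_persistent_slope])
    then show ?thesis unfolding s_def by simp
  qed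
  have [measurable]: "s k \<in> borel_measurable M" for k by (rule measurable_from_subalg[OF F s_F])
  have s01: "0 \<le> s k \<omega>" "s k \<omega> \<le> 1" for k \<omega> by (auto simp: s_def)
  \<comment> \<open>The second factor is the derivative of \<open>h\<close> at \<open>V k\<close>.
    It is at most \<open>1 / R\<close>, and \<open>G_le\<close> turns its decay in
    \<open>V k\<close> into a bound for \<open>\<sigma> * G^2\<close>.\<close>
  define \<sigma> where "\<sigma> k \<omega> = s k \<omega> * (R / (R + V k \<omega>)\<^sup>2)" for k \<omega>
  have \<sigma>_F[measurable]: "\<sigma> k \<in> borel_measurable (F k)" for k using s_F[of k] unfolding \<sigma>_def by measurable
  have \<sigma>_M[measurable]: "\<sigma> k \<in> borel_measurable M" for k by (rule measurable_from_subalg[OF F \<sigma>_F])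
  have RV: "R\<^sup>2 \<le> (R + V k \<omega>)\<^sup>2" "R * V k \<omega> \<le> (R + V k \<omega>)\<^sup>2" "0 < (R + V k \<omega>)\<^sup>2" for k \<omega>
  proof -
    have "0 < R + V k \<omega>" using V_nonneg[of k \<omega>] R by linarith
    then show "0 < (R + V k \<omega>)\<^sup>2" by simp
  qed (use V_nonneg[of k \<omega>] R in \<open>auto simp: power2_eq_square algebra_simps\<close>)
  have \<sigma>0: "0 \<le> \<sigma> k \<omega>" for k \<omega> unfolding \<sigma>_def using s01 R by simp
  have \<sigma>R: "\<sigma> k \<omega> \<le> 1 / R" for k \<omega>
  proof -
    have "R / (R + V k \<omega>)\<^sup>2 \<le> 1 / R"
      using RV[of k \<omega>] R by (simp add: divide_le_eq power2_eq_square field_simps)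
    then have "s k \<omega> * (R / (R + V k \<omega>)\<^sup>2) \<le> 1 * (1 / R)"
      by (intro mult_mono) (use s01 R in auto)
    then show ?thesis by (simp add: \<sigma>_def)
  qed
  have \<sigma>G: "\<sigma> k \<omega> * (G k \<omega>)\<^sup>2 \<le> C" for k \<omega>
  proof -
    have "R / (R + V k \<omega>)\<^sup>2 * (G k \<omega>)\<^sup>2 \<le> R / (R + V k \<omega>)\<^sup>2 * (C * V k \<omega>)"
      using G_le[of k \<omega>] R by (intro mult_left_mono) auto
    also have "\<dots> = C * (R * V k \<omega> / (R + V k \<omega>)\<^sup>2)" by simp
    also have "\<dots> \<le> C * 1"
      using RV[of k \<omega>] by (intro mult_left_mono C) (simp add: divide_le_eq_1)
    finally have "s k \<omega> * (R / (R + V k \<omega>)\<^sup>2 * (G k \<omega>)\<^sup>2) \<le> 1 * C"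
      by (intro mult_mono) (use s01 R in auto)
    then show ?thesis by (simp add: \<sigma>_def mult.assoc)
  qed
  have intb: "integrable M f" if "f \<in> borel_measurable M" "\<And>\<omega>. 0 \<le> f \<omega>" "\<And>\<omega>. f \<omega> \<le> c" for f :: "'a \<Rightarrow> real" and c
    using that by (intro integrable_const_bound[where B = c]) auto
  define u where "u k = (\<integral>\<omega>. s k \<omega> * indicator (J k) \<omega> * h (V k \<omega>) \<partial>M)" for k
  have iu: "integrable M (\<lambda>\<omega>. s j \<omega> * indicator (J k) \<omega> * h (V l \<omega>))" for j k l
    by (rule intb[of _ 1]) (use s01 h01 V_nonneg in \<open>auto simp: indicator_def mult_le_one\<close>)
  have i\<sigma>: "integrable M (\<sigma> k)" for k by (rule intb[OF \<sigma>_M \<sigma>0 \<sigma>R])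
  have i\<sigma>G: "integrable M (\<lambda>\<omega>. \<sigma> k \<omega> * (G k \<omega>)\<^sup>2)" for k
    by (rule intb[of _ C]) (use \<sigma>0 \<sigma>G in auto)
  define E where "E k = (\<integral>\<omega>. \<sigma> k \<omega> * (G k \<omega>)\<^sup>2 \<partial>M)" for k
  have E0: "0 \<le> E k" for k unfolding E_def using \<sigma>0 by simp
  \<comment> \<open>The Lyapunov mean \<open>u\<close> counts switched paths only. Paths that switch
    at this step enter with a value of \<open>h\<close> at most 1, and these entries add up to the
    difference of the probabilities of \<open>J\<close>.\<close>
  have step: "u (Suc k) \<le> u k + (prob (J (Suc k)) - prob (J k)) + b k / R - \<alpha> k * \<kappa> * E k"
    if k: "K \<le> k" for k
  proof -
    have "\<forall>\<omega>. \<sigma> k \<omega> \<noteq> 0 \<longrightarrow> \<epsilon> < G k \<omega> \<and> 1 - \<rho> \<le> switch_prob k \<omega>"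
      using k by (auto simp: \<sigma>_def s_def indicator_def split: if_splits)
    moreover have "\<forall>\<omega>. 0 \<le> \<sigma> k \<omega> \<and> \<sigma> k \<omega> \<le> max (1 / R) C \<and> \<sigma> k \<omega> * (G k \<omega>)\<^sup>2 \<le> max (1 / R) C"
      using \<sigma>0 \<sigma>R \<sigma>G by (meson max.coboundedI1 max.coboundedI2)
    ultimately obtain U where U: "integrable M U"
      "AE \<omega> in M. indicator (J k) \<omega> * (\<sigma> k \<omega> * (V (Suc k) \<omega> - V k \<omega>)) \<le> U \<omega>"
      "(\<integral>\<omega>. U \<omega> \<partial>M) \<le> b k * (\<integral>\<omega>. \<sigma> k \<omega> \<partial>M) - \<alpha> k * \<kappa> * E k"
      using drift[OF k] \<sigma>_F[of k] unfolding drift_bound_def E_def by blast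
    have "u (Suc k) \<le> (\<integral>\<omega>. s k \<omega> * indicator (J k) \<omega> * h (V k \<omega>) + U \<omega>
        + indicator (J (Suc k) - J k) \<omega> \<partial>M)"
      unfolding u_def
    proof (rule integral_mono_AE)
      show "AE \<omega> in M. s (Suc k) \<omega> * indicator (J (Suc k)) \<omega> * h (V (Suc k) \<omega>)
          \<le> s k \<omega> * indicator (J k) \<omega> * h (V k \<omega>) + U \<omega> + indicator (J (Suc k) - J k) \<omega>"
        using U(2)
      proof eventually_elim
        case (elim \<omega>)
        define v where "v = V k \<omega>"
        define v' where "v' = V (Suc k) \<omega>"
        have v: "0 \<le> v" "0 \<le> v'" using V_nonneg by (auto simp: v_def v'_def)
        have ss: "s (Suc k) \<omega> \<le> s k \<omega>" by (auto simp: s_def indicator_def)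
        have pos: "R + v' > 0" "R + v > 0" using v R by linarith+
        have "h v' - h v = R * (v' - v) / ((R + v) * (R + v'))"
          using pos unfolding h_def by (simp add: divide_simps) (simp add: algebra_simps)
        \<comment> \<open>Concavity: the tangent of \<open>h\<close> at \<open>v\<close> lies above
          its graph, and the gap is an explicit nonnegative term with a square in it.\<close>
        also have "\<dots> \<le> R / (R + v)\<^sup>2 * (v' - v)"
        proof -
          have "R / (R + v)\<^sup>2 * (v' - v) - R * (v' - v) / ((R + v) * (R + v')) =
              R * (v' - v)\<^sup>2 / ((R + v)\<^sup>2 * (R + v'))"
            using pos by (simp add: divide_simps power2_eq_square) (simp add: algebra_simps)
          moreover have "\<dots> \<ge> 0" using pos R by simp
          ultimately show ?thesis by linarith
        qed
        finally have hh: "h v' \<le> h v + R / (R + v)\<^sup>2 * (v' - v)" by simp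
        have "s k \<omega> * indicator (J k) \<omega> * h v' \<le>
            s k \<omega> * indicator (J k) \<omega> * (h v + R / (R + v)\<^sup>2 * (v' - v))"
          using hh s01 by (intro mult_left_mono) auto
        also have "\<dots> = s k \<omega> * indicator (J k) \<omega> * h v + indicator (J k) \<omega> * (\<sigma> k \<omega> * (v' - v))"
          by (simp add: \<sigma>_def v_def algebra_simps)
        finally have A: "s k \<omega> * indicator (J k) \<omega> * h v' \<le> s k \<omega> * indicator (J k) \<omega> * h v + U \<omega>"
          using elim by (simp add: v_def v'_def)
        have "s (Suc k) \<omega> * indicator (J (Suc k)) \<omega> * h v' \<le>
            s k \<omega> * indicator (J k) \<omega> * h v' + indicator (J (Suc k) - J k) \<omega>"
          using mult_right_mono[OF ss h01(1)[OF v(2)]] h01[OF v(2)] s01[of "Suc k" \<omega>] J_mono[of k]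
          by (auto simp: indicator_def mult_le_one)
        with A show ?case by (simp add: v_def v'_def)
      qed
    qed (use iu U in \<open>auto intro!: Bochner_Integration.integrable_add simp: less_top[symmetric]\<close>)
    also have "\<dots> = u k + (\<integral>\<omega>. U \<omega> \<partial>M) + prob (J (Suc k) - J k)"
      unfolding u_def using iu U(1) by (simp add: less_top[symmetric])
    also have "prob (J (Suc k) - J k) = prob (J (Suc k)) - prob (J k)"
      by (rule finite_measure_Diff) (use J_mono in auto)
    also have "(\<integral>\<omega>. U \<omega> \<partial>M) \<le> b k / R - \<alpha> k * \<kappa> * E k"
    proof -
      have "(\<integral>\<omega>. \<sigma> k \<omega> \<partial>M) \<le> (\<integral>\<omega>. 1 / R \<partial>M)"
        using i\<sigma> \<sigma>R by (intro integral_mono) auto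
      then have "b k * (\<integral>\<omega>. \<sigma> k \<omega> \<partial>M) \<le> b k * (1 / R)"
        using b(2) by (intro mult_left_mono) (auto simp: prob_space)
      then show ?thesis using U(3) by simp
    qed
    finally show ?thesis by simp
  qed
  have tele: "u (K + m) + \<kappa> * (\<Sum>i<m. \<alpha> (K + i) * E (K + i)) \<le>
      u K + (prob (J (K + m)) - prob (J K)) + (\<Sum>i<m. b (K + i)) / R" for m
  proof (induction m)
    case (Suc m)
    then show ?case using step[of "K + m"] by (simp add: algebra_simps add_divide_distrib)
  qed simp
  have bound: "u (K + m) + \<kappa> * (\<Sum>i<m. \<alpha> (K + i) * E (K + i)) \<le> z / 4" for m
  proof -
    have "u K \<le> (\<integral>\<omega>. V K \<omega> / (R + V K \<omega>) \<partial>M)"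
      unfolding u_def
    proof (rule integral_mono)
      show "integrable M (\<lambda>\<omega>. V K \<omega> / (R + V K \<omega>))"
        by (rule intb[of _ 1]) (use h01 V_nonneg in \<open>auto simp: h_def\<close>)
      show "s K \<omega> * indicator (J K) \<omega> * h (V K \<omega>) \<le> V K \<omega> / (R + V K \<omega>)" for \<omega>
        using s01[of K \<omega>] h01[OF V_nonneg[of K \<omega>]]
        by (auto simp: indicator_def h_def[symmetric] intro: mult_left_le_one_le)
    qed (use iu in auto)
    then have "u K \<le> z / 16" using n(1) by (simp add: R_def)
    moreover have "prob (J (K + m)) - prob (J K) \<le> z / 8"
    proof -
      have "prob (J (K + m)) - prob (J K) = prob (J (K + m) - J K)"
        by (rule finite_measure_Diff[symmetric]) (use J_mono'[of K "K + m"] in auto)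
      also have "\<dots> \<le> prob ((\<Union>k. J k) - J K)"
        by (intro finite_measure_mono) auto
      finally show ?thesis using late by simp
    qed
    moreover have "(\<Sum>i<m. b (K + i)) \<le> (\<Sum>k. b k)"
    proof -
      have "(\<Sum>i<m. b (K + i)) = sum b ((\<lambda>i. K + i) ` {..<m})"
        by (subst sum.reindex) auto
      also have "\<dots> \<le> (\<Sum>k. b k)" by (rule sum_le_suminf) (use b in auto)
      finally show ?thesis .
    qed
    then have "(\<Sum>i<m. b (K + i)) / R \<le> (\<Sum>k. b k) / R"
      using R by (intro divide_right_mono) auto
    then have "(\<Sum>i<m. b (K + i)) / R \<le> z / 16"
      using n(2) unfolding R_def by linarith
    ultimately show ?thesis using tele[of m] by linarith
  qed
  \<comment> \<open>What remains for \<open>E\<close> in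
    \<open>z <= 2 * u + 4 * R / \<epsilon>^2 * E\<close> once \<open>u <= z / 4\<close> is
    inserted.\<close>
  define \<gamma> where "\<gamma> = z * \<epsilon>\<^sup>2 / (8 * R)"
  have \<gamma>: "0 < \<gamma>" using z \<epsilon> R by (simp add: \<gamma>_def)
  have E\<gamma>: "\<gamma> \<le> E (K + m)" for m
  proof -
    let ?k = "K + m"
    let ?Z = "{\<omega>\<in>space M. \<omega> \<in> J K \<and> (\<forall>k\<ge>K. \<epsilon> < G k \<omega> \<and> 1 - \<rho> \<le> switch_prob k \<omega>)}"
    have [measurable]: "?Z \<in> sets M" by measurable
    have "prob ?Z = (\<integral>\<omega>. indicat_real ?Z \<omega> \<partial>M)" by simp
    \<comment> \<open>A dichotomy on the persistent event: if \<open>V\<close> exceeds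
      \<open>R\<close> then \<open>h\<close> is at least 1/2 and the Lyapunov term pays; otherwise
      \<open>\<sigma>\<close> is at least \<open>1 / (4 * R)\<close> and the slope term pays. The
      bound on \<open>u\<close> thus excludes that most of the event hides at large gaps.\<close>
    also have "\<dots> \<le> (\<integral>\<omega>. 2 * (s ?k \<omega> * indicator (J ?k) \<omega> * h (V ?k \<omega>)) +
        4 * R / \<epsilon>\<^sup>2 * (\<sigma> ?k \<omega> * (G ?k \<omega>)\<^sup>2) \<partial>M)"
    proof (rule integral_mono)
      fix \<omega>
      have nn: "0 \<le> 2 * (s ?k \<omega> * indicator (J ?k) \<omega> * h (V ?k \<omega>))"
        "0 \<le> 4 * R / \<epsilon>\<^sup>2 * (\<sigma> ?k \<omega> * (G ?k \<omega>)\<^sup>2)"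
        using s01 h01 V_nonneg \<sigma>0 R by auto
      show "indicat_real ?Z \<omega> \<le> 2 * (s ?k \<omega> * indicator (J ?k) \<omega> * h (V ?k \<omega>)) +
        4 * R / \<epsilon>\<^sup>2 * (\<sigma> ?k \<omega> * (G ?k \<omega>)\<^sup>2)"
      proof (cases "\<omega> \<in> ?Z")
        case True
        then have s1: "s ?k \<omega> = 1" and J1: "\<omega> \<in> J ?k" and G1: "\<epsilon> < G ?k \<omega>"
          using J_mono'[of K ?k] by (auto simp: s_def)
        show ?thesis
        proof (cases "V ?k \<omega> \<le> R")
          case False
          then have "1 / 2 \<le> h (V ?k \<omega>)" using R by (simp add: h_def field_simps)
          then show ?thesis using nn s1 J1 True by simp
        next
          case VR: True
          have "(R + V ?k \<omega>)\<^sup>2 \<le> (2 * R)\<^sup>2" using VR V_nonneg[of ?k \<omega>] R by (intro power_mono) auto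
          then have "1 / (4 * R) \<le> R / (R + V ?k \<omega>)\<^sup>2"
            using RV(3)[of ?k \<omega>] R by (simp add: field_simps power2_eq_square)
          moreover have "\<epsilon>\<^sup>2 \<le> (G ?k \<omega>)\<^sup>2" using G1 \<epsilon> by (intro power_mono) auto
          ultimately have "1 / (4 * R) * \<epsilon>\<^sup>2 \<le> \<sigma> ?k \<omega> * (G ?k \<omega>)\<^sup>2"
            unfolding \<sigma>_def s1 using R by (intro mult_mono) auto
          then have "4 * R / \<epsilon>\<^sup>2 * (1 / (4 * R) * \<epsilon>\<^sup>2) \<le> 4 * R / \<epsilon>\<^sup>2 * (\<sigma> ?k \<omega> * (G ?k \<omega>)\<^sup>2)"
            using R by (intro mult_left_mono) auto
          then have "1 \<le> 4 * R / \<epsilon>\<^sup>2 * (\<sigma> ?k \<omega> * (G ?k \<omega>)\<^sup>2)" using R \<epsilon> by simp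
          then show ?thesis using nn True by simp
        qed
      qed (use nn in simp)
    qed (use iu i\<sigma>G in \<open>auto intro!: Bochner_Integration.integrable_add Bochner_Integration.integrable_mult_right simp: less_top[symmetric]\<close>)
    also have "\<dots> = 2 * u ?k + 4 * R / \<epsilon>\<^sup>2 * E ?k"
      unfolding u_def E_def using iu i\<sigma>G
      by (subst Bochner_Integration.integral_add) (auto simp del: times_divide_eq_left)
    finally have "z \<le> 2 * u ?k + 4 * R / \<epsilon>\<^sup>2 * E ?k" using z by simp
    moreover have "u ?k \<le> z / 4"
    proof -
      have "0 \<le> \<kappa> * (\<Sum>i<m. \<alpha> (K + i) * E (K + i))"
        using \<kappa> \<alpha> E0 by (intro mult_nonneg_nonneg sum_nonneg) (auto simp: less_imp_le)
      then show ?thesis using bound[of m] by linarith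
    qed
    ultimately have "z / 2 \<le> 4 * R / \<epsilon>\<^sup>2 * E ?k" by simp
    then show ?thesis using R \<epsilon> by (simp add: \<gamma>_def field_simps)
  qed
  \<comment> \<open>Each step costs at least \<open>\<alpha> * \<kappa> * \<gamma>\<close> of the
    fixed budget \<open>z / 4\<close>, so the step lengths after \<open>K\<close> have bounded
    sums.\<close>
  have sum_bd: "(\<Sum>i<m. \<alpha> (K + i)) \<le> z / (4 * \<kappa> * \<gamma>)" for m
  proof -
    have "\<kappa> * ((\<Sum>i<m. \<alpha> (K + i)) * \<gamma>) \<le> \<kappa> * (\<Sum>i<m. \<alpha> (K + i) * E (K + i))"
      unfolding sum_distrib_right using \<kappa> \<alpha> E\<gamma> by (intro mult_left_mono sum_mono) (auto simp: less_imp_le)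
    moreover have "0 \<le> u (K + m)" unfolding u_def
      using s01 h01 V_nonneg by (intro integral_nonneg_AE AE_I2) auto
    ultimately have "\<kappa> * ((\<Sum>i<m. \<alpha> (K + i)) * \<gamma>) \<le> z / 4" using bound[of m] by linarith
    then show ?thesis using \<kappa> \<gamma> by (simp add: field_simps)
  qed
  have "eventually (\<lambda>n. (\<Sum>k<K. \<alpha> k) + z / (4 * \<kappa> * \<gamma>) < (\<Sum>k<n. \<alpha> k)) sequentially"
    using \<alpha>_div unfolding filterlim_at_top_dense by blast
  then obtain n where n: "K \<le> n" "(\<Sum>k<K. \<alpha> k) + z / (4 * \<kappa> * \<gamma>) < (\<Sum>k<n. \<alpha> k)"
    unfolding eventually_sequentially by (meson nat_le_linear order_refl)
  then obtain m where m: "n = K + m" using le_Suc_ex by blast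
  have "(\<Sum>k<K + m. \<alpha> k) = (\<Sum>k<K. \<alpha> k) + (\<Sum>i<m. \<alpha> (K + i))"
    by (induction m) auto
  then show False using n sum_bd[of m] by (simp add: m)
qed

text \<open>The event for \<open>K\<close> is contained in the event for every later index. If it
  had positive probability, the start could be moved so far that later switches have probability at
  most an eighth of it, which is the situation excluded by
  \<open>persistent_slope_contradiction\<close>.\<close>

lemma persistent_slope_null:
  assumes \<epsilon>: "0 < \<epsilon>" and \<kappa>: "0 < \<kappa>" and b: "summable b" "\<And>k. 0 \<le> b k"
    and drift: "\<And>k. K0 \<le> k \<Longrightarrow> drift_bound \<epsilon> \<kappa> \<rho> b k"
  shows "AE \<omega> in M. \<omega> \<in> J K \<longrightarrow> (\<exists>k\<ge>K. \<not> (\<epsilon> < G k \<omega> \<and> 1 - \<rho> \<le> switch_prob k \<omega>))"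
proof -
  let ?Z = "\<lambda>K. {\<omega>\<in>space M. \<omega> \<in> J K \<and> (\<forall>k\<ge>K. \<epsilon> < G k \<omega> \<and> 1 - \<rho> \<le> switch_prob k \<omega>)}"
  have [measurable]: "?Z K \<in> sets M" for K by measurable
  have "prob (?Z K) = 0"
  proof (rule ccontr)
    assume "prob (?Z K) \<noteq> 0"
    then have z: "0 < prob (?Z K)" using measure_nonneg by (simp add: less_le)
    have "(\<lambda>n. prob (J n)) \<longlonglongrightarrow> prob (\<Union>k. J k)"
      by (rule finite_Lim_measure_incseq) (auto simp: incseq_SucI J_mono)
    then have "eventually (\<lambda>n. prob (\<Union>k. J k) - prob (?Z K) / 8 < prob (J n)) sequentially"
      using z by (intro order_tendstoD(1)) auto
    then obtain n where n: "max K K0 \<le> n" "prob (\<Union>k. J k) - prob (?Z K) / 8 < prob (J n)"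
      unfolding eventually_sequentially by (meson nat_le_linear order_refl)
    show False
    proof (rule persistent_slope_contradiction[OF \<epsilon> \<kappa> b drift z])
      show "prob (?Z K) \<le> prob (?Z n)"
        using n J_mono'[of K n] by (intro finite_measure_mono) auto
      have "prob ((\<Union>k. J k) - J n) = prob (\<Union>k. J k) - prob (J n)"
        by (rule finite_measure_Diff) auto
      then show "prob ((\<Union>k. J k) - J n) \<le> prob (?Z K) / 8" using n by simp
    qed (use n in auto)
  qed
  then have "AE \<omega> in M. \<omega> \<notin> ?Z K"
    by (subst (asm) prob_eq_0) auto
  then show ?thesis using AE_space by eventually_elim auto
qed

text \<open>
  Maximal inequality, by first entrance: on paths where G stays large the conditional probability of not yet
  having switched is a nonnegative supermartingale whose mean tends to 0.
\<close>

lemma eventually_switch_prob_ge: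
  assumes \<rho>: "0 < \<rho>"
    and null: "AE \<omega> in M. (\<forall>k\<ge>K. \<epsilon> < G k \<omega>) \<longrightarrow> (\<exists>k. \<omega> \<in> J k)"
  shows "AE \<omega> in M. (\<forall>k\<ge>K. \<epsilon> < G k \<omega>) \<longrightarrow> (\<exists>n\<ge>K. \<forall>k\<ge>n. 1 - \<rho> \<le> switch_prob k \<omega>)"
proof -
  define H where "H n = {\<omega>\<in>space M. \<forall>j\<in>{K..n}. \<epsilon> < G j \<omega>}" for n
  have [measurable]: "H n \<in> sets M" for n unfolding H_def by measurable
  \<comment> \<open>By \<open>null\<close>, a path whose slope stays large must switch, so these
    decreasing events have a null intersection.\<close>
  have "(\<lambda>n. prob (H n - J n)) \<longlonglongrightarrow> prob (\<Inter>n. H n - J n)"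
  proof (rule finite_Lim_measure_decseq)
    show "decseq (\<lambda>n. H n - J n)"
      by (rule decseq_SucI) (use J_mono in \<open>auto simp: H_def\<close>)
  qed auto
  moreover have "prob (\<Inter>n. H n - J n) = 0"
  proof (subst prob_eq_0)
    show "AE \<omega> in M. \<omega> \<notin> (\<Inter>n. H n - J n)"
      using null
    proof eventually_elim
      case (elim \<omega>)
      show ?case
      proof
        assume \<omega>: "\<omega> \<in> (\<Inter>n. H n - J n)"
        have "\<epsilon> < G k \<omega>" if "K \<le> k" for k
        proof -
          have "\<omega> \<in> H k" using \<omega> by blast
          then show ?thesis using that by (simp add: H_def)
        qed
        with elim \<omega> show False by blast
      qed
    qed
  qed auto
  ultimately have lim: "(\<lambda>n. prob (H n - J n) / \<rho>) \<longlonglongrightarrow> 0"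
    by (intro tendsto_divide_zero) simp
  define Q where "Q = {\<omega>\<in>space M. (\<forall>k\<ge>K. \<epsilon> < G k \<omega>) \<and> (\<forall>n\<ge>K. \<exists>k\<ge>n. switch_prob k \<omega> < 1 - \<rho>)}"
  have [measurable]: "Q \<in> sets M" unfolding Q_def by measurable
  have Q: "prob Q \<le> prob (H n - J n) / \<rho>" if n: "K \<le> n" for n
  proof -
    \<comment> \<open>First entrance: \<open>k\<close> is the first time from \<open>n\<close> on at
      which the conditional probability of having switched falls below \<open>1 - \<rho>\<close>.
      The event lies in \<open>F k\<close>, so the conditional probability may be integrated over
      it, and for distinct \<open>k\<close> the events are disjoint.\<close>
    define A where "A k = {\<omega>\<in>space M. n \<le> k \<and> (\<forall>j\<in>{K..k}. \<epsilon> < G j \<omega>)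
        \<and> switch_prob k \<omega> < 1 - \<rho> \<and> (\<forall>j\<in>{n..<k}. 1 - \<rho> \<le> switch_prob j \<omega>)}" for k
    have A_F: "A k \<in> sets (F k)" for k
    proof -
      have P1: "Measurable.pred (F k) (\<lambda>\<omega>. \<forall>j\<in>{K..k}. \<epsilon> < G j \<omega>)"
      proof (intro pred_intros_finite)
        fix j assume "j \<in> {K..k}"
        then have [measurable]: "G j \<in> borel_measurable (F k)" using measurable_F_mono[OF _ G[of j]] by auto
        show "Measurable.pred (F k) (\<lambda>\<omega>. \<epsilon> < G j \<omega>)" by measurable
      qed auto
      have P2: "Measurable.pred (F k) (\<lambda>\<omega>. \<forall>j\<in>{n..<k}. 1 - \<rho> \<le> switch_prob j \<omega>)"
      proof (intro pred_intros_finite)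
        fix j assume "j \<in> {n..<k}"
        then have [measurable]: "switch_prob j \<in> borel_measurable (F k)" using measurable_F_mono[OF _ switch_prob_F[of j]] by auto
        show "Measurable.pred (F k) (\<lambda>\<omega>. 1 - \<rho> \<le> switch_prob j \<omega>)" by measurable
      qed auto
      have P3: "Measurable.pred (F k) (\<lambda>\<omega>. switch_prob k \<omega> < 1 - \<rho>)" by measurable
      have "A k = (if n \<le> k then {\<omega>\<in>space (F k). \<forall>j\<in>{K..k}. \<epsilon> < G j \<omega>} \<inter>
          {\<omega>\<in>space (F k). switch_prob k \<omega> < 1 - \<rho>} \<inter> {\<omega>\<in>space (F k). \<forall>j\<in>{n..<k}. 1 - \<rho> \<le> switch_prob j \<omega>} else {})"
        unfolding A_def by auto
      then show ?thesis using predE[OF P1] predE[OF P2] predE[OF P3] by (simp add: sets.Int)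
    qed
    have [measurable]: "A k \<in> sets M" for k using A_F[of k] F[of k] by (auto simp: subalgebra_def)
    have A_le: "\<rho> * prob (A k) \<le> prob (A k - J k)" for k
    proof -
      interpret Fk: finite_measure_subalgebra M "F k" using F[of k] by unfold_locales
      have iAJ: "integrable M (\<lambda>\<omega>. indicat_real (A k) \<omega> * indicat_real (J k) \<omega>)"
        by (intro integrable_const_bound[where B = 1]) (auto simp: indicator_def)
      have AF: "indicat_real (A k) \<in> borel_measurable (F k)" using A_F by simp
      have ip: "integrable M (\<lambda>\<omega>. indicat_real (A k) \<omega> * switch_prob k \<omega>)"
        unfolding switch_prob_def by (rule Fk.real_cond_exp_intg(1)[OF iAJ AF]) simp
      have "(\<integral>\<omega>. indicat_real (A k) \<omega> * switch_prob k \<omega> \<partial>M) = (\<integral>\<omega>. indicat_real (A k) \<omega> * indicat_real (J k) \<omega> \<partial>M)"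
        unfolding switch_prob_def by (rule Fk.real_cond_exp_intg(2)[OF iAJ AF]) simp
      also have "(\<integral>\<omega>. indicat_real (A k) \<omega> * indicat_real (J k) \<omega> \<partial>M) = prob (A k \<inter> J k)"
        by (simp add: indicator_inter_arith[symmetric])
      finally have e: "(\<integral>\<omega>. indicat_real (A k) \<omega> * switch_prob k \<omega> \<partial>M) = prob (A k \<inter> J k)" .
      have "(\<integral>\<omega>. indicat_real (A k) \<omega> * switch_prob k \<omega> \<partial>M) \<le> (\<integral>\<omega>. (1 - \<rho>) * indicat_real (A k) \<omega> \<partial>M)"
      proof (rule integral_mono[OF ip])
        show "integrable M (\<lambda>\<omega>. (1 - \<rho>) * indicat_real (A k) \<omega>)" by (simp add: less_top[symmetric])
        show "indicat_real (A k) \<omega> * switch_prob k \<omega> \<le> (1 - \<rho>) * indicat_real (A k) \<omega>" for \<omega>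
          by (cases "\<omega> \<in> A k") (auto simp: A_def)
      qed
      also have "\<dots> = (1 - \<rho>) * prob (A k)" by simp
      finally have "prob (A k \<inter> J k) \<le> (1 - \<rho>) * prob (A k)" using e by simp
      moreover have "prob (A k - J k) = prob (A k) - prob (A k \<inter> J k)"
        by (rule finite_measure_Diff') auto
      ultimately show ?thesis by (simp add: algebra_simps)
    qed
    have disj: "disjoint_family A"
    proof -
      have "A i \<inter> A j = {}" if "i < j" for i j
      proof -
        have False if \<omega>: "\<omega> \<in> A i" "\<omega> \<in> A j" for \<omega>
        proof -
          have "i \<in> {n..<j}" "switch_prob i \<omega> < 1 - \<rho>" using \<omega>(1) \<open>i < j\<close> by (auto simp: A_def)
          moreover have "\<forall>i\<in>{n..<j}. 1 - \<rho> \<le> switch_prob i \<omega>" using \<omega>(2) by (simp add: A_def)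
          ultimately show False by force
        qed
        then show ?thesis by blast
      qed
      then have "A i \<inter> A j = {}" if "i \<noteq> j" for i j
        using that nat_neq_iff by (metis Int_commute)
      then show ?thesis by (simp add: disjoint_family_on_def)
    qed
    then have disj': "disjoint_family (\<lambda>k. A k - J k)" by (rule disjoint_family_subset) simp
    have S1: "(\<lambda>k. \<rho> * prob (A k)) sums (\<rho> * prob (\<Union>k. A k))"
      by (intro sums_mult finite_measure_UNION disj) auto
    have S2: "(\<lambda>k. prob (A k - J k)) sums prob (\<Union>k. A k - J k)"
      by (intro finite_measure_UNION disj') auto
    have "\<rho> * prob (\<Union>k. A k) \<le> prob (\<Union>k. A k - J k)"
      by (rule sums_le[OF _ S1 S2]) (use A_le in auto)
    \<comment> \<open>A path not switched at the entrance time \<open>k\<close> has not switched at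
      the earlier time \<open>n\<close>; all entrance events are thus charged to one event.\<close>
    also have "\<dots> \<le> prob (H n - J n)"
    proof (rule finite_measure_mono)
      show "(\<Union>k. A k - J k) \<subseteq> H n - J n"
      proof
        fix \<omega> assume "\<omega> \<in> (\<Union>k. A k - J k)"
        then obtain k where "\<omega> \<in> A k" "\<omega> \<notin> J k" by blast
        then show "\<omega> \<in> H n - J n" using J_mono'[of n k] by (simp add: A_def H_def) auto
      qed
    qed auto
    finally have "prob (\<Union>k. A k) \<le> prob (H n - J n) / \<rho>" using \<rho> by (simp add: field_simps)
    moreover have "Q \<subseteq> (\<Union>k. A k)"
    proof
      fix \<omega> assume \<omega>: "\<omega> \<in> Q"
      then have ex: "\<exists>k. n \<le> k \<and> switch_prob k \<omega> < 1 - \<rho>" using n by (auto simp: Q_def)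
      define k where "k = (LEAST k. n \<le> k \<and> switch_prob k \<omega> < 1 - \<rho>)"
      have "n \<le> k \<and> switch_prob k \<omega> < 1 - \<rho>" unfolding k_def by (rule LeastI_ex[OF ex])
      moreover have "1 - \<rho> \<le> switch_prob j \<omega>" if "j \<in> {n..<k}" for j
        using not_less_Least[of j "\<lambda>k. n \<le> k \<and> switch_prob k \<omega> < 1 - \<rho>"] that by (auto simp: k_def)
      ultimately have "\<omega> \<in> A k" using \<omega> by (auto simp: A_def Q_def)
      then show "\<omega> \<in> (\<Union>k. A k)" by blast
    qed
    then have "prob Q \<le> prob (\<Union>k. A k)" by (intro finite_measure_mono) auto
    ultimately show ?thesis by simp
  qed
  have "prob Q \<le> 0"
    by (rule LIMSEQ_le_const[OF lim]) (intro exI[of _ K] allI impI Q)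
  then have "prob Q = 0" using measure_nonneg[of M Q] by linarith
  then have "AE \<omega> in M. \<omega> \<notin> Q" by (subst (asm) prob_eq_0) auto
  then show ?thesis using AE_space
  proof eventually_elim
    case (elim \<omega>)
    show ?case
    proof (intro impI, rule ccontr)
      assume large: "\<forall>k\<ge>K. \<epsilon> < G k \<omega>" and not_ev: "\<not> (\<exists>n\<ge>K. \<forall>k\<ge>n. 1 - \<rho> \<le> switch_prob k \<omega>)"
      have "\<exists>k\<ge>n. switch_prob k \<omega> < 1 - \<rho>" if "K \<le> n" for n
      proof (rule ccontr)
        assume "\<not> (\<exists>k\<ge>n. switch_prob k \<omega> < 1 - \<rho>)"
        then have "\<forall>k\<ge>n. 1 - \<rho> \<le> switch_prob k \<omega>" by (simp add: not_less)
        with not_ev that show False by blast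
      qed
      with large elim(2) have "\<omega> \<in> Q" by (simp add: Q_def)
      with elim(1) show False by blast
    qed
  qed
qed

text \<open>On a path with slope above \<open>\<epsilon>\<close> from \<open>K\<close> on,
  \<open>null\<close> gives a switch and the maximal inequality makes the switch likely from some
  time on. From the later of both times the path lies in an event that
  \<open>persistent_slope_null\<close> declares null. The constants of the drift bound may depend on
  \<open>\<epsilon>\<close>.\<close>

theorem frequently_small:
  assumes drift: "\<And>\<epsilon>. 0 < \<epsilon> \<Longrightarrow> \<exists>\<kappa>>0. \<exists>\<rho>>0. \<exists>b K0. summable b \<and> (\<forall>k. 0 \<le> b k) \<and>
      (\<forall>k\<ge>K0. drift_bound \<epsilon> \<kappa> \<rho> b k)"
    and null: "\<And>\<epsilon> K. 0 < \<epsilon> \<Longrightarrow> AE \<omega> in M. (\<forall>k\<ge>K. \<epsilon> < G k \<omega>) \<longrightarrow> (\<exists>k. \<omega> \<in> J k)"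
  shows "AE \<omega> in M. \<forall>i K :: nat. \<exists>k\<ge>K. G k \<omega> \<le> 1 / real (Suc i)"
  unfolding AE_all_countable
proof (intro allI)
  fix i K :: nat
  define \<epsilon> where "\<epsilon> = 1 / real (Suc i)"
  have \<epsilon>: "0 < \<epsilon>" by (simp add: \<epsilon>_def)
  obtain \<kappa> \<rho> b K0 where *: "0 < \<kappa>" "0 < \<rho>" "summable b" "\<And>k. 0 \<le> b k" "\<And>k. K0 \<le> k \<Longrightarrow> drift_bound \<epsilon> \<kappa> \<rho> b k"
    using drift[OF \<epsilon>] by blast
  have "AE \<omega> in M. \<forall>K. \<omega> \<in> J K \<longrightarrow> (\<exists>k\<ge>K. \<not> (\<epsilon> < G k \<omega> \<and> 1 - \<rho> \<le> switch_prob k \<omega>))"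
    unfolding AE_all_countable using persistent_slope_null[OF \<epsilon> *(1,3,4,5)] by blast
  moreover note eventually_switch_prob_ge[OF *(2) null[OF \<epsilon>, of K]] null[OF \<epsilon>, of K]
  ultimately have "AE \<omega> in M. \<exists>k\<ge>K. G k \<omega> \<le> \<epsilon>"
  proof eventually_elim
    case (elim \<omega>)
    show ?case
    proof (rule ccontr)
      assume "\<not> ?case"
      then have "\<epsilon> < G k \<omega>" if "K \<le> k" for k using that by (metis not_le)
      then have large: "\<forall>k\<ge>K. \<epsilon> < G k \<omega>" by blast
      with elim obtain n m where "n \<ge> K" "\<forall>k\<ge>n. 1 - \<rho> \<le> switch_prob k \<omega>" "\<omega> \<in> J m" by blast
      then have "\<omega> \<in> J (max n m)" "\<forall>k\<ge>max n m. \<epsilon> < G k \<omega> \<and> 1 - \<rho> \<le> switch_prob k \<omega>"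
        using large J_mono'[of m "max n m"] by auto
      with elim(1) show False by blast
    qed
  qed
  then show "AE \<omega> in M. \<exists>k\<ge>K. G k \<omega> \<le> 1 / real (Suc i)" by (simp add: \<epsilon>_def)
qed

end

section \<open>The LSOS iteration\<close>

text \<open>Telescoping from \<open>K\<close> bounds the partial sums of \<open>q\<close>, since
  \<open>v\<close> is bounded below and the perturbations are summable.\<close>

lemma tendsto_0_of_descent:
  fixes v q \<zeta> :: "nat \<Rightarrow> real"
  assumes step: "\<And>k. K \<le> k \<Longrightarrow> v (Suc k) \<le> v k - c * q k + C * \<zeta> k"
    and low: "\<And>k. low \<le> v k" and q: "\<And>k. 0 \<le> q k" and c: "0 < c"
    and \<zeta>: "summable \<zeta>" "\<And>k. 0 \<le> \<zeta> k" and C: "0 \<le> C"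
  shows "q \<longlonglongrightarrow> 0"
proof -
  have tele: "v (K + n) + c * (\<Sum>i<n. q (K + i)) \<le> v K + C * (\<Sum>i<n. \<zeta> (K + i))" for n
  proof (induction n)
    case (Suc n)
    then show ?case using step[of "K + n"] by (simp add: algebra_simps)
  qed simp
  have "summable (\<lambda>i. q (K + i))"
  proof (rule summableI_nonneg_bounded)
    fix n
    have "(\<Sum>i<n. \<zeta> (K + i)) = sum \<zeta> ((\<lambda>i. K + i) ` {..<n})" by (subst sum.reindex) auto
    also have "\<dots> \<le> (\<Sum>k. \<zeta> k)" by (rule sum_le_suminf) (use \<zeta> in auto)
    finally have "C * (\<Sum>i<n. \<zeta> (K + i)) \<le> C * (\<Sum>k. \<zeta> k)" using C by (rule mult_left_mono)
    then have "c * (\<Sum>i<n. q (K + i)) \<le> v K - low + C * (\<Sum>k. \<zeta> k)" using tele[of n] low[of "K + n"] by linarith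
    then show "(\<Sum>i<n. q (K + i)) \<le> (v K - low + C * (\<Sum>k. \<zeta> k)) / c" using c by (simp add: field_simps)
  qed (use q in auto)
  then have "(\<lambda>i. q (i + K)) \<longlonglongrightarrow> 0" by (simp add: add.commute summable_LIMSEQ_zero)
  then show ?thesis by (rule LIMSEQ_offset)
qed

text \<open>With residual \<open>r\<close>, the direction is the inverse of \<open>B\<close> applied
  to \<open>r - g\<close>, and \<open>g\<close> splits into \<open>G x\<close> and noise. The part
  from \<open>G x\<close> gives the descent. The part linear in the noise is kept exactly, because
  it will be removed by orthogonality and not by size. The residual and the second-order term go
  into the remainder: \<open>2 / \<mu>\<close> stems from the residual,
  \<open>4 * L / \<mu>^2\<close> from \<open>L / 2\<close> times the bound
  \<open>8 / \<mu>^2\<close> for the squared direction, which uses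
  \<open>\<delta> <= 1\<close>.\<close>

lemma inexact_newton_step:
  fixes f :: "real ^ 'n \<Rightarrow> real" and B :: "real ^ 'n ^ 'n"
  assumes f: "\<And>y. GDERIV f y :> G y" and lip: "L-lipschitz_on UNIV G"
    and B: "transpose B = B" "loewner_le (mat \<mu>) B" "loewner_le B (mat L)" and pos: "0 < \<mu>" "0 < L"
    and res: "norm (B *v d + g) \<le> \<delta> * norm g" and \<delta>: "0 \<le> \<delta>" "\<delta> \<le> 1" and a: "0 < a"
  shows "f (x + a *\<^sub>R d) - f x \<le>
    - a / L * (norm (G x))\<^sup>2 - a * inner (G x) (matrix_inv B *v (g - G x)) +
    (2 / \<mu> + 4 * L / \<mu>\<^sup>2) * (a * \<delta> + a\<^sup>2) * ((norm (G x))\<^sup>2 + (norm (g - G x))\<^sup>2)"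
proof -
  define r where "r = B *v d + g"
  define e where "e = g - G x"
  let ?I = "\<lambda>v. matrix_inv B *v v"
  have "B *v (d - ?I (r - g)) = 0"
    by (simp add: matrix_vector_mult_diff_distrib matrix_inv_cancel[OF B pos] r_def)
  then have d: "d = ?I (r - g)"
    using loewner_norm_lower[OF B pos, of "d - ?I (r - g)"] pos by (simp add: mult_le_0_iff)
  have "r - g = r - G x - e" by (simp add: e_def)
  then have "?I (r - g) = ?I r - ?I (G x) - ?I e" by (simp only: matrix_vector_mult_diff_distrib)
  then have dd: "inner (G x) d = inner (G x) (?I r) - inner (G x) (?I (G x)) - inner (G x) (?I e)"
    by (subst d) (simp only: inner_diff_right)
  have g2: "(norm g)\<^sup>2 \<le> 2 * ((norm (G x))\<^sup>2 + (norm e)\<^sup>2)"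
  proof -
    have "norm g \<le> norm (G x) + norm e" unfolding e_def by norm
    then have "(norm g)\<^sup>2 \<le> (norm (G x) + norm e)\<^sup>2" by (intro power_mono) auto
    also have "\<dots> \<le> 2 * ((norm (G x))\<^sup>2 + (norm e)\<^sup>2)"
      using sum_squares_bound[of "norm (G x)" "norm e"] by (simp add: power2_sum)
    finally show ?thesis .
  qed
  define q where "q = (norm (G x))\<^sup>2 + (norm e)\<^sup>2"
  have q: "0 \<le> q" "(norm (G x))\<^sup>2 \<le> q" by (auto simp: q_def)
  have t1: "inner (G x) (?I r) \<le> 2 / \<mu> * \<delta> * q"
  proof -
    have "inner (G x) (?I r) \<le> norm (G x) * (norm r / \<mu>)"
      by (rule order_trans[OF norm_cauchy_schwarz]) (intro mult_left_mono norm_matrix_inv_le[OF B pos] norm_ge_zero)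
    also have "\<dots> \<le> norm (G x) * (\<delta> * norm g / \<mu>)"
      using res pos by (intro mult_left_mono divide_right_mono) (auto simp: r_def)
    also have "\<dots> = \<delta> / \<mu> * (norm (G x) * norm g)" by simp
    also have "\<dots> \<le> \<delta> / \<mu> * (2 * q)"
    proof (rule mult_left_mono)
      show "norm (G x) * norm g \<le> 2 * q"
        using sum_squares_bound[of "norm (G x)" "norm g"] g2 q unfolding q_def[symmetric] by linarith
    qed (use \<delta> pos in auto)
    finally show ?thesis by (simp add: mult_ac)
  qed
  have t2: "(norm d)\<^sup>2 \<le> 8 / \<mu>\<^sup>2 * q"
  proof -
    have "norm d \<le> norm (r - g) / \<mu>" unfolding d by (rule norm_matrix_inv_le[OF B pos])
    also have "norm (r - g) \<le> norm r + norm g" by (rule norm_triangle_ineq4)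
    also have "norm r \<le> 1 * norm g" using res mult_right_mono[OF \<delta>(2), of "norm g"] by (simp add: r_def)
    finally have "norm d \<le> 2 * norm g / \<mu>" using pos by (simp add: divide_right_mono)
    then have "(norm d)\<^sup>2 \<le> (2 * norm g / \<mu>)\<^sup>2" by (intro power_mono) auto
    also have "\<dots> = 4 / \<mu>\<^sup>2 * (norm g)\<^sup>2" by (simp add: power_mult_distrib power_divide)
    also have "\<dots> \<le> 4 / \<mu>\<^sup>2 * (2 * q)" using g2 by (intro mult_left_mono) (auto simp: q_def)
    finally show ?thesis by simp
  qed
  have t3: "(norm (G x))\<^sup>2 / L \<le> inner (G x) (?I (G x))" by (rule inner_matrix_inv_ge[OF B pos])
  have "f (x + a *\<^sub>R d) - f x \<le> a * inner (G x) d + L / 2 * (a\<^sup>2 * (norm d)\<^sup>2)"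
    using descent_lemma[OF f lip, of x "a *\<^sub>R d"] by (simp add: power_mult_distrib inner_commute)
  also have "\<dots> \<le> a * (2 / \<mu> * \<delta> * q - (norm (G x))\<^sup>2 / L - inner (G x) (?I e)) + L / 2 * (a\<^sup>2 * (8 / \<mu>\<^sup>2 * q))"
    unfolding dd using t1 t2 t3 a pos by (intro add_mono mult_left_mono) auto
  also have "\<dots> = - a / L * (norm (G x))\<^sup>2 - a * inner (G x) (?I e) + (2 / \<mu> * (a * \<delta>) + 4 * L / \<mu>\<^sup>2 * a\<^sup>2) * q"
    by (simp add: algebra_simps)
  also have "(2 / \<mu> * (a * \<delta>) + 4 * L / \<mu>\<^sup>2 * a\<^sup>2) * q \<le> (2 / \<mu> + 4 * L / \<mu>\<^sup>2) * (a * \<delta> + a\<^sup>2) * q"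
  proof (rule mult_right_mono)
    have "0 \<le> 2 / \<mu> * a\<^sup>2 + 4 * L / \<mu>\<^sup>2 * (a * \<delta>)"
      using pos a \<delta> by (intro add_nonneg_nonneg mult_nonneg_nonneg divide_nonneg_nonneg) auto
    then show "2 / \<mu> * (a * \<delta>) + 4 * L / \<mu>\<^sup>2 * a\<^sup>2 \<le> (2 / \<mu> + 4 * L / \<mu>\<^sup>2) * (a * \<delta> + a\<^sup>2)"
      unfolding distrib_left distrib_right by linarith
  qed (rule q)
  finally show ?thesis by (simp add: q_def e_def)
qed

locale lsos_run = prob_space M for M :: "'w measure" +
  fixes \<phi> :: "nat \<Rightarrow> real ^ 'n \<Rightarrow> real"
    and N Kmax :: nat
    and \<eta> \<beta> cmin Cmax phi_low L \<mu> c1 :: real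
    and \<alpha> \<zeta> \<delta> :: "nat \<Rightarrow> real"
    and x g d :: "nat \<Rightarrow> 'w \<Rightarrow> real ^ 'n"
    and B :: "nat \<Rightarrow> 'w \<Rightarrow> real ^ 'n ^ 'n"
    and S D :: "nat \<Rightarrow> 'w \<Rightarrow> nat set"
    and t :: "nat \<Rightarrow> 'w \<Rightarrow> real"
    and Kf ind :: "nat \<Rightarrow> 'w \<Rightarrow> nat"
  assumes N: "N \<ge> 1"
    and smooth: "\<And>i. i \<in> {1..N} \<Longrightarrow> twice_continuously_differentiable (\<phi> i)"
    and cmin: "0 < cmin" and Cmax: "0 < Cmax"
    and \<alpha>: "\<And>k. 0 < \<alpha> k" and \<zeta>: "\<And>k. 0 < \<zeta> k" and \<delta>: "\<And>k. 0 \<le> \<delta> k"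
    and x[measurable]: "\<And>k. x k \<in> borel_measurable M" and B[measurable]: "\<And>k. B k \<in> borel_measurable M"
    and g[measurable]: "\<And>k. g k \<in> borel_measurable M" and d[measurable]: "\<And>k. d k \<in> borel_measurable M"
    and init: "\<And>\<omega>. \<omega> \<in> space M \<Longrightarrow> Kf 0 \<omega> = 0 \<and> ind 0 \<omega> = 0"
    and iter: "\<And>k \<omega>. \<omega> \<in> space M \<Longrightarrow>
           LSOS_iteration \<phi> \<eta> \<beta> cmin Cmax Kmax (\<alpha> k) (\<zeta> k) (\<delta> k) (S k \<omega>) (D k \<omega>)
             (B k \<omega>) (g k \<omega>) (d k \<omega>) (t k \<omega>)
             (x k \<omega>, Kf k \<omega>, ind k \<omega>) (x (Suc k) \<omega>, Kf (Suc k) \<omega>, ind (Suc k) \<omega>)"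
    and S: "\<And>k. S k \<in> measurable M (count_space (Pow {1..N} - {{}}))"
    and D: "\<And>k. uniform_sample M (mid_history_algebra M x B S g d D k) N (D k)"
    and D_indep: "\<And>k. independent_of_algebra M (mid_history_algebra M x B S g d D k) (D k)"
    and ci: "\<And>k. cond_indep M (iterate_algebra M x k) (g k) (B k)"
    and low: "\<And>y. phi_low \<le> full_fun \<phi> N y"
    and lip: "\<And>i. i \<in> {1..N} \<Longrightarrow> L-lipschitz_on UNIV (gradient (\<phi> i))"
    and \<mu>: "0 < \<mu>" and L: "0 < L"
    and spd: "AE \<omega> in M. \<forall>k. transpose (B k \<omega>) = B k \<omega> \<and>
           loewner_le (mat \<mu>) (B k \<omega>) \<and> loewner_le (B k \<omega>) (mat L)"
    and c1: "0 < c1"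
    and mean: "\<And>k. AE \<omega> in M. vec_cond_exp M (iterate_algebra M x k) (g k) \<omega> =
           gradient (full_fun \<phi> N) (x k \<omega>)"
    and var: "\<And>k. AE \<omega> in M. nn_cond_exp M (iterate_algebra M x k)
             (\<lambda>\<omega>. ennreal ((norm (gradient (full_fun \<phi> N) (x k \<omega>) - g k \<omega>))\<^sup>2)) \<omega> \<le> ennreal c1"
    and sum_\<zeta>: "summable \<zeta>"
    and \<alpha>_div: "filterlim (\<lambda>n. \<Sum>k<n. \<alpha> k) at_top sequentially"
    and sum_\<alpha>2: "summable (\<lambda>k. (\<alpha> k)\<^sup>2)"
    and \<delta>_0: "\<delta> \<longlonglongrightarrow> 0"
    and sum_\<delta>\<alpha>: "summable (\<lambda>k. \<delta> k * \<alpha> k)"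
begin

section \<open>Smoothness and measurability of the full and sampled objectives\<close>

abbreviation "f \<equiv> full_fun \<phi> N"
abbreviation "Df \<equiv> sample_grad \<phi> {1..N}"

lemma GDERIV_f: "GDERIV f y :> Df y"
  by (rule GDERIV_sample_fun) (use smooth in auto)

lemma gradient_f: "gradient f = Df"
  by (rule ext) (rule gradient_eq[OF GDERIV_f])

lemma lipschitz_Df: "L-lipschitz_on UNIV Df"
  by (rule lipschitz_sample_grad) (use lip N in auto)

lemma continuous_Df: "continuous_on UNIV Df"
  using lipschitz_Df by (rule lipschitz_on_continuous_on)

lemma sample_fun_measurable: "V \<subseteq> {1..N} \<Longrightarrow> sample_fun \<phi> V \<in> borel_measurable borel"
proof (rule borel_measurable_continuous_onI)
  assume "V \<subseteq> {1..N}"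
  then have "GDERIV (sample_fun \<phi> V) y :> sample_grad \<phi> V y" for y
    using smooth by (intro GDERIV_sample_fun) auto
  then show "continuous_on UNIV (sample_fun \<phi> V)"
    unfolding gderiv_def by (metis continuous_at_imp_continuous_on has_derivative_continuous)
qed

lemma sample_grad_measurable: "V \<subseteq> {1..N} \<Longrightarrow> sample_grad \<phi> V \<in> borel_measurable borel"
proof (cases "V = {}")
  case False
  assume "V \<subseteq> {1..N}"
  then have "L-lipschitz_on UNIV (sample_grad \<phi> V)"
    using False lip finite_subset by (intro lipschitz_sample_grad) auto
  then show ?thesis by (intro borel_measurable_continuous_onI lipschitz_on_continuous_on)
qed (simp add: sample_grad_def[abs_def])

lemma f_measurable [measurable]: "f \<in> borel_measurable borel"
  and Df_measurable [measurable]: "Df \<in> borel_measurable borel"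
  by (auto intro: sample_fun_measurable sample_grad_measurable)

lemma random_sample_measurable:
  assumes V[measurable]: "V \<in> measurable H (count_space (Pow {1..N}))" and y[measurable]: "y \<in> borel_measurable H"
  shows "(\<lambda>\<omega>. sample_fun \<phi> (V \<omega>) (y \<omega>)) \<in> borel_measurable H"
    and "(\<lambda>\<omega>. sample_grad \<phi> (V \<omega>) (y \<omega>)) \<in> borel_measurable H"
proof -
  have c: "countable (Pow {1..N})" by (intro countable_finite) simp
  show "(\<lambda>\<omega>. sample_fun \<phi> (V \<omega>) (y \<omega>)) \<in> borel_measurable H"
    by (rule measurable_compose_countable'[OF _ V c]) (use measurable_compose[OF y sample_fun_measurable] in auto)
  show "(\<lambda>\<omega>. sample_grad \<phi> (V \<omega>) (y \<omega>)) \<in> borel_measurable H"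
    by (rule measurable_compose_countable'[OF _ V c]) (use measurable_compose[OF y sample_grad_measurable] in auto)
qed

section \<open>Measurability with respect to the history before the second sample\<close>

abbreviation "mid \<equiv> mid_history_algebra M x B S g d D"

lemma D_M [measurable]: "D k \<in> measurable M (count_space (Pow {1..N} - {{}}))"
  using D[of k] by (simp add: uniform_sample_def)

lemma preimages_subset: "X \<in> measurable M T \<Longrightarrow> preimages M X T \<subseteq> sets M"
  by (auto simp: preimages_def)

lemma preimages_sample_subset:
  assumes X: "X \<in> measurable M (count_space A)"
  shows "preimages M X (count_space UNIV) \<subseteq> sets M"
proof
  fix E assume "E \<in> preimages M X (count_space UNIV)"
  then obtain C where "E = X -` C \<inter> space M" by (auto simp: preimages_def)
  then have "E = X -` (C \<inter> A) \<inter> space M" using measurable_space[OF X] by auto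
  then show "E \<in> sets M" using measurable_sets[OF X, of "C \<inter> A"] by simp
qed

lemma mid_events_subset:
  "history_events M x B S g d D k \<union> preimages M (S k) (count_space UNIV) \<union>
     preimages M (g k) borel \<union> preimages M (d k) borel \<subseteq> sets M"
proof -
  note * = preimages_subset[OF x] preimages_subset[OF B] preimages_subset[OF g] preimages_subset[OF d]
    preimages_sample_subset[OF S] preimages_sample_subset[OF D_M]
  show ?thesis unfolding history_events_def by (intro Un_least UN_least *)
qed

lemma space_mid [simp]: "space (mid k) = space M"
  using mid_events_subset[of k] sets.space_closed[of M]
  unfolding mid_history_algebra_def by (intro space_measure_of) blast

lemma sets_mid:
  "sets (mid k) = sigma_sets (space M) (history_events M x B S g d D k \<union>
     preimages M (S k) (count_space UNIV) \<union> preimages M (g k) borel \<union> preimages M (d k) borel)"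
  using mid_events_subset[of k] sets.space_closed[of M]
  unfolding mid_history_algebra_def by (intro sets_measure_of) blast

lemma subalgebra_mid: "subalgebra M (mid k)"
  unfolding subalgebra_def sets_mid by (auto intro: sets.sigma_sets_subset[OF mid_events_subset, THEN subsetD])

text \<open>The disjunction covers both kinds of generators: vectors enter the algebra by their
  Borel preimages, samples by preimages under \<open>count_space UNIV\<close> although their target
  is a smaller count space.\<close>

lemma measurable_midI:
  assumes "\<And>\<omega>. \<omega> \<in> space M \<Longrightarrow> X \<omega> \<in> space T"
    and "preimages M X (count_space UNIV) \<subseteq> E \<or> preimages M X T \<subseteq> E"
    and "E \<subseteq> history_events M x B S g d D k \<union>
     preimages M (S k) (count_space UNIV) \<union> preimages M (g k) borel \<union> preimages M (d k) borel"
  shows "X \<in> measurable (mid k) T"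
proof (rule measurableI)
  fix A assume A: "A \<in> sets T"
  then have "X -` A \<inter> space M \<in> preimages M X T" "X -` A \<inter> space M \<in> preimages M X (count_space UNIV)"
    by (auto simp: preimages_def)
  then have "X -` A \<inter> space M \<in> E" using assms(2) by blast
  then have "X -` A \<inter> space M \<in> sets (mid k)"
    unfolding sets_mid using assms(3) by (intro sigma_sets.Basic) (rule subsetD)
  then show "X -` A \<inter> space (mid k) \<in> sets (mid k)" by simp
qed (use assms(1) in simp)

lemma mid_measurable:
  assumes "j \<le> k"
  shows "x j \<in> borel_measurable (mid k)" "g j \<in> borel_measurable (mid k)" "d j \<in> borel_measurable (mid k)"
    and "S j \<in> measurable (mid k) (count_space (Pow {1..N}))"
proof -
  have jk: "j \<in> {..k}" "j \<in> {..<k} \<or> j = k" using assms by auto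
  show "x j \<in> borel_measurable (mid k)"
    by (rule measurable_midI[OF _ disjI2[OF order_refl]]) (use jk(1) in \<open>auto simp: history_events_def\<close>)
  show "g j \<in> borel_measurable (mid k)"
  proof (rule measurable_midI[OF _ disjI2[OF order_refl]])
    show "preimages M (g j) borel \<subseteq> history_events M x B S g d D k \<union>
     preimages M (S k) (count_space UNIV) \<union> preimages M (g k) borel \<union> preimages M (d k) borel"
      using jk(2) unfolding history_events_def by blast
  qed simp
  show "d j \<in> borel_measurable (mid k)"
  proof (rule measurable_midI[OF _ disjI2[OF order_refl]])
    show "preimages M (d j) borel \<subseteq> history_events M x B S g d D k \<union>
     preimages M (S k) (count_space UNIV) \<union> preimages M (g k) borel \<union> preimages M (d k) borel"
      using jk(2) unfolding history_events_def by blast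
  qed simp
  show "S j \<in> measurable (mid k) (count_space (Pow {1..N}))"
  proof (rule measurable_midI[OF _ disjI1[OF order_refl]])
    show "preimages M (S j) (count_space UNIV) \<subseteq> history_events M x B S g d D k \<union>
     preimages M (S k) (count_space UNIV) \<union> preimages M (g k) borel \<union> preimages M (d k) borel"
      using jk(2) unfolding history_events_def by blast
  qed (use measurable_space[OF S[of j]] in auto)
qed

lemma mid_measurable_D:
  assumes "j < k"
  shows "D j \<in> measurable (mid k) (count_space (Pow {1..N}))"
proof (rule measurable_midI[OF _ disjI1[OF order_refl]])
  have "j \<in> {..<k}" using assms by simp
  then show "preimages M (D j) (count_space UNIV) \<subseteq> history_events M x B S g d D k \<union>
     preimages M (S k) (count_space UNIV) \<union> preimages M (g k) borel \<union> preimages M (d k) borel"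
    unfolding history_events_def by blast
qed (use measurable_space[OF D_M[of j]] in auto)

text \<open>
  The trial step length is defined at every iteration, also after the switch, so that the events below do not
  refer to the indicator of the switch.
\<close>

definition trial :: "nat \<Rightarrow> 'w \<Rightarrow> real ^ 'n" where
  "trial k \<omega> = x k \<omega> + \<beta> ^ (LEAST j. line_search_condition \<phi> (S k \<omega>) \<eta> (\<zeta> k) (x k \<omega>) (g k \<omega>) (d k \<omega>) (\<beta> ^ j)) *\<^sub>R d k \<omega>"

definition rejects :: "nat \<Rightarrow> nat set \<Rightarrow> 'w \<Rightarrow> bool" where
  "rejects k V \<omega> \<longleftrightarrow> \<not> acceptance_condition \<phi> V cmin Cmax (\<zeta> k) (x k \<omega>) (trial k \<omega>)"

text \<open>A substitute for \<open>Kf\<close>: both agree until the switch, and afterwards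
  hypothetical rejections continue to be counted. \<open>Kf\<close> and \<open>ind\<close> come
  without a measurability hypothesis, whereas this counter, which involves the second samples of
  indices below \<open>k\<close> only, is measurable in \<open>mid k\<close>.\<close>

definition rejections :: "nat \<Rightarrow> 'w \<Rightarrow> nat" where
  "rejections k \<omega> = (\<Sum>j<k. if rejects j (D j \<omega>) \<omega> then 1 else 0)"

lemma trial_measurable:
  assumes "j \<le> k"
  shows "trial j \<in> borel_measurable (mid k)"
proof -
  note [measurable] = mid_measurable[OF assms]
  note [measurable] = random_sample_measurable(1)[OF mid_measurable(4)[OF assms]]
  show ?thesis unfolding trial_def line_search_condition_def by measurable
qed

lemma rejects_measurable:
  assumes j: "j \<le> k" and V: "V \<in> measurable (mid k) (count_space (Pow {1..N}))"
  shows "Measurable.pred (mid k) (\<lambda>\<omega>. rejects j (V \<omega>) \<omega>)"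
proof -
  note [measurable] = random_sample_measurable[OF V] mid_measurable(1)[OF j] trial_measurable[OF j]
  show ?thesis unfolding rejects_def acceptance_condition_def by measurable
qed

lemma rejections_measurable: "rejections k \<in> measurable (mid k) (count_space UNIV)"
proof -
  have [measurable]: "Measurable.pred (mid k) (\<lambda>\<omega>. rejects j (D j \<omega>) \<omega>)" if "j < k" for j
    using that by (intro rejects_measurable mid_measurable_D) auto
  show ?thesis unfolding rejections_def by measurable
qed

lemma rejections_measurable_M [measurable]: "rejections k \<in> measurable M (count_space UNIV)"
  by (rule measurable_from_subalg[OF subalgebra_mid rejections_measurable])

lemma rejects_measurable_M [measurable]: "Measurable.pred M (\<lambda>\<omega>. rejects k (D k \<omega>) \<omega>)"
  by (rule measurable_from_subalg[OF subalgebra_mid[of "Suc k"]])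
    (intro rejects_measurable mid_measurable_D; simp)

lemma trial_eq:
  assumes \<omega>: "\<omega> \<in> space M" and "ind k \<omega> = 0"
  shows "trial k \<omega> = x k \<omega> + t k \<omega> *\<^sub>R d k \<omega>"
proof -
  obtain j where j: "t k \<omega> = \<beta> ^ j"
    "line_search_condition \<phi> (S k \<omega>) \<eta> (\<zeta> k) (x k \<omega>) (g k \<omega>) (d k \<omega>) (\<beta> ^ j)"
    "\<forall>i<j. \<not> line_search_condition \<phi> (S k \<omega>) \<eta> (\<zeta> k) (x k \<omega>) (g k \<omega>) (d k \<omega>) (\<beta> ^ i)"
    using iter[OF \<omega>, of k] assms by (auto simp: LSOS_iteration_def)
  then have "(LEAST j. line_search_condition \<phi> (S k \<omega>) \<eta> (\<zeta> k) (x k \<omega>) (g k \<omega>) (d k \<omega>) (\<beta> ^ j)) = j"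
    by (intro Least_equality) (auto simp: not_less[symmetric])
  then show ?thesis using j by (simp add: trial_def)
qed

text \<open>After the switch \<open>Kf\<close> is frozen while \<open>rejections\<close> may grow,
  so equality is lost and only the comparison of each with \<open>Kmax\<close> survives. This
  comparison is enough to express the switch through \<open>rejections\<close>.\<close>

lemma ind_rejections:
  assumes \<omega>: "\<omega> \<in> space M"
  shows "if ind k \<omega> = 0 then Kf k \<omega> = rejections k \<omega> \<and> Kf k \<omega> \<le> Kmax
    else Kmax < Kf k \<omega> \<and> Kmax < rejections k \<omega>"
proof (induction k)
  case 0
  then show ?case using init[OF \<omega>] by (simp add: rejections_def)
next
  case (Suc k)
  then show ?case using iter[OF \<omega>, of k] trial_eq[OF \<omega>, of k]
    by (cases "ind k \<omega> = 0")
      (auto simp: LSOS_iteration_def rejections_def rejects_def split: if_splits)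
qed

lemma iterate_accepted:
  assumes \<omega>: "\<omega> \<in> space M" and "ind k \<omega> = 0" "\<not> rejects k (D k \<omega>) \<omega>"
  shows "x (Suc k) \<omega> = trial k \<omega>"
  using assms iter[OF \<omega>, of k] trial_eq[OF \<omega>, of k]
  by (auto simp: LSOS_iteration_def rejects_def split: if_splits)


section \<open>Borel-Cantelli for the rejected trial points\<close>

lemma sum_early_rejections:
  "(\<Sum>k<n. if rejections k \<omega> \<le> Kmax \<and> rejects k (D k \<omega>) \<omega> then 1 else 0) = min (rejections n \<omega>) (Suc Kmax)"
  by (induction n) (auto simp: rejections_def)

text \<open>The partial sums are means of a count that is capped at \<open>Suc Kmax\<close> on every
  path.\<close>

lemma summable_early_rejections:
  "summable (\<lambda>k. prob {\<omega>\<in>space M. rejections k \<omega> \<le> Kmax \<and> rejects k (D k \<omega>) \<omega>})"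
proof (rule summableI_nonneg_bounded)
  fix n
  let ?E = "\<lambda>k. {\<omega>\<in>space M. rejections k \<omega> \<le> Kmax \<and> rejects k (D k \<omega>) \<omega>}"
  have "(\<Sum>k<n. prob (?E k)) = (\<integral>\<omega>. (\<Sum>k<n. indicat_real (?E k) \<omega>) \<partial>M)"
    by (subst Bochner_Integration.integral_sum) (auto simp: less_top[symmetric])
  also have "\<dots> \<le> (\<integral>\<omega>. real (Suc Kmax) \<partial>M)"
  proof (rule integral_mono)
    fix \<omega> assume "\<omega> \<in> space M"
    then have "(\<Sum>k<n. indicat_real (?E k) \<omega>) =
        (\<Sum>k<n. real (if rejections k \<omega> \<le> Kmax \<and> rejects k (D k \<omega>) \<omega> then 1 else 0))"
      by (intro sum.cong) (auto simp: indicator_def)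
    also have "\<dots> = real (min (rejections n \<omega>) (Suc Kmax))"
      by (simp only: of_nat_sum[symmetric] sum_early_rejections)
    finally show "(\<Sum>k<n. indicat_real (?E k) \<omega>) \<le> real (Suc Kmax)" by simp
  qed (auto simp: less_top[symmetric])
  finally show "(\<Sum>k<n. prob (?E k)) \<le> real (Suc Kmax)" by (simp add: prob_space)
qed simp

lemma rejects_fixed_measurable:
  assumes "V \<subseteq> {1..N}"
  shows "{\<omega>\<in>space M. rejections k \<omega> \<le> Kmax \<and> rejects k V \<omega>} \<in> sets (mid k)"
proof -
  have [measurable]: "Measurable.pred (mid k) (rejects k V)"
    using assms by (intro rejects_measurable) auto
  have [measurable]: "rejections k \<in> measurable (mid k) (count_space UNIV)" by (rule rejections_measurable)
  have "{\<omega>\<in>space (mid k). rejections k \<omega> \<le> Kmax \<and> rejects k V \<omega>} \<in> sets (mid k)" by measurable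
  then show ?thesis by simp
qed

text \<open>That a fixed set \<open>V\<close> would reject is decided before the second sample is
  drawn, hence is independent of the event that \<open>V\<close> is drawn; when both occur, an early
  rejection takes place.\<close>

lemma prob_rejects_le:
  assumes V: "V \<subseteq> {1..N}"
  shows "prob {\<omega>\<in>space M. D k \<omega> = V} * prob {\<omega>\<in>space M. rejections k \<omega> \<le> Kmax \<and> rejects k V \<omega>} \<le>
    prob {\<omega>\<in>space M. rejections k \<omega> \<le> Kmax \<and> rejects k (D k \<omega>) \<omega>}"
proof -
  let ?A = "{\<omega>\<in>space M. D k \<omega> = V}" and ?R = "{\<omega>\<in>space M. rejections k \<omega> \<le> Kmax \<and> rejects k V \<omega>}"
  have "?A = D k -` {V} \<inter> space M" by auto
  then have "?A \<in> preimages M (D k) (count_space UNIV)" by (auto simp: preimages_def)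
  then have "prob (?A \<inter> ?R) = prob ?A * prob ?R"
    by (rule indep_setD[OF D_indep[unfolded independent_of_algebra_def] _ rejects_fixed_measurable[OF V]])
  moreover have "prob (?A \<inter> ?R) \<le> prob {\<omega>\<in>space M. rejections k \<omega> \<le> Kmax \<and> rejects k (D k \<omega>) \<omega>}"
    by (rule finite_measure_mono) auto
  ultimately show ?thesis by simp
qed

text \<open>The law of the sample size may vary with k, so the likely size m does as well.\<close>

lemma likely_sample_size:
  "\<exists>m. 0 < m \<and> m \<le> N \<and> (\<forall>V. V \<subseteq> {1..N} \<longrightarrow> card V = m \<longrightarrow> 1 / 2 ^ N \<le> prob {\<omega>\<in>space M. D k \<omega> = V})"
proof -
  have [measurable]: "{\<omega>\<in>space M. D k \<omega> = V} \<in> sets M" if "V \<subseteq> {1..N}" for V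
    using preimages_sample_subset[OF D_M[of k]] by (force simp: preimages_def vimage_def)
  \<comment> \<open>Pigeonhole over the \<open>2 ^ N\<close> subsets. Uniformity, applied to the
    whole space, then gives every set of the same cardinality the same probability.\<close>
  have "\<exists>V\<in>Pow {1..N}. 1 / 2 ^ N \<le> prob {\<omega>\<in>space M. D k \<omega> = V}"
  proof (rule ccontr)
    assume "\<not> ?thesis"
    then have small: "prob {\<omega>\<in>space M. D k \<omega> = V} < 1 / 2 ^ N" if "V \<in> Pow {1..N}" for V
      using that by (meson not_le)
    have "space M = (\<Union>V\<in>Pow {1..N}. {\<omega>\<in>space M. D k \<omega> = V})"
      using measurable_space[OF D_M[of k]] by auto
    then have "1 = prob (\<Union>V\<in>Pow {1..N}. {\<omega>\<in>space M. D k \<omega> = V})" using prob_space by metis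
    also have "\<dots> \<le> (\<Sum>V\<in>Pow {1..N}. prob {\<omega>\<in>space M. D k \<omega> = V})"
      by (rule finite_measure_subadditive_finite) auto
    also have "\<dots> < (\<Sum>V\<in>Pow {1..N}. 1 / 2 ^ N)"
      by (rule sum_strict_mono) (use small in auto)
    also have "\<dots> = 1" by (simp add: card_Pow)
    finally show False by simp
  qed
  then obtain V where V: "V \<subseteq> {1..N}" "1 / 2 ^ N \<le> prob {\<omega>\<in>space M. D k \<omega> = V}" by auto
  have "V \<noteq> {}"
  proof
    assume "V = {}"
    then have "{\<omega>\<in>space M. D k \<omega> = V} = {}" using measurable_space[OF D_M[of k]] by auto
    then have "prob {\<omega>\<in>space M. D k \<omega> = V} = 0" by (simp only: measure_empty)
    moreover have "(0 :: real) < 1 / 2 ^ N" by simp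
    ultimately show False using V(2) by linarith
  qed
  then have "0 < card V" using V finite_subset by (auto simp: card_gt_0_iff)
  moreover have "card V \<le> N" using card_mono[OF _ V(1)] by simp
  moreover have "1 / 2 ^ N \<le> prob {\<omega>\<in>space M. D k \<omega> = W}" if "W \<subseteq> {1..N}" "card W = card V" for W
  proof -
    have "space M \<in> sets (mid k)" using sets.top[of "mid k"] by simp
    then have "prob {\<omega>\<in>space M. D k \<omega> = W} = prob {\<omega>\<in>space M. D k \<omega> = V}"
      using D[of k] that V(1) unfolding uniform_sample_def by blast
    then show ?thesis using V(2) by simp
  qed
  ultimately show ?thesis by blast
qed

text \<open>For likely sets \<open>V\<close>, the probability that \<open>V\<close> would reject
  early is at most \<open>2 ^ N\<close> times that of an early rejection, which is summable. On
  paths that never switch all rejections are early, so eventually every sample of the likely size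
  would accept and the actual trial point is accepted too.\<close>

lemma eventually_descent:
  "AE \<omega> in M. (\<forall>k. Kf k \<omega> \<le> Kmax) \<longrightarrow> (\<exists>K. \<forall>k\<ge>K.
     f (x (Suc k) \<omega>) \<le> f (x k \<omega>) - cmin * (norm (Df (x k \<omega>)))\<^sup>2 + Cmax * \<zeta> k)"
proof -
  obtain m where m: "\<And>k. 0 < m k" "\<And>k. m k \<le> N"
    "\<And>k V. V \<subseteq> {1..N} \<Longrightarrow> card V = m k \<Longrightarrow> 1 / 2 ^ N \<le> prob {\<omega>\<in>space M. D k \<omega> = V}"
    using likely_sample_size by metis
  \<comment> \<open>Empty for sets of the wrong size, so that a single application of Borel-Cantelli
    to each of the finitely many \<open>V\<close> suffices although \<open>m k\<close> varies with
    \<open>k\<close>.\<close>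
  define R where "R V k = (if card V = m k then {\<omega>\<in>space M. rejections k \<omega> \<le> Kmax \<and> rejects k V \<omega>} else {})" for V k
  have "AE \<omega> in M. eventually (\<lambda>k. \<omega> \<in> space M - R V k) sequentially" if V: "V \<in> Pow {1..N}" for V
  proof (rule borel_cantelli_AE1)
    show R: "R V k \<in> sets M" for k
      using rejects_fixed_measurable[of V k] subalgebra_mid[of k] V by (auto simp: R_def subalgebra_def)
    show "emeasure M (R V k) < \<infinity>" for k by (simp add: less_top[symmetric])
    show "summable (\<lambda>k. prob (R V k))"
    proof (rule summable_comparison_test'[OF summable_mult[OF summable_early_rejections, of "2 ^ N"]])
      fix k
      let ?E = "prob {\<omega>\<in>space M. rejections k \<omega> \<le> Kmax \<and> rejects k (D k \<omega>) \<omega>}"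
      show "norm (prob (R V k)) \<le> 2 ^ N * ?E"
      proof (cases "card V = m k")
        case True
        have "1 / 2 ^ N * prob (R V k) \<le> prob {\<omega>\<in>space M. D k \<omega> = V} * prob (R V k)"
          using m(3)[of V k] V True by (intro mult_right_mono) auto
        also have "\<dots> \<le> ?E" using prob_rejects_le[of V k] V True by (simp add: R_def)
        finally show ?thesis by (simp add: field_simps)
      qed (simp add: R_def)
    qed
  qed
  then have "AE \<omega> in M. \<forall>V\<in>Pow {1..N}. eventually (\<lambda>k. \<omega> \<in> space M - R V k) sequentially"
    by (intro AE_finite_allI) auto
  then show ?thesis using AE_space
  proof eventually_elim
    case (elim \<omega>)
    show ?case
    proof
      assume Kf: "\<forall>k. Kf k \<omega> \<le> Kmax"
      have ind: "ind k \<omega> = 0" and le: "rejections k \<omega> \<le> Kmax" for k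
        using ind_rejections[OF elim(2), of k] Kf[rule_format, of k] by (auto split: if_splits)
      have "eventually (\<lambda>k. \<not> rejects k (D k \<omega>) \<omega>) sequentially"
      proof -
        have "summable (\<lambda>k. if rejects k (D k \<omega>) \<omega> then 1 else 0 :: real)"
        proof (rule summableI_nonneg_bounded)
          fix n
          have "(\<Sum>k<n. if rejects k (D k \<omega>) \<omega> then 1 else 0 :: real) = real (rejections n \<omega>)"
            unfolding rejections_def of_nat_sum by (intro sum.cong) auto
          then show "(\<Sum>k<n. if rejects k (D k \<omega>) \<omega> then 1 else 0 :: real) \<le> real Kmax" using le[of n] by simp
        qed auto
        then have "(\<lambda>k. if rejects k (D k \<omega>) \<omega> then 1 else 0 :: real) \<longlonglongrightarrow> 0" by (rule summable_LIMSEQ_zero)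
        from order_tendstoD(2)[OF this, of 1] show ?thesis by (auto elim!: eventually_mono split: if_splits)
      qed
      moreover have "eventually (\<lambda>k. \<forall>V\<in>Pow {1..N}. \<omega> \<in> space M - R V k) sequentially"
        using elim(1) by (intro eventually_ball_finite) auto
      ultimately have "eventually (\<lambda>k. f (x (Suc k) \<omega>) \<le>
          f (x k \<omega>) - cmin * (norm (Df (x k \<omega>)))\<^sup>2 + Cmax * \<zeta> k) sequentially"
      proof eventually_elim
        case (elim k)
        have "f (trial k \<omega>) \<le> f (x k \<omega>) - cmin * (norm (Df (x k \<omega>)))\<^sup>2 + Cmax * \<zeta> k"
        proof (rule acceptance_average[OF m(1) m(2)])
          show "0 \<le> cmin" using cmin by simp
          fix V assume "V \<subseteq> {1..N}" "card V = m k"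
          then have "\<omega> \<in> space M - R V k" using elim(2) by blast
          then have "\<not> rejects k V \<omega>" using le[of k] \<open>card V = m k\<close> by (simp add: R_def)
          then show "acceptance_condition \<phi> V cmin Cmax (\<zeta> k) (x k \<omega>) (trial k \<omega>)" by (simp add: rejects_def)
        qed
        moreover have "x (Suc k) \<omega> = trial k \<omega>"
          using iterate_accepted[OF _ ind] elim(1) \<open>\<omega> \<in> space M\<close> by blast
        ultimately show ?case by simp
      qed
      then show "\<exists>K. \<forall>k\<ge>K. f (x (Suc k) \<omega>) \<le> f (x k \<omega>) - cmin * (norm (Df (x k \<omega>)))\<^sup>2 + Cmax * \<zeta> k"
        by (simp add: eventually_sequentially)
    qed
  qed
qed

lemma gradient_tendsto_0:
  "AE \<omega> in M. (\<forall>k. Kf k \<omega> \<le> Kmax) \<longrightarrow> (\<lambda>k. norm (Df (x k \<omega>))) \<longlonglongrightarrow> 0"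
  using eventually_descent
proof eventually_elim
  case (elim \<omega>)
  show ?case
  proof
    assume "\<forall>k. Kf k \<omega> \<le> Kmax"
    with elim obtain K where K: "\<And>k. K \<le> k \<Longrightarrow>
      f (x (Suc k) \<omega>) \<le> f (x k \<omega>) - cmin * (norm (Df (x k \<omega>)))\<^sup>2 + Cmax * \<zeta> k" by blast
    have "(\<lambda>k. (norm (Df (x k \<omega>)))\<^sup>2) \<longlonglongrightarrow> 0"
      by (rule tendsto_0_of_descent[where v = "\<lambda>k. f (x k \<omega>)", OF K low])
        (use cmin Cmax sum_\<zeta> \<zeta> in \<open>auto simp: less_imp_le\<close>)
    from tendsto_real_sqrt[OF this] show "(\<lambda>k. norm (Df (x k \<omega>))) \<longlonglongrightarrow> 0" by simp
  qed
qed

lemma limit_point_stationary: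
  assumes "(\<lambda>k. norm (Df (x k \<omega>))) \<longlonglongrightarrow> 0" "strict_mono r" "(\<lambda>k. x (r k) \<omega>) \<longlonglongrightarrow> z"
  shows "Df z = 0"
proof -
  have "isCont Df z" using continuous_Df by (simp add: continuous_on_eq_continuous_at)
  then have "(\<lambda>k. norm (Df (x (r k) \<omega>))) \<longlonglongrightarrow> norm (Df z)"
    by (intro tendsto_norm isCont_tendsto_compose[OF _ assms(3)])
  moreover have "(\<lambda>k. norm (Df (x (r k) \<omega>))) \<longlonglongrightarrow> 0"
    using LIMSEQ_subseq_LIMSEQ[OF assms(1,2)] by (simp add: o_def)
  ultimately show ?thesis using LIMSEQ_unique by force
qed


section \<open>Gradient noise given the iterates\<close>

abbreviation "past \<equiv> iterate_algebra M x"

lemma past_events_subset: "(\<Union>j\<le>k. preimages M (x j) borel) \<subseteq> sets M"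
  using preimages_subset[OF x] by blast

lemma space_past [simp]: "space (past k) = space M"
  using past_events_subset[of k] sets.space_closed[of M]
  unfolding iterate_algebra_def by (intro space_measure_of) blast

lemma sets_past: "sets (past k) = sigma_sets (space M) (\<Union>j\<le>k. preimages M (x j) borel)"
  using past_events_subset[of k] sets.space_closed[of M]
  unfolding iterate_algebra_def by (intro sets_measure_of) blast

lemma subalgebra_past: "subalgebra M (past k)"
  unfolding subalgebra_def sets_past
  by (auto intro: sets.sigma_sets_subset[OF past_events_subset, THEN subsetD])

lemma sets_past_mono: "j \<le> k \<Longrightarrow> sets (past j) \<subseteq> sets (past k)"
  unfolding sets_past by (intro sigma_sets_mono' UN_mono) auto

lemma x_past [measurable]: "x k \<in> borel_measurable (past k)"
proof (rule measurableI)
  fix A :: "(real ^ 'n) set" assume "A \<in> sets borel"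
  then have "x k -` A \<inter> space M \<in> (\<Union>j\<le>k. preimages M (x j) borel)" by (auto simp: preimages_def)
  then show "x k -` A \<inter> space (past k) \<in> sets (past k)" by (simp add: sets_past sigma_sets.Basic)
qed simp

definition gap :: "nat \<Rightarrow> 'w \<Rightarrow> real" where "gap k \<omega> = f (x k \<omega>) - phi_low"
definition slope :: "nat \<Rightarrow> 'w \<Rightarrow> real" where "slope k \<omega> = norm (Df (x k \<omega>))"
definition noise :: "nat \<Rightarrow> 'w \<Rightarrow> real ^ 'n" where "noise k \<omega> = g k \<omega> - Df (x k \<omega>)"
text \<open>By \<open>ind_rejections\<close> this is the event that \<open>ind k\<close> is nonzero,
  written through the measurable counter.\<close>

definition switched :: "nat \<Rightarrow> 'w set" where "switched k = {\<omega>\<in>space M. Kmax < rejections k \<omega>}"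

lemma noise_M [measurable]: "noise k \<in> borel_measurable M"
  unfolding noise_def by measurable

sublocale drift: switched_drift M past gap slope switched \<alpha> "2 * L"
proof
  show "switched k \<subseteq> switched (Suc k)" for k by (auto simp: switched_def rejections_def)
  show "(slope k \<omega>)\<^sup>2 \<le> 2 * L * gap k \<omega>" for k \<omega>
    unfolding slope_def gap_def by (rule norm_gradient_le[OF GDERIV_f lipschitz_Df L low])
  show "slope k \<in> borel_measurable (past k)" for k unfolding slope_def by measurable
  show "gap k \<in> borel_measurable (past k)" for k unfolding gap_def by measurable
  show "switched k \<in> sets M" for k unfolding switched_def by measurable
qed (use subalgebra_past sets_past_mono low L \<alpha> \<alpha>_div in \<open>auto simp: gap_def slope_def\<close>)

text \<open>The conditional variance bound is integrated against \<open>w\<close> as a nonnegative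
  integral; integrability of the squared noise is then a consequence of the bound.\<close>

lemma weighted_variance:
  assumes w: "w \<in> borel_measurable (past k)" and w0: "\<And>\<omega>. 0 \<le> w \<omega>" and wc: "\<And>\<omega>. w \<omega> \<le> c"
  shows "integrable M (\<lambda>\<omega>. w \<omega> * (norm (noise k \<omega>))\<^sup>2)"
    and "(\<integral>\<omega>. w \<omega> * (norm (noise k \<omega>))\<^sup>2 \<partial>M) \<le> c1 * (\<integral>\<omega>. w \<omega> \<partial>M)"
proof -
  interpret P: finite_measure_subalgebra M "past k" using subalgebra_past by unfold_locales
  note [measurable] = w measurable_from_subalg[OF subalgebra_past w]
  have iw: "integrable M w" using w0 wc by (intro integrable_const_bound[where B = c]) auto
  let ?E = "\<lambda>\<omega>. ennreal ((norm (gradient f (x k \<omega>) - g k \<omega>))\<^sup>2)"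
  have E: "?E \<omega> = ennreal ((norm (noise k \<omega>))\<^sup>2)" for \<omega>
    by (simp only: gradient_f noise_def norm_minus_commute)
  have E_meas: "?E \<in> borel_measurable M" unfolding gradient_f by measurable
  have "(\<integral>\<^sup>+\<omega>. ennreal (w \<omega> * (norm (noise k \<omega>))\<^sup>2) \<partial>M) = (\<integral>\<^sup>+\<omega>. ennreal (w \<omega>) * ?E \<omega> \<partial>M)"
    unfolding E using w0 by (intro nn_integral_cong) (simp add: ennreal_mult)
  also have "\<dots> = (\<integral>\<^sup>+\<omega>. ennreal (w \<omega>) * nn_cond_exp M (past k) ?E \<omega> \<partial>M)"
    by (rule P.nn_cond_exp_intg[symmetric, OF _ E_meas]) measurable
  also have "\<dots> \<le> (\<integral>\<^sup>+\<omega>. ennreal (c1 * w \<omega>) \<partial>M)"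
  proof (rule nn_integral_mono_AE)
    show "AE \<omega> in M. ennreal (w \<omega>) * nn_cond_exp M (past k) ?E \<omega> \<le> ennreal (c1 * w \<omega>)"
      using var[of k]
    proof eventually_elim
      case (elim \<omega>)
      have "ennreal (w \<omega>) * nn_cond_exp M (past k) ?E \<omega> \<le> ennreal (w \<omega>) * ennreal c1"
        by (intro mult_left_mono elim) simp
      then show ?case using w0 c1 by (simp add: ennreal_mult mult.commute)
    qed
  qed
  also have "\<dots> = ennreal (c1 * (\<integral>\<omega>. w \<omega> \<partial>M))"
    using iw w0 c1 by (subst nn_integral_eq_integral) (auto simp: less_imp_le)
  finally have le: "(\<integral>\<^sup>+\<omega>. ennreal (w \<omega> * (norm (noise k \<omega>))\<^sup>2) \<partial>M) \<le> ennreal (c1 * (\<integral>\<omega>. w \<omega> \<partial>M))" .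
  show int: "integrable M (\<lambda>\<omega>. w \<omega> * (norm (noise k \<omega>))\<^sup>2)"
  proof (rule integrableI_nonneg)
    show "(\<integral>\<^sup>+\<omega>. ennreal (w \<omega> * (norm (noise k \<omega>))\<^sup>2) \<partial>M) < \<infinity>"
      using le_less_trans[OF le ennreal_less_top] by simp
  qed (use w0 in auto)
  have "0 \<le> c1 * (\<integral>\<omega>. w \<omega> \<partial>M)" using w0 c1 by (simp add: less_imp_le)
  then show "(\<integral>\<omega>. w \<omega> * (norm (noise k \<omega>))\<^sup>2 \<partial>M) \<le> c1 * (\<integral>\<omega>. w \<omega> \<partial>M)"
    using le w0 by (subst (asm) nn_integral_eq_integral[OF int]) auto
qed

lemma integrable_noise: "integrable M (\<lambda>\<omega>. norm (noise k \<omega>))"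
proof (rule Bochner_Integration.integrable_bound)
  show "integrable M (\<lambda>\<omega>. 1 + 1 * (norm (noise k \<omega>))\<^sup>2)"
    by (intro Bochner_Integration.integrable_add weighted_variance(1)[where c = 1]) auto
  have "r \<le> 1 + r\<^sup>2" for r :: real
    using sum_squares_bound[of 1 r] by (cases "0 \<le> r") (simp_all add: order_trans[of r 0])
  then show "AE \<omega> in M. norm (norm (noise k \<omega>)) \<le> norm (1 + 1 * (norm (noise k \<omega>))\<^sup>2)"
    by (intro AE_I2) (simp add: abs_of_nonneg add_nonneg_nonneg)
qed auto

lemma matrix_inv_entry_bound:
  "AE \<omega> in M. \<forall>i j. cramer_entry i j (B k \<omega>) = matrix_inv (B k \<omega>) $ i $ j \<and> \<bar>cramer_entry i j (B k \<omega>)\<bar> \<le> 1 / \<mu>"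
  using spd
proof eventually_elim
  case (elim \<omega>)
  have Bk: "transpose (B k \<omega>) = B k \<omega>" "loewner_le (mat \<mu>) (B k \<omega>)" "loewner_le (B k \<omega>) (mat L)"
    using elim by blast+
  show ?case
  proof (intro allI)
    fix i j
    have eq: "cramer_entry i j (B k \<omega>) = matrix_inv (B k \<omega>) $ i $ j"
      by (rule cramer_entry_eq_matrix_inv[OF invertible_loewner[OF Bk \<mu> L]])
    have "\<bar>(matrix_inv (B k \<omega>) *v axis j 1) $ i\<bar> \<le> norm (matrix_inv (B k \<omega>) *v axis j 1)"
      by (rule component_le_norm_cart)
    also have "\<dots> \<le> norm (axis j 1 :: real ^ 'n) / \<mu>" by (rule norm_matrix_inv_le[OF Bk \<mu> L])
    finally show "cramer_entry i j (B k \<omega>) = matrix_inv (B k \<omega>) $ i $ j \<and> \<bar>cramer_entry i j (B k \<omega>)\<bar> \<le> 1 / \<mu>"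
      by (simp add: eq matrix_vector_mul_component inner_axis)
  qed
qed

text \<open>The two bounds on \<open>w\<close> serve different integrals: \<open>wb\<close> controls
  \<open>w\<close> times the noise, \<open>wD\<close> controls \<open>w\<close> times the true
  gradient, which is not known to be integrable on its own. Together they make \<open>w\<close>
  times the stochastic gradient integrable, as \<open>cond_indep_orthogonal\<close> demands.\<close>

lemma noise_orthogonal:
  assumes w: "w \<in> borel_measurable (past k)" and wb: "\<And>\<omega>. \<bar>w \<omega>\<bar> \<le> b"
    and wD: "\<And>\<omega>. \<bar>w \<omega>\<bar> * slope k \<omega> \<le> b"
  shows "integrable M (\<lambda>\<omega>. w \<omega> * noise k \<omega> $ j * cramer_entry i j (B k \<omega>))"
    and "(\<integral>\<omega>. w \<omega> * noise k \<omega> $ j * cramer_entry i j (B k \<omega>) \<partial>M) = 0"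
proof -
  note [measurable] = measurable_from_subalg[OF subalgebra_past w]
  have nth[measurable]: "(\<lambda>v :: real ^ 'n. v $ j) \<in> borel_measurable borel"
    by (intro borel_measurable_continuous_onI continuous_intros)
  have b: "0 \<le> b" using wb[of undefined] by simp
  have wn: "\<bar>w \<omega> * noise k \<omega> $ j\<bar> \<le> b * norm (noise k \<omega>)" for \<omega>
    unfolding abs_mult by (intro mult_mono wb component_le_norm_cart b) auto
  show int: "integrable M (\<lambda>\<omega>. w \<omega> * noise k \<omega> $ j * cramer_entry i j (B k \<omega>))"
  proof (rule Bochner_Integration.integrable_bound)
    show "integrable M (\<lambda>\<omega>. b * norm (noise k \<omega>) * (1 / \<mu>))"
      using integrable_noise[of k] by (intro integrable_mult_left integrable_mult_right)
    show "AE \<omega> in M. norm (w \<omega> * noise k \<omega> $ j * cramer_entry i j (B k \<omega>)) \<le> norm (b * norm (noise k \<omega>) * (1 / \<mu>))"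
      using matrix_inv_entry_bound[of k]
    proof eventually_elim
      case (elim \<omega>)
      have "\<bar>w \<omega> * noise k \<omega> $ j\<bar> * \<bar>cramer_entry i j (B k \<omega>)\<bar> \<le> b * norm (noise k \<omega>) * (1 / \<mu>)"
        using elim b by (intro mult_mono wn) (blast, simp_all)
      then show ?case using b \<mu> by (simp add: abs_mult)
    qed
  qed measurable
  have "integrable M (\<lambda>\<omega>. w \<omega> * noise k \<omega> $ j)"
  proof (rule Bochner_Integration.integrable_bound)
    show "integrable M (\<lambda>\<omega>. b * norm (noise k \<omega>))" using integrable_noise[of k] by simp
    show "AE \<omega> in M. norm (w \<omega> * noise k \<omega> $ j) \<le> norm (b * norm (noise k \<omega>))"
      using wn b by (intro AE_I2) (simp add: abs_of_nonneg)
  qed measurable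
  moreover have "integrable M (\<lambda>\<omega>. w \<omega> * Df (x k \<omega>) $ j)"
  proof (rule integrable_const_bound[where B = b])
    have "\<bar>w \<omega> * Df (x k \<omega>) $ j\<bar> \<le> b" for \<omega>
      using mult_left_mono[OF component_le_norm_cart[of "Df (x k \<omega>)" j], of "\<bar>w \<omega>\<bar>"] wD[of \<omega>]
      by (simp add: abs_mult slope_def)
    then show "AE \<omega> in M. norm (w \<omega> * Df (x k \<omega>) $ j) \<le> b" by simp
  qed measurable
  ultimately have "integrable M (\<lambda>\<omega>. w \<omega> * noise k \<omega> $ j + w \<omega> * Df (x k \<omega>) $ j)"
    by (rule Bochner_Integration.integrable_add)
  then have wg: "integrable M (\<lambda>\<omega>. w \<omega> * g k \<omega> $ j)" by (simp add: noise_def algebra_simps)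
  have "(\<integral>\<omega>. w \<omega> * (g k \<omega> $ j - Df (x k \<omega>) $ j) * cramer_entry i j (B k \<omega>) \<partial>M) = 0"
  proof (rule cond_indep_orthogonal[OF subalgebra_past g B ci w wb nth wg])
    show "(\<lambda>\<omega>. Df (x k \<omega>) $ j) \<in> borel_measurable (past k)" by measurable
    show "AE \<omega> in M. real_cond_exp M (past k) (\<lambda>\<omega>. g k \<omega> $ j) \<omega> = Df (x k \<omega>) $ j"
      using mean[of k] by eventually_elim (simp only: vec_cond_exp_def vec_eq_iff gradient_f vec_lambda_beta)
    show "integrable M (\<lambda>\<omega>. w \<omega> * (g k \<omega> $ j - Df (x k \<omega>) $ j) * cramer_entry i j (B k \<omega>))"
      using int by (simp add: noise_def)
  qed measurable
  then show "(\<integral>\<omega>. w \<omega> * noise k \<omega> $ j * cramer_entry i j (B k \<omega>) \<partial>M) = 0" by (simp add: noise_def)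
qed

section \<open>Descent after the switch\<close>

definition step_const :: real where "step_const = 2 / \<mu> + 4 * L / \<mu>\<^sup>2"

lemma step_const: "0 < step_const"
  using \<mu> L by (auto simp: step_const_def intro!: add_pos_pos)

text \<open>
  The noise has mean zero given the iterates, but not given in addition that the switch has happened.  The
  resulting bias is minus the contribution of the paths that have not switched, hence small when the switch
  is likely given the iterates.
\<close>

lemma drift_bound_switched:
  assumes \<epsilon>: "0 < \<epsilon>" and \<delta>1: "\<delta> k \<le> 1" and small: "step_const * (\<delta> k + \<alpha> k) \<le> 1 / (8 * L)"
  defines "\<tau> \<equiv> \<epsilon> * \<mu> / (4 * L * c1)"
  shows "drift.drift_bound \<epsilon> (1 / (8 * L)) (min (1 / 2) (\<tau>\<^sup>2 * c1))
    (\<lambda>k. step_const * c1 * (\<alpha> k * \<delta> k + (\<alpha> k)\<^sup>2)) k"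
  unfolding drift.drift_bound_def
proof (intro allI impI)
  fix \<sigma> c
  \<comment> \<open>Of the descent coefficient \<open>1 / L\<close>, the bound
    \<open>\<rho> <= 1 / 2\<close> preserves one half on switched paths; the bias takes
    \<open>1 / (4 * L)\<close>, the second-order terms take \<open>1 / (8 * L)\<close>, and
    \<open>1 / (8 * L)\<close> is left. The bound \<open>\<rho> <= \<tau>^2 * c1\<close> makes the
    second Young term no larger than the bound for the first, and \<open>\<tau>\<close> is chosen so
    that both together contribute the factor
    \<open>\<tau> * c1 / \<mu> = \<epsilon> / (4 * L)\<close>.\<close>
  define \<rho> where "\<rho> = min (1 / 2) (\<tau>\<^sup>2 * c1)"
  define a where "a = \<alpha> k"
  define \<theta> where "\<theta> = step_const * (a * \<delta> k + a\<^sup>2)"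
  define J where "J = switched k"
  assume \<sigma>[measurable]: "\<sigma> \<in> borel_measurable (past k)"
    and bd: "\<forall>\<omega>. 0 \<le> \<sigma> \<omega> \<and> \<sigma> \<omega> \<le> c \<and> \<sigma> \<omega> * (slope k \<omega>)\<^sup>2 \<le> c"
    and sup: "\<forall>\<omega>. \<sigma> \<omega> \<noteq> 0 \<longrightarrow> \<epsilon> < slope k \<omega> \<and> 1 - min (1 / 2) (\<tau>\<^sup>2 * c1) \<le> drift.switch_prob k \<omega>"
  have \<tau>: "0 < \<tau>" using \<epsilon> \<mu> L c1 by (simp add: \<tau>_def)
  have \<rho>: "\<rho> \<le> 1 / 2" "\<rho> \<le> \<tau>\<^sup>2 * c1" by (auto simp: \<rho>_def)
  have a: "0 < a" using \<alpha> by (simp add: a_def)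
  have \<theta>: "0 \<le> \<theta>" using step_const a \<delta>[of k] by (simp add: \<theta>_def)
  have \<theta>a: "\<theta> \<le> a * (1 / (8 * L))"
  proof -
    have "\<theta> = a * (step_const * (\<delta> k + \<alpha> k))" by (simp add: \<theta>_def a_def algebra_simps power2_eq_square)
    also have "\<dots> \<le> a * (1 / (8 * L))" using small a by (intro mult_left_mono) auto
    finally show ?thesis .
  qed
  have s0: "0 \<le> \<sigma> \<omega>" and sc: "\<sigma> \<omega> \<le> c" and sG2: "\<sigma> \<omega> * (slope k \<omega>)\<^sup>2 \<le> c" for \<omega> using bd by auto
  have G0: "0 \<le> slope k \<omega>" for \<omega> by (simp add: slope_def)
  have c: "0 \<le> c" using s0 sc order_trans by blast
  have sG: "\<sigma> \<omega> * slope k \<omega> \<le> 2 * c" for \<omega>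
  proof -
    have "slope k \<omega> \<le> 1 + (slope k \<omega>)\<^sup>2"
      using sum_squares_bound[of 1 "slope k \<omega>"] G0[of \<omega>] by simp
    then have "\<sigma> \<omega> * slope k \<omega> \<le> \<sigma> \<omega> * (1 + (slope k \<omega>)\<^sup>2)" using s0 by (rule mult_left_mono)
    then show ?thesis using sc[of \<omega>] sG2[of \<omega>] by (simp add: distrib_left)
  qed
  note [measurable] = measurable_from_subalg[OF subalgebra_past \<sigma>]
  have J[measurable]: "J \<in> sets M" unfolding J_def by measurable
  have intb: "integrable M h" if "h \<in> borel_measurable M" "\<And>\<omega>. 0 \<le> h \<omega>" "\<And>\<omega>. h \<omega> \<le> r" for h :: "'w \<Rightarrow> real" and r
    using that by (intro integrable_const_bound[where B = r]) auto
  have i\<sigma>: "integrable M \<sigma>" by (rule intb) (use s0 sc in auto)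
  have iG: "integrable M (\<lambda>\<omega>. \<sigma> \<omega> * slope k \<omega>)" by (rule intb) (use s0 sG G0 in auto)
  have iG2: "integrable M (\<lambda>\<omega>. \<sigma> \<omega> * (slope k \<omega>)\<^sup>2)" by (rule intb) (use s0 sG2 in auto)
  define e where "e \<omega> = (norm (noise k \<omega>))\<^sup>2" for \<omega>
  have [measurable]: "e \<in> borel_measurable M" unfolding e_def by measurable
  have ie: "integrable M (\<lambda>\<omega>. \<sigma> \<omega> * e \<omega>)" "(\<integral>\<omega>. \<sigma> \<omega> * e \<omega> \<partial>M) \<le> c1 * (\<integral>\<omega>. \<sigma> \<omega> \<partial>M)"
    unfolding e_def using weighted_variance[OF \<sigma> s0 sc] by auto
  have \<sigma>G_past: "(\<lambda>\<omega>. \<sigma> \<omega> * slope k \<omega>) \<in> borel_measurable (past k)"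
    and \<sigma>G2_past: "(\<lambda>\<omega>. \<sigma> \<omega> * (slope k \<omega>)\<^sup>2) \<in> borel_measurable (past k)"
    by measurable
  have \<sigma>G0: "0 \<le> \<sigma> \<omega> * slope k \<omega>" for \<omega> using s0 G0 by simp
  have iGe: "integrable M (\<lambda>\<omega>. \<sigma> \<omega> * slope k \<omega> * e \<omega>)"
    "(\<integral>\<omega>. \<sigma> \<omega> * slope k \<omega> * e \<omega> \<partial>M) \<le> c1 * (\<integral>\<omega>. \<sigma> \<omega> * slope k \<omega> \<partial>M)"
    unfolding e_def using weighted_variance[OF \<sigma>G_past \<sigma>G0 sG] by auto
  \<comment> \<open>The weighted linear noise term, written entrywise with
    \<open>cramer_entry\<close> so that \<open>noise_orthogonal\<close> applies. It carries no
    indicator of the switch; this is what makes its mean zero.\<close>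
  define Q where "Q \<omega> = (\<Sum>i\<in>UNIV. \<Sum>j\<in>UNIV. \<sigma> \<omega> * Df (x k \<omega>) $ i * noise k \<omega> $ j * cramer_entry i j (B k \<omega>))" for \<omega>
  have Q: "integrable M Q" "(\<integral>\<omega>. Q \<omega> \<partial>M) = 0"
  proof -
    have wb: "\<bar>\<sigma> \<omega> * Df (x k \<omega>) $ i\<bar> \<le> 2 * c" for \<omega> i
      using mult_left_mono[OF component_le_norm_cart[of "Df (x k \<omega>)" i] s0[of \<omega>]] sG[of \<omega>] s0[of \<omega>]
      by (simp add: abs_mult slope_def)
    have wD: "\<bar>\<sigma> \<omega> * Df (x k \<omega>) $ i\<bar> * slope k \<omega> \<le> 2 * c" for \<omega> i
    proof -
      have "\<bar>\<sigma> \<omega> * Df (x k \<omega>) $ i\<bar> * slope k \<omega> \<le> (\<sigma> \<omega> * slope k \<omega>) * slope k \<omega>"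
        using component_le_norm_cart[of "Df (x k \<omega>)" i] s0[of \<omega>]
        by (intro mult_right_mono G0) (auto simp: abs_mult slope_def intro: mult_left_mono)
      also have "\<dots> \<le> 2 * c" using sG2[of \<omega>] c by (simp add: power2_eq_square mult.assoc)
      finally show ?thesis .
    qed
    have w: "(\<lambda>\<omega>. \<sigma> \<omega> * Df (x k \<omega>) $ i) \<in> borel_measurable (past k)" for i by measurable
    note no = noise_orthogonal[OF w wb wD]
    show "integrable M Q" unfolding Q_def by (intro Bochner_Integration.integrable_sum no(1))
    show "(\<integral>\<omega>. Q \<omega> \<partial>M) = 0"
    proof -
      have "(\<integral>\<omega>. (\<Sum>j\<in>UNIV. \<sigma> \<omega> * Df (x k \<omega>) $ i * noise k \<omega> $ j * cramer_entry i j (B k \<omega>)) \<partial>M) = 0" for i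
        by (subst Bochner_Integration.integral_sum) (simp_all only: no sum.neutral_const)
      then show ?thesis unfolding Q_def
        by (subst Bochner_Integration.integral_sum)
          (simp_all only: sum.neutral_const, intro Bochner_Integration.integrable_sum no(1))
    qed
  qed
  define iJ where "iJ = indicat_real J"
  define iN where "iN \<omega> = 1 - iJ \<omega>" for \<omega>
  have [measurable]: "iJ \<in> borel_measurable M" "iN \<in> borel_measurable M" unfolding iJ_def iN_def by measurable
  have iJ01: "0 \<le> iJ \<omega>" "iJ \<omega> \<le> 1" "0 \<le> iN \<omega>" "iN \<omega> \<le> 1" for \<omega> by (auto simp: iJ_def iN_def indicator_def)
  interpret P: finite_measure_subalgebra M "past k" using subalgebra_past by unfold_locales
  have p_int: "integrable M (\<lambda>\<omega>. h \<omega> * drift.switch_prob k \<omega>)" "integrable M (\<lambda>\<omega>. h \<omega> * iJ \<omega>)"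
      "(\<integral>\<omega>. h \<omega> * drift.switch_prob k \<omega> \<partial>M) = (\<integral>\<omega>. h \<omega> * iJ \<omega> \<partial>M)"
    if h: "h \<in> borel_measurable (past k)" "\<And>\<omega>. 0 \<le> h \<omega>" "\<And>\<omega>. h \<omega> \<le> r" for h r
  proof -
    note [measurable] = measurable_from_subalg[OF subalgebra_past h(1)]
    have "h \<omega> * iJ \<omega> \<le> r" for \<omega>
      using mult_left_le[OF iJ01(2) h(2)] h(3) order_trans by blast
    then show *: "integrable M (\<lambda>\<omega>. h \<omega> * iJ \<omega>)"
      by (intro intb[of _ r]) (use h(2) iJ01 in auto)
    show "integrable M (\<lambda>\<omega>. h \<omega> * drift.switch_prob k \<omega>)"
      "(\<integral>\<omega>. h \<omega> * drift.switch_prob k \<omega> \<partial>M) = (\<integral>\<omega>. h \<omega> * iJ \<omega> \<partial>M)"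
      unfolding drift.switch_prob_def J_def[symmetric] iJ_def[symmetric]
      using * h(1) by (auto intro!: P.real_cond_exp_intg)
  qed
  note pG = p_int[OF \<sigma>G_past \<sigma>G0 sG]
  note pG2 = p_int[OF \<sigma>G2_past _ sG2]
  have JG2: "integrable M (\<lambda>\<omega>. \<sigma> \<omega> * (slope k \<omega>)\<^sup>2 * iJ \<omega>)"
    "(1 / 2) * (\<integral>\<omega>. \<sigma> \<omega> * (slope k \<omega>)\<^sup>2 \<partial>M) \<le> (\<integral>\<omega>. \<sigma> \<omega> * (slope k \<omega>)\<^sup>2 * iJ \<omega> \<partial>M)"
  proof -
    show "integrable M (\<lambda>\<omega>. \<sigma> \<omega> * (slope k \<omega>)\<^sup>2 * iJ \<omega>)" by (rule pG2(2)) (use s0 in simp)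
    have "(\<integral>\<omega>. (1 / 2) * (\<sigma> \<omega> * (slope k \<omega>)\<^sup>2) \<partial>M) \<le> (\<integral>\<omega>. \<sigma> \<omega> * (slope k \<omega>)\<^sup>2 * drift.switch_prob k \<omega> \<partial>M)"
    proof (rule integral_mono)
      show "integrable M (\<lambda>\<omega>. \<sigma> \<omega> * (slope k \<omega>)\<^sup>2 * drift.switch_prob k \<omega>)" by (rule pG2(1)) (use s0 in simp)
      fix \<omega>
      show "(1 / 2) * (\<sigma> \<omega> * (slope k \<omega>)\<^sup>2) \<le> \<sigma> \<omega> * (slope k \<omega>)\<^sup>2 * drift.switch_prob k \<omega>"
      proof (cases "\<sigma> \<omega> = 0")
        case False
        then have "1 / 2 \<le> drift.switch_prob k \<omega>" using sup[rule_format, of \<omega>] \<rho>(1) unfolding \<rho>_def by linarith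
        then show ?thesis using mult_left_mono[of "1 / 2" "drift.switch_prob k \<omega>" "\<sigma> \<omega> * (slope k \<omega>)\<^sup>2"] s0[of \<omega>]
          by (simp add: mult.commute)
      qed simp
    qed (use iG2 in simp)
    then show "(1 / 2) * (\<integral>\<omega>. \<sigma> \<omega> * (slope k \<omega>)\<^sup>2 \<partial>M) \<le> (\<integral>\<omega>. \<sigma> \<omega> * (slope k \<omega>)\<^sup>2 * iJ \<omega> \<partial>M)"
      using pG2(3) s0 by simp
  qed
  have NG: "integrable M (\<lambda>\<omega>. \<sigma> \<omega> * slope k \<omega> * iN \<omega>)"
    "(\<integral>\<omega>. \<sigma> \<omega> * slope k \<omega> * iN \<omega> \<partial>M) \<le> \<rho> * (\<integral>\<omega>. \<sigma> \<omega> * slope k \<omega> \<partial>M)"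
  proof -
    have eq: "\<sigma> \<omega> * slope k \<omega> * iN \<omega> = \<sigma> \<omega> * slope k \<omega> - \<sigma> \<omega> * slope k \<omega> * iJ \<omega>" for \<omega>
      by (simp add: iN_def algebra_simps)
    show "integrable M (\<lambda>\<omega>. \<sigma> \<omega> * slope k \<omega> * iN \<omega>)"
      unfolding eq by (intro Bochner_Integration.integrable_diff iG pG(2))
    have "(\<integral>\<omega>. \<sigma> \<omega> * slope k \<omega> * iN \<omega> \<partial>M) =
        (\<integral>\<omega>. \<sigma> \<omega> * slope k \<omega> \<partial>M) - (\<integral>\<omega>. \<sigma> \<omega> * slope k \<omega> * drift.switch_prob k \<omega> \<partial>M)"
      unfolding eq pG(3) by (intro Bochner_Integration.integral_diff iG pG(2))
    also have "\<dots> = (\<integral>\<omega>. \<sigma> \<omega> * slope k \<omega> - \<sigma> \<omega> * slope k \<omega> * drift.switch_prob k \<omega> \<partial>M)"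
      by (intro Bochner_Integration.integral_diff[symmetric] iG pG(1))
    also have "\<dots> \<le> (\<integral>\<omega>. \<rho> * (\<sigma> \<omega> * slope k \<omega>) \<partial>M)"
    proof (rule integral_mono)
      fix \<omega>
      show "\<sigma> \<omega> * slope k \<omega> - \<sigma> \<omega> * slope k \<omega> * drift.switch_prob k \<omega> \<le> \<rho> * (\<sigma> \<omega> * slope k \<omega>)"
      proof (cases "\<sigma> \<omega> = 0")
        case False
        then have "1 - drift.switch_prob k \<omega> \<le> \<rho>" using sup[rule_format, of \<omega>] unfolding \<rho>_def by linarith
        then have "(1 - drift.switch_prob k \<omega>) * (\<sigma> \<omega> * slope k \<omega>) \<le> \<rho> * (\<sigma> \<omega> * slope k \<omega>)"
          by (rule mult_right_mono[OF _ \<sigma>G0])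
        then show ?thesis by (simp add: algebra_simps)
      qed simp
    qed (use iG pG(1) in auto)
    finally show "(\<integral>\<omega>. \<sigma> \<omega> * slope k \<omega> * iN \<omega> \<partial>M) \<le> \<rho> * (\<integral>\<omega>. \<sigma> \<omega> * slope k \<omega> \<partial>M)" by simp
  qed
  have G\<epsilon>: "\<epsilon> * (\<integral>\<omega>. \<sigma> \<omega> * slope k \<omega> \<partial>M) \<le> (\<integral>\<omega>. \<sigma> \<omega> * (slope k \<omega>)\<^sup>2 \<partial>M)"
  proof -
    have "(\<integral>\<omega>. \<epsilon> * (\<sigma> \<omega> * slope k \<omega>) \<partial>M) \<le> (\<integral>\<omega>. \<sigma> \<omega> * (slope k \<omega>)\<^sup>2 \<partial>M)"
    proof (rule integral_mono)
      fix \<omega>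
      show "\<epsilon> * (\<sigma> \<omega> * slope k \<omega>) \<le> \<sigma> \<omega> * (slope k \<omega>)\<^sup>2"
      proof (cases "\<sigma> \<omega> = 0")
        case False
        then have "\<epsilon> \<le> slope k \<omega>" using sup by (simp add: less_imp_le)
        then have "\<epsilon> * (\<sigma> \<omega> * slope k \<omega>) \<le> slope k \<omega> * (\<sigma> \<omega> * slope k \<omega>)"
          by (rule mult_right_mono[OF _ \<sigma>G0])
        then show ?thesis by (simp add: power2_eq_square mult_ac)
      qed simp
    qed (use iG iG2 in auto)
    then show ?thesis by simp
  qed
  \<comment> \<open>On \<open>J\<close> this dominates the increment by the inexact Newton step. Off
    \<open>J\<close> the increment is masked, but \<open>- a * Q\<close> may be negative there, and
    the two Young terms make up for it. The term with the squared noise carries no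
    \<open>iN\<close>, because the second moment is controlled only given the iterates; the constant
    term does carry \<open>iN\<close>, and its integral is small by \<open>NG\<close>.\<close>
  define U where "U \<omega> = - (a / L) * (\<sigma> \<omega> * (slope k \<omega>)\<^sup>2 * iJ \<omega>) - a * Q \<omega> +
      a / \<mu> * (\<tau> / 2) * (\<sigma> \<omega> * slope k \<omega> * e \<omega>) + a / \<mu> * (1 / (2 * \<tau>)) * (\<sigma> \<omega> * slope k \<omega> * iN \<omega>) +
      \<theta> * (\<sigma> \<omega> * (slope k \<omega>)\<^sup>2) + \<theta> * (\<sigma> \<omega> * e \<omega>)" for \<omega>
  note ints = JG2(1) Q(1) iGe(1) NG(1) iG2 ie(1)
  have "AE \<omega> in M. indicator J \<omega> * (\<sigma> \<omega> * (gap (Suc k) \<omega> - gap k \<omega>)) \<le> U \<omega>"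
    using spd matrix_inv_entry_bound[of k] AE_space
  proof eventually_elim
    case (elim \<omega>)
    have Bk: "transpose (B k \<omega>) = B k \<omega>" "loewner_le (mat \<mu>) (B k \<omega>)" "loewner_le (B k \<omega>) (mat L)"
      using elim(1) by blast+
    define q where "q = inner (Df (x k \<omega>)) (matrix_inv (B k \<omega>) *v noise k \<omega>)"
    have Q_eq: "Q \<omega> = \<sigma> \<omega> * q"
    proof -
      have "Q \<omega> = (\<Sum>i\<in>UNIV. \<Sum>j\<in>UNIV. \<sigma> \<omega> * (Df (x k \<omega>) $ i * (matrix_inv (B k \<omega>) $ i $ j * noise k \<omega> $ j)))"
        unfolding Q_def using elim(2) by (intro sum.cong refl) (simp add: mult_ac)
      also have "\<dots> = \<sigma> \<omega> * (\<Sum>i\<in>UNIV. Df (x k \<omega>) $ i * (\<Sum>j\<in>UNIV. matrix_inv (B k \<omega>) $ i $ j * noise k \<omega> $ j))"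
        by (simp add: sum_distrib_left)
      also have "\<dots> = \<sigma> \<omega> * q" by (simp add: q_def inner_vec_def matrix_vector_mult_def)
      finally show ?thesis .
    qed
    have young: "norm (noise k \<omega>) \<le> \<tau> / 2 * e \<omega> + 1 / (2 * \<tau>)"
    proof -
      have "2 * (\<tau> * norm (noise k \<omega>)) \<le> (\<tau> * norm (noise k \<omega>))\<^sup>2 + 1"
        using sum_squares_bound[of "\<tau> * norm (noise k \<omega>)" 1] by simp
      then show ?thesis using \<tau> by (simp add: e_def field_simps power2_eq_square)
    qed
    show ?case
    proof (cases "\<omega> \<in> J")
      case True
      then have sw: "Kmax < rejections k \<omega>" by (simp add: J_def switched_def)
      then have ind: "ind k \<omega> \<noteq> 0" using ind_rejections[OF elim(3), of k] by (auto split: if_splits)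
      have step: "x (Suc k) \<omega> = x k \<omega> + a *\<^sub>R d k \<omega>" and res: "norm (B k \<omega> *v d k \<omega> + g k \<omega>) \<le> \<delta> k * norm (g k \<omega>)"
        using iter[OF elim(3), of k] ind by (auto simp: LSOS_iteration_def a_def)
      have "gap (Suc k) \<omega> - gap k \<omega> \<le> - a / L * (slope k \<omega>)\<^sup>2 - a * q + \<theta> * ((slope k \<omega>)\<^sup>2 + e \<omega>)"
        using inexact_newton_step[OF GDERIV_f lipschitz_Df Bk \<mu> L res \<delta> \<delta>1 a, of "x k \<omega>"]
        unfolding gap_def step slope_def q_def e_def noise_def \<theta>_def step_const_def by simp
      then have "\<sigma> \<omega> * (gap (Suc k) \<omega> - gap k \<omega>) \<le>
          \<sigma> \<omega> * (- a / L * (slope k \<omega>)\<^sup>2 - a * q + \<theta> * ((slope k \<omega>)\<^sup>2 + e \<omega>))"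
        by (rule mult_left_mono[OF _ s0])
      also have "\<dots> = - (a / L) * (\<sigma> \<omega> * (slope k \<omega>)\<^sup>2 * iJ \<omega>) - a * Q \<omega> +
          \<theta> * (\<sigma> \<omega> * (slope k \<omega>)\<^sup>2) + \<theta> * (\<sigma> \<omega> * e \<omega>)"
        using True by (simp add: Q_eq iJ_def algebra_simps)
      also have "\<dots> \<le> U \<omega>"
      proof -
        have "0 \<le> a / \<mu> * (\<tau> / 2) * (\<sigma> \<omega> * slope k \<omega> * e \<omega>)"
          using a \<mu> \<tau> \<sigma>G0[of \<omega>] by (intro mult_nonneg_nonneg[OF _ mult_nonneg_nonneg]) (auto simp: e_def)
        moreover have "0 \<le> a / \<mu> * (1 / (2 * \<tau>)) * (\<sigma> \<omega> * slope k \<omega> * iN \<omega>)"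
          using a \<mu> \<tau> \<sigma>G0[of \<omega>] iJ01 by (intro mult_nonneg_nonneg[OF _ mult_nonneg_nonneg]) auto
        ultimately show ?thesis unfolding U_def by linarith
      qed
      finally show ?thesis using True by simp
    next
      case False
      \<comment> \<open>Off \<open>J\<close> it remains to show that \<open>U\<close> is
        nonnegative: the stray noise term is bounded by Cauchy-Schwarz and \<open>young\<close>,
        with \<open>iN = 1\<close>.\<close>
      have "\<bar>q\<bar> \<le> slope k \<omega> * (norm (noise k \<omega>) / \<mu>)"
        unfolding q_def slope_def
        by (rule order_trans[OF Cauchy_Schwarz_ineq2]) (intro mult_left_mono norm_matrix_inv_le[OF Bk \<mu> L] norm_ge_zero)
      also have "\<dots> \<le> slope k \<omega> * ((\<tau> / 2 * e \<omega> + 1 / (2 * \<tau>)) / \<mu>)"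
        using young \<mu> by (intro mult_left_mono divide_right_mono G0) auto
      finally have "a * (\<sigma> \<omega> * q) \<le> a * (\<sigma> \<omega> * (slope k \<omega> * ((\<tau> / 2 * e \<omega> + 1 / (2 * \<tau>)) / \<mu>)))"
        using a s0 by (intro mult_left_mono) auto
      also have "\<dots> = a / \<mu> * (\<tau> / 2) * (\<sigma> \<omega> * slope k \<omega> * e \<omega>) + a / \<mu> * (1 / (2 * \<tau>)) * (\<sigma> \<omega> * slope k \<omega> * iN \<omega>)"
        using False \<mu> \<tau> by (simp add: iN_def iJ_def field_simps)
      finally have "0 \<le> - a * Q \<omega> + a / \<mu> * (\<tau> / 2) * (\<sigma> \<omega> * slope k \<omega> * e \<omega>) + a / \<mu> * (1 / (2 * \<tau>)) * (\<sigma> \<omega> * slope k \<omega> * iN \<omega>)"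
        by (simp add: Q_eq)
      moreover have "0 \<le> \<theta> * (\<sigma> \<omega> * (slope k \<omega>)\<^sup>2)" "0 \<le> \<theta> * (\<sigma> \<omega> * e \<omega>)"
        using \<theta> s0 by (auto simp: e_def)
      moreover have "iJ \<omega> = 0" using False by (simp add: iJ_def)
      ultimately show ?thesis using False unfolding U_def by simp
    qed
  qed
  moreover have "integrable M U"
    unfolding U_def by (intro Bochner_Integration.integrable_add Bochner_Integration.integrable_diff integrable_mult_right ints)
  moreover have "(\<integral>\<omega>. U \<omega> \<partial>M) \<le> step_const * c1 * (\<alpha> k * \<delta> k + (\<alpha> k)\<^sup>2) * (\<integral>\<omega>. \<sigma> \<omega> \<partial>M)
      - \<alpha> k * (1 / (8 * L)) * (\<integral>\<omega>. \<sigma> \<omega> * (slope k \<omega>)\<^sup>2 \<partial>M)"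
  proof -
    define I0 where "I0 = (\<integral>\<omega>. \<sigma> \<omega> \<partial>M)"
    define I1 where "I1 = (\<integral>\<omega>. \<sigma> \<omega> * slope k \<omega> \<partial>M)"
    define I2 where "I2 = (\<integral>\<omega>. \<sigma> \<omega> * (slope k \<omega>)\<^sup>2 \<partial>M)"
    have I: "0 \<le> I0" "0 \<le> I1" "0 \<le> I2" unfolding I0_def I1_def I2_def using s0 \<sigma>G0 by simp_all
    have "(\<integral>\<omega>. U \<omega> \<partial>M) = - (a / L) * (\<integral>\<omega>. \<sigma> \<omega> * (slope k \<omega>)\<^sup>2 * iJ \<omega> \<partial>M) - a * (\<integral>\<omega>. Q \<omega> \<partial>M) +
      a / \<mu> * (\<tau> / 2) * (\<integral>\<omega>. \<sigma> \<omega> * slope k \<omega> * e \<omega> \<partial>M) + a / \<mu> * (1 / (2 * \<tau>)) * (\<integral>\<omega>. \<sigma> \<omega> * slope k \<omega> * iN \<omega> \<partial>M) +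
      \<theta> * I2 + \<theta> * (\<integral>\<omega>. \<sigma> \<omega> * e \<omega> \<partial>M)"
      unfolding U_def I2_def
      by (simp only: Bochner_Integration.integral_add Bochner_Integration.integral_diff integral_mult_right_zero
          Bochner_Integration.integrable_add Bochner_Integration.integrable_diff integrable_mult_right ints)
    also have "\<dots> \<le> - (a / L) * (1 / 2 * I2) - a * 0 + a / \<mu> * (\<tau> / 2) * (c1 * I1) +
        a / \<mu> * (1 / (2 * \<tau>)) * (\<rho> * I1) + \<theta> * I2 + \<theta> * (c1 * I0)"
      unfolding Q(2) I0_def I1_def I2_def
      using a L \<mu> \<tau> \<theta> by (intro add_mono diff_mono mult_left_mono mult_left_mono_neg JG2(2) iGe(2) NG(2) ie(2) order_refl) auto
    also have "a / \<mu> * (1 / (2 * \<tau>)) * (\<rho> * I1) \<le> a / \<mu> * (\<tau> / 2) * (c1 * I1)"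
    proof -
      have "1 / (2 * \<tau>) * \<rho> \<le> 1 / (2 * \<tau>) * (\<tau>\<^sup>2 * c1)" using \<rho>(2) \<tau> by (intro mult_left_mono) auto
      also have "\<dots> = \<tau> / 2 * c1" using \<tau> by (simp add: power2_eq_square)
      finally have "a / \<mu> * (1 / (2 * \<tau>) * \<rho> * I1) \<le> a / \<mu> * (\<tau> / 2 * c1 * I1)"
        using a \<mu> I by (intro mult_left_mono mult_right_mono) auto
      then show ?thesis by (simp only: mult.assoc)
    qed
    also have "\<theta> * I2 \<le> a * (1 / (8 * L)) * I2" using \<theta>a I by (intro mult_right_mono)
    finally have "(\<integral>\<omega>. U \<omega> \<partial>M) \<le> - (a / L) * (1 / 2 * I2) + a * (\<tau> / \<mu> * c1 * I1) + a * (1 / (8 * L)) * I2 + \<theta> * (c1 * I0)"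
      by (simp add: algebra_simps)
    \<comment> \<open>The bias is linear in the slope; on the support of \<open>\<sigma>\<close> the
      slope exceeds \<open>\<epsilon>\<close>, so \<open>\<epsilon> * I1 <= I2\<close> turns it into
      a fraction of the quadratic descent.\<close>
    also have "\<tau> / \<mu> * c1 * I1 \<le> 1 / (4 * L) * I2"
    proof -
      have "\<tau> / \<mu> * c1 = \<epsilon> / (4 * L)" using \<mu> c1 L by (simp add: \<tau>_def)
      then have "\<tau> / \<mu> * c1 * I1 = 1 / (4 * L) * (\<epsilon> * I1)" by simp
      also have "\<dots> \<le> 1 / (4 * L) * I2" using G\<epsilon> L unfolding I1_def I2_def by (intro mult_left_mono) auto
      finally show ?thesis .
    qed
    finally have "(\<integral>\<omega>. U \<omega> \<partial>M) \<le> - (a / L) * (1 / 2 * I2) + a * (1 / (4 * L) * I2) + a * (1 / (8 * L)) * I2 + \<theta> * (c1 * I0)"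
      using a by (simp add: mult_left_mono)
    also have "\<dots> = step_const * c1 * (\<alpha> k * \<delta> k + (\<alpha> k)\<^sup>2) * I0 - \<alpha> k * (1 / (8 * L)) * I2"
      using L by (simp add: \<theta>_def a_def field_simps)
    finally show ?thesis by (simp add: I0_def I2_def)
  qed
  ultimately show "\<exists>U. integrable M U \<and>
        (AE \<omega> in M. indicator (switched k) \<omega> * (\<sigma> \<omega> * (gap (Suc k) \<omega> - gap k \<omega>)) \<le> U \<omega>) \<and>
        (\<integral>\<omega>. U \<omega> \<partial>M) \<le> step_const * c1 * (\<alpha> k * \<delta> k + (\<alpha> k)\<^sup>2) * (\<integral>\<omega>. \<sigma> \<omega> \<partial>M)
          - \<alpha> k * (1 / (8 * L)) * (\<integral>\<omega>. \<sigma> \<omega> * (slope k \<omega>)\<^sup>2 \<partial>M)"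
    unfolding J_def by blast
qed

section \<open>Gradients that are small infinitely often\<close>

lemma eventually_small_step:
  "eventually (\<lambda>k. \<delta> k \<le> 1 \<and> step_const * (\<delta> k + \<alpha> k) \<le> 1 / (8 * L)) sequentially"
proof -
  have "(\<lambda>k. sqrt ((\<alpha> k)\<^sup>2)) \<longlonglongrightarrow> sqrt 0"
    by (intro tendsto_real_sqrt summable_LIMSEQ_zero sum_\<alpha>2)
  then have "\<alpha> \<longlonglongrightarrow> 0" using \<alpha> by (simp add: less_imp_le)
  then have "(\<lambda>k. step_const * (\<delta> k + \<alpha> k)) \<longlonglongrightarrow> step_const * (0 + 0)"
    by (intro tendsto_intros \<delta>_0)
  then have "eventually (\<lambda>k. step_const * (\<delta> k + \<alpha> k) < 1 / (8 * L)) sequentially"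
    using L by (intro order_tendstoD(2)) auto
  moreover have "eventually (\<lambda>k. \<delta> k < 1) sequentially" using \<delta>_0 by (intro order_tendstoD(2)) auto
  ultimately show ?thesis by eventually_elim simp
qed

lemma frequently_small_gradient:
  "AE \<omega> in M. \<forall>i K :: nat. \<exists>k\<ge>K. norm (Df (x k \<omega>)) \<le> 1 / real (Suc i)"
proof -
  have "AE \<omega> in M. \<forall>i K :: nat. \<exists>k\<ge>K. slope k \<omega> \<le> 1 / real (Suc i)"
  proof (rule drift.frequently_small)
    fix \<epsilon> :: real assume \<epsilon>: "0 < \<epsilon>"
    obtain K0 where K0: "\<And>k. K0 \<le> k \<Longrightarrow> \<delta> k \<le> 1 \<and> step_const * (\<delta> k + \<alpha> k) \<le> 1 / (8 * L)"
      using eventually_small_step unfolding eventually_sequentially by blast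
    let ?\<rho> = "min (1 / 2) ((\<epsilon> * \<mu> / (4 * L * c1))\<^sup>2 * c1)"
    let ?b = "\<lambda>k. step_const * c1 * (\<alpha> k * \<delta> k + (\<alpha> k)\<^sup>2)"
    have "0 < ?\<rho>" using \<epsilon> \<mu> L c1 by simp
    moreover have "summable ?b"
      using sum_\<delta>\<alpha> sum_\<alpha>2 by (intro summable_mult summable_add) (simp_all add: mult.commute)
    moreover have "0 \<le> ?b k" for k
      using step_const c1 \<alpha>[of k] \<delta>[of k] by (intro mult_nonneg_nonneg add_nonneg_nonneg) auto
    moreover have "\<forall>k\<ge>K0. drift.drift_bound \<epsilon> (1 / (8 * L)) ?\<rho> ?b k"
      using drift_bound_switched[OF \<epsilon>] K0 by blast
    moreover have "0 < 1 / (8 * L)" using L by simp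
    ultimately show "\<exists>\<kappa>>0. \<exists>\<rho>>0. \<exists>b K0. summable b \<and> (\<forall>k. 0 \<le> b k) \<and>
      (\<forall>k\<ge>K0. drift.drift_bound \<epsilon> \<kappa> \<rho> b k)" by blast
  next
    fix \<epsilon> :: real and K :: nat assume \<epsilon>: "0 < \<epsilon>"
    \<comment> \<open>A path that never switches keeps \<open>Kf\<close> at most
      \<open>Kmax\<close>, and the line-search phase then drives its gradients to zero, against the
      assumed lower bound.\<close>
    show "AE \<omega> in M. (\<forall>k\<ge>K. \<epsilon> < slope k \<omega>) \<longrightarrow> (\<exists>k. \<omega> \<in> switched k)"
      using gradient_tendsto_0 AE_space
    proof eventually_elim
      case (elim \<omega>)
      show ?case
      proof (intro impI, rule ccontr)
        assume large: "\<forall>k\<ge>K. \<epsilon> < slope k \<omega>" and no: "\<nexists>k. \<omega> \<in> switched k"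
        have "Kf k \<omega> \<le> Kmax" for k
          using ind_rejections[OF elim(2), of k] no elim(2) by (auto simp: switched_def split: if_splits)
        with elim(1) have "(\<lambda>k. norm (Df (x k \<omega>))) \<longlonglongrightarrow> 0" by blast
        then have "eventually (\<lambda>k. slope k \<omega> < \<epsilon>) sequentially"
          unfolding slope_def using \<epsilon> by (rule order_tendstoD(2))
        then obtain n where "\<forall>k\<ge>n. slope k \<omega> < \<epsilon>" unfolding eventually_sequentially by blast
        then have "slope (max n K) \<omega> < \<epsilon>" "\<epsilon> < slope (max n K) \<omega>" using large by auto
        then show False by simp
      qed
    qed
  qed
  then show ?thesis by (simp add: slope_def)
qed

lemma liminf_gradient: "AE \<omega> in M. liminf (\<lambda>k. ereal (norm (Df (x k \<omega>)))) = 0"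
  using frequently_small_gradient
proof eventually_elim
  case (elim \<omega>)
  let ?X = "\<lambda>k. ereal (norm (Df (x k \<omega>)))"
  have "liminf ?X \<le> 0"
  proof (rule ereal_le_epsilon2)
    fix r :: real assume "0 < r"
    then obtain i where i: "1 / real (Suc i) < r" using nat_approx_posE by blast
    have "(INF k\<in>{K..}. ?X k) \<le> ereal r" for K
    proof -
      obtain k where "K \<le> k" "norm (Df (x k \<omega>)) \<le> 1 / real (Suc i)" using elim by blast
      then show ?thesis using i by (intro INF_lower2[of k]) auto
    qed
    then show "liminf ?X \<le> 0 + ereal r" unfolding liminf_SUP_INF by (simp add: SUP_le_iff)
  qed
  moreover have "0 \<le> liminf ?X" by (intro Liminf_bounded) auto
  ultimately show ?case by (rule antisym)
qed

end

theorem theorem3p10: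
  fixes M :: "'w measure"
    and \<phi> :: "nat \<Rightarrow> real ^ 'n \<Rightarrow> real"
    and N Kmax :: nat
    and x0 :: "real ^ 'n" and B0 :: "real ^ 'n ^ 'n"
    and \<eta> \<beta> cmin Cmax phi_low L \<mu> c1 :: real
    and \<alpha> \<zeta> \<delta> :: "nat \<Rightarrow> real"
    and x g d :: "nat \<Rightarrow> 'w \<Rightarrow> real ^ 'n"
    and B :: "nat \<Rightarrow> 'w \<Rightarrow> real ^ 'n ^ 'n"
    and S D :: "nat \<Rightarrow> 'w \<Rightarrow> nat set"
    and t :: "nat \<Rightarrow> 'w \<Rightarrow> real"
    and Kf ind :: "nat \<Rightarrow> 'w \<Rightarrow> nat"
  assumes "prob_space M"
    \<comment> \<open>the problem\<close>
    and "N \<ge> 1"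
    and "\<And>i. i \<in> {1..N} \<Longrightarrow> twice_continuously_differentiable (\<phi> i)"
    \<comment> \<open>the parameters of the algorithm\<close>
    and "0 < \<eta>" "\<eta> < 1" "0 < \<beta>" "\<beta> < 1" "0 < cmin" "0 < Cmax"
    and "\<And>k. 0 < \<alpha> k" "\<And>k. 0 < \<zeta> k" "\<And>k. 0 \<le> \<delta> k"
    \<comment> \<open>the algorithm\<close>
    and "\<And>k. x k \<in> borel_measurable M" "\<And>k. B k \<in> borel_measurable M"
    and "\<And>k. g k \<in> borel_measurable M" "\<And>k. d k \<in> borel_measurable M"
    and "\<And>\<omega>. \<omega> \<in> space M \<Longrightarrow> x 0 \<omega> = x0 \<and> B 0 \<omega> = B0 \<and> Kf 0 \<omega> = 0 \<and> ind 0 \<omega> = 0"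
    and "\<And>k \<omega>. \<omega> \<in> space M \<Longrightarrow>
           LSOS_iteration \<phi> \<eta> \<beta> cmin Cmax Kmax (\<alpha> k) (\<zeta> k) (\<delta> k) (S k \<omega>) (D k \<omega>)
             (B k \<omega>) (g k \<omega>) (d k \<omega>) (t k \<omega>)
             (x k \<omega>, Kf k \<omega>, ind k \<omega>) (x (Suc k) \<omega>, Kf (Suc k) \<omega>, ind (Suc k) \<omega>)"
    and "\<And>k. uniform_sample M (history_algebra M x B S g d D k) N (S k)"
    and "\<And>k. uniform_sample M (mid_history_algebra M x B S g d D k) N (D k)"
    and "\<And>k. independent_of_algebra M (mid_history_algebra M x B S g d D k) (D k)"
    \<comment> \<open>the standing assumption\<close>
    and "\<And>k. cond_indep_gradient_matrix M (iterate_algebra M x k) (g k) (B k)"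
    \<comment> \<open>(A1)\<close>
    and "\<And>y. phi_low \<le> full_fun \<phi> N y"
    and "\<And>i. i \<in> {1..N} \<Longrightarrow> L-lipschitz_on UNIV (gradient (\<phi> i))"
    \<comment> \<open>(A2)\<close>
    and "0 < \<mu>" "0 < L"
    and "AE \<omega> in M. \<forall>k. transpose (B k \<omega>) = B k \<omega> \<and>
           loewner_le (mat \<mu>) (B k \<omega>) \<and> loewner_le (B k \<omega>) (mat L)"
    \<comment> \<open>(A3)\<close>
    and "0 < c1"
    and "\<And>k. AE \<omega> in M. vec_cond_exp M (iterate_algebra M x k) (g k) \<omega> =
           gradient (full_fun \<phi> N) (x k \<omega>)"
    and "\<And>k. AE \<omega> in M. nn_cond_exp M (iterate_algebra M x k)
             (\<lambda>\<omega>. ennreal ((norm (gradient (full_fun \<phi> N) (x k \<omega>) - g k \<omega>))\<^sup>2)) \<omega> \<le> ennreal c1"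
    \<comment> \<open>(A4)\<close>
    and "summable \<zeta>"
    and "filterlim (\<lambda>n. \<Sum>k<n. \<alpha> k) at_top sequentially"
    and "summable (\<lambda>k. (\<alpha> k)\<^sup>2)"
    and "\<delta> \<longlonglongrightarrow> 0"
    and "summable (\<lambda>k. \<delta> k * \<alpha> k)"
  shows "(AE \<omega> in M. liminf (\<lambda>k. ereal (norm (gradient (full_fun \<phi> N) (x k \<omega>)))) = 0) \<and>
         (AE \<omega> in M. (\<forall>k. Kf k \<omega> \<le> Kmax) \<longrightarrow>
            (\<lambda>k. norm (gradient (full_fun \<phi> N) (x k \<omega>))) \<longlonglongrightarrow> 0) \<and>
         (AE \<omega> in M. (\<forall>k. Kf k \<omega> \<le> Kmax) \<longrightarrow>
            (\<forall>z r. strict_mono r \<longrightarrow> (\<lambda>k. x (r k) \<omega>) \<longlonglongrightarrow> z \<longrightarrow>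
               gradient (full_fun \<phi> N) z = 0))"
proof -
  have "lsos_run M \<phi> N Kmax \<eta> \<beta> cmin Cmax phi_low L \<mu> c1 \<alpha> \<zeta> \<delta> x g d B S D t Kf ind"
  proof (intro lsos_run.intro lsos_run_axioms.intro)
    show "S k \<in> measurable M (count_space (Pow {1..N} - {{}}))" for k
      using assms(19)[of k] by (simp add: uniform_sample_def)
    show "cond_indep M (iterate_algebra M x k) (g k) (B k)" for k
      using assms(22)[of k] by (simp add: cond_indep_gradient_matrix_def)
    show "Kf 0 \<omega> = 0 \<and> ind 0 \<omega> = 0" if "\<omega> \<in> space M" for \<omega>
      using assms(17)[OF that] by simp
  qed (fact assms)+
  then interpret lsos_run M \<phi> N Kmax \<eta> \<beta> cmin Cmax phi_low L \<mu> c1 \<alpha> \<zeta> \<delta> x g d B S D t Kf ind .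
  show ?thesis
    unfolding gradient_f
  proof (intro conjI)
    show "AE \<omega> in M. (\<forall>k. Kf k \<omega> \<le> Kmax) \<longrightarrow>
        (\<forall>z r. strict_mono r \<longrightarrow> (\<lambda>k. x (r k) \<omega>) \<longlonglongrightarrow> z \<longrightarrow> Df z = 0)"
      using gradient_tendsto_0 by eventually_elim (blast intro: limit_point_stationary)
  qed (fact liminf_gradient gradient_tendsto_0)+
qed

end
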